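(* The morphisms of theories $J_{\Theta}\colon\Theta\to\Theta_a$, for $\Theta$ ranging over decorated theories, form the components of a natural transformation $J\colon H\Rightarrow U'\circ F'_{\mathrm{exp}}\colon\mathbf{T}_{\mathrm{dec}}\to\mathbf{T}_{\mathrm{eq}}$.
   Context: Size issues are ignored. Theories. A (equational) theory is a category with chosen finite products; its objects are called types and its morphisms terms. $\mathbf{T}_{\mathrm{eq}}$ is the category of theories and functors strictly preserving the chosen finite products. The chosen terminal type is denoted $1$, and $1\times X$ is identified with $X$ via the canonical isomorphism. Decorated theories. A decorated theory is a theory $\Theta$ together with a wide subtheory $\Theta_0$ (a subcategory with the same types, containing all identities and chosen projections, closed under composition and tuples, with the same chosen products). Terms of $\Theta_0$ are called pure. A morphism of decorated theories is a morphism of theories mapping pure terms to pure terms. This gives the category $\mathbf{T}_{\mathrm{dec}}$. The functor $H\colon\mathbf{T}_{\mathrm{dec}}\to\mathbf{T}_{\mathrm{eq}}$ maps a decorated theory $(\Theta,\Theta_0)$ to the theory $\Theta$. Parameterized theories and theories with a parameter. $\Pi_A$ is the theory freely generated by a type $A$; $\Pi_a$ is the theory freely generated by a type $A$ and a term $a\colon 1\to A$; $i_A\colon\Pi_A\to\Pi_a$ is the inclusion. $\mathbf{T}_A=\Pi_A\downarrow\mathbf{T}_{\mathrm{eq}}$ and $\mathbf{T}_a=\Pi_a\downarrow\mathbf{T}_{\mathrm{eq}}$ are the coslice categories (theories with a distinguished type $A$, respectively with a distinguished type $A$ and a distinguished constant $a\colon 1\to A$). $U'\colon\mathbf{T}_a\to\mathbf{T}_{\mathrm{eq}}$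 forgets that $A$ and $a$ are distinguished. The functor $F_{\mathrm{exp}}\colon\mathbf{T}_{\mathrm{dec}}\to\mathbf{T}_A$. The projections from $A\times X$ are $\mathrm{pr}_X\colon A\times X\to A$ and $\varepsilon_X\colon A\times X\to X$. $F_{\mathrm{exp}}\Theta$ is the parameterized theory $\Theta_A$ generated by: the theory $\Theta_0$ (all types and pure terms of $\Theta$, with their identities, composites, chosen products and tuples, so that there is a morphism of theories $\Theta_0\to\Theta_A$), a new type $A$ (the distinguished one), and a term $f'\colon A\times X\to Y$ for each term $f\colon X\to Y$ of $\Theta$, subject to the relations: $f'=f\circ\varepsilon_X$ if $f$ is pure; $(g\circ f)'=g'\circ\langle \mathrm{pr}_X,f'\rangle$ for $f\colon X\to Y$, $g\colon Y\to Z$; and $\langle f_1,\dots,f_n\rangle'=\langle f_1',\dots,f_n'\rangle$ for all $n\ge 0$. That is, morphisms of theories $\Theta_A\to\Theta'$ correspond bijectively to a morphism of theories $\Theta_0\to\Theta'$, a type of $\Theta'$, and a family of terms of $\Theta'$ satisfying these relations. On a morphism $\varphi$ of decorated theories, $F_{\mathrm{exp}}\varphi$ sends $A$ to $A$, each pure $f$ to $\varphi(f)$ and each $f'$ to $\varphi(f)'$. The functor $F'_{\mathrm{exp}}\colon\mathbf{T}_{\mathrm{dec}}\to\mathbf{T}_a$ is the composite of $F_{\mathrm{exp}}$ with the functor $\mathbf{T}_A\to\mathbf{T}_a$ mapping $\gamma_A\colon\Pi_A\to\Theta_A$ to $\gamma_a\colon\Pi_a\to\Theta_a$, the pushout of $\gamma_A$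 along $i_A$ (so $\Theta_a$ is $\Theta_A$ with a freely added term $a\colon 1\to A$). For a decorated theory $\Theta$, $\Theta_a$ denotes the underlying theory of $F'_{\mathrm{exp}}\Theta$, which is a theory under $\Theta_0$. The morphism $J_\Theta\colon\Theta\to\Theta_a$ is the morphism of theories under $\Theta_0$ which maps each type $X$ to $X$ and each term $f\colon X\to Y$ to $f'\circ(a\times\mathrm{id}_X)\colon X\to Y$. *)

theory Defs
  imports Main "HOL-Library.FuncSet"
begin

section \<open>Theories: categories with chosen finite products\<close>

text \<open>
  Objects are the types and arrows the terms of the theory; \<open>Comp T g f\<close> is \<open>g \<circ> f\<close>.
  Every finite list \<open>Xs\<close> of objects has a chosen product \<open>Prd T Xs\<close> with chosen projections
  \<open>Prj T Xs i\<close>, for \<open>i < length Xs\<close>. The chosen terminal object is \<open>Prd T []\<close> and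
  \<open>X \<times> Y\<close> is \<open>Prd T [X, Y]\<close>.
\<close>

record ('o, 'm) thy =
  Obj :: "'o set"
  Arr :: "'m set"
  Dom :: "'m \<Rightarrow> 'o"
  Cod :: "'m \<Rightarrow> 'o"
  Ident :: "'o \<Rightarrow> 'm"
  Comp :: "'m \<Rightarrow> 'm \<Rightarrow> 'm"
  Prd :: "'o list \<Rightarrow> 'o"
  Prj :: "'o list \<Rightarrow> nat \<Rightarrow> 'm"

definition hom :: "('o, 'm, 'z) thy_scheme \<Rightarrow> 'o \<Rightarrow> 'o \<Rightarrow> 'm set" where
  "hom T X Y = {f \<in> Arr T. Dom T f = X \<and> Cod T f = Y}"

locale category =
  fixes T :: "('o, 'm, 'z) thy_scheme"
  assumes dom_closed: "f \<in> Arr T \<Longrightarrow> Dom T f \<in> Obj T"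
    and cod_closed: "f \<in> Arr T \<Longrightarrow> Cod T f \<in> Obj T"
    and ident_hom: "X \<in> Obj T \<Longrightarrow> Ident T X \<in> hom T X X"
    and comp_hom: "\<lbrakk>f \<in> hom T X Y; g \<in> hom T Y Z\<rbrakk> \<Longrightarrow> Comp T g f \<in> hom T X Z"
    and ident_left: "f \<in> hom T X Y \<Longrightarrow> Comp T (Ident T Y) f = f"
    and ident_right: "f \<in> hom T X Y \<Longrightarrow> Comp T f (Ident T X) = f"
    and comp_assoc: "\<lbrakk>f \<in> hom T W X; g \<in> hom T X Y; h \<in> hom T Y Z\<rbrakk>
      \<Longrightarrow> Comp T h (Comp T g f) = Comp T (Comp T h g) f"

locale eq_theory = category +
  assumes prd_closed: "Xs \<in> lists (Obj T) \<Longrightarrow> Prd T Xs \<in> Obj T"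
    and prj_hom: "\<lbrakk>Xs \<in> lists (Obj T); i < length Xs\<rbrakk> \<Longrightarrow> Prj T Xs i \<in> hom T (Prd T Xs) (Xs ! i)"
    and prd_universal: "\<lbrakk>X \<in> Obj T; Xs \<in> lists (Obj T); length fs = length Xs;
        \<And>i. i < length Xs \<Longrightarrow> fs ! i \<in> hom T X (Xs ! i)\<rbrakk>
      \<Longrightarrow> \<exists>!h. h \<in> hom T X (Prd T Xs) \<and> (\<forall>i < length Xs. Comp T (Prj T Xs i) h = fs ! i)"

text \<open>The source \<open>X\<close> is an argument because it is not determined by \<open>fs\<close> when \<open>fs = []\<close>.\<close>

definition tuple :: "('o, 'm, 'z) thy_scheme \<Rightarrow> 'o \<Rightarrow> 'm list \<Rightarrow> 'm" where
  "tuple T X fs = (THE h. h \<in> hom T X (Prd T (map (Cod T) fs)) \<and>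
     (\<forall>i < length fs. Comp T (Prj T (map (Cod T) fs) i) h = fs ! i))"

definition cross :: "('o, 'm, 'z) thy_scheme \<Rightarrow> 'm \<Rightarrow> 'm \<Rightarrow> 'm" where
  "cross T f g = (let XY = [Dom T f, Dom T g]
     in tuple T (Prd T XY) [Comp T f (Prj T XY 0), Comp T g (Prj T XY 1)])"

text \<open>The canonical isomorphism \<open>X \<cong> 1 \<times> X\<close>.\<close>

definition unit_iso :: "('o, 'm, 'z) thy_scheme \<Rightarrow> 'o \<Rightarrow> 'm" where
  "unit_iso T X = tuple T X [tuple T X [], Ident T X]"

text \<open>
  Morphisms are taken to be extensional (\<open>undefined\<close> outside the source theory), so that equality
  of morphisms is HOL equality.
\<close>

record ('o, 'm, 'p, 'n) thy_mor =
  on_obj :: "'o \<Rightarrow> 'p"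
  on_arr :: "'m \<Rightarrow> 'n"

definition theory_morphism ::
  "('o, 'm, 'y) thy_scheme \<Rightarrow> ('p, 'n, 'z) thy_scheme \<Rightarrow> ('o, 'm, 'p, 'n) thy_mor \<Rightarrow> bool" where
  "theory_morphism S T F \<longleftrightarrow> eq_theory S \<and> eq_theory T \<and>
     on_obj F \<in> Obj S \<rightarrow>\<^sub>E Obj T \<and> on_arr F \<in> Arr S \<rightarrow>\<^sub>E Arr T \<and>
     (\<forall>f \<in> Arr S. Dom T (on_arr F f) = on_obj F (Dom S f) \<and> Cod T (on_arr F f) = on_obj F (Cod S f)) \<and>
     (\<forall>X \<in> Obj S. on_arr F (Ident S X) = Ident T (on_obj F X)) \<and>
     (\<forall>f \<in> Arr S. \<forall>g \<in> Arr S. Cod S f = Dom S g \<longrightarrow>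
        on_arr F (Comp S g f) = Comp T (on_arr F g) (on_arr F f)) \<and>
     (\<forall>Xs \<in> lists (Obj S). on_obj F (Prd S Xs) = Prd T (map (on_obj F) Xs) \<and>
        (\<forall>i < length Xs. on_arr F (Prj S Xs i) = Prj T (map (on_obj F) Xs) i))"

definition mor_id :: "('o, 'm, 'z) thy_scheme \<Rightarrow> ('o, 'm, 'o, 'm) thy_mor" where
  "mor_id S = \<lparr>on_obj = (\<lambda>X \<in> Obj S. X), on_arr = (\<lambda>f \<in> Arr S. f)\<rparr>"

text \<open>\<open>mor_comp S G F\<close> is \<open>G \<circ> F\<close>, where \<open>S\<close> is the source of \<open>F\<close>.\<close>

definition mor_comp :: "('o, 'm, 'z) thy_scheme \<Rightarrow> ('p, 'n, 'q, 'k) thy_mor \<Rightarrow>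
    ('o, 'm, 'p, 'n) thy_mor \<Rightarrow> ('o, 'm, 'q, 'k) thy_mor" where
  "mor_comp S G F = \<lparr>on_obj = compose (Obj S) (on_obj G) (on_obj F),
                     on_arr = compose (Arr S) (on_arr G) (on_arr F)\<rparr>"


section \<open>Decorated theories\<close>

record ('o, 'm) dec_thy = "('o, 'm) thy" +
  PureArr :: "'m set"

locale decorated_theory = eq_theory \<Theta> for \<Theta> :: "('o, 'm, 'z) dec_thy_scheme" +
  assumes pure_subset: "PureArr \<Theta> \<subseteq> Arr \<Theta>"
    and pure_ident: "X \<in> Obj \<Theta> \<Longrightarrow> Ident \<Theta> X \<in> PureArr \<Theta>"
    and pure_prj: "\<lbrakk>Xs \<in> lists (Obj \<Theta>); i < length Xs\<rbrakk> \<Longrightarrow> Prj \<Theta> Xs i \<in> PureArr \<Theta>"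
    and pure_comp: "\<lbrakk>f \<in> PureArr \<Theta>; g \<in> PureArr \<Theta>; Cod \<Theta> f = Dom \<Theta> g\<rbrakk> \<Longrightarrow> Comp \<Theta> g f \<in> PureArr \<Theta>"
    and pure_tuple: "\<lbrakk>X \<in> Obj \<Theta>; fs \<in> lists (PureArr \<Theta>); \<And>f. f \<in> set fs \<Longrightarrow> Dom \<Theta> f = X\<rbrakk>
      \<Longrightarrow> tuple \<Theta> X fs \<in> PureArr \<Theta>"

text \<open>The wide subtheory \<open>\<Theta>\<^sub>0\<close> of pure terms and its inclusion into \<open>\<Theta>\<close>.\<close>

definition pure_part :: "('o, 'm) dec_thy \<Rightarrow> ('o, 'm) thy" where
  "pure_part \<Theta> = (thy.truncate \<Theta>)\<lparr>Arr := PureArr \<Theta>\<rparr>"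

definition pure_incl :: "('o, 'm) dec_thy \<Rightarrow> ('o, 'm, 'o, 'm) thy_mor" where
  "pure_incl \<Theta> = mor_id (pure_part \<Theta>)"

definition dec_morphism ::
  "('o, 'm) dec_thy \<Rightarrow> ('p, 'n) dec_thy \<Rightarrow> ('o, 'm, 'p, 'n) thy_mor \<Rightarrow> bool" where
  "dec_morphism \<Theta> \<Theta>' \<phi> \<longleftrightarrow> decorated_theory \<Theta> \<and> decorated_theory \<Theta>' \<and>
     theory_morphism \<Theta> \<Theta>' \<phi> \<and> on_arr \<phi> ` PureArr \<Theta> \<subseteq> PureArr \<Theta>'"

definition H_obj :: "('o, 'm) dec_thy \<Rightarrow> ('o, 'm) thy" where
  "H_obj \<Theta> = thy.truncate \<Theta>"

definition H_mor :: "('o, 'm, 'p, 'n) thy_mor \<Rightarrow> ('o, 'm, 'p, 'n) thy_mor" where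
  "H_mor \<phi> = \<phi>"


section \<open>Theories generated by types, terms and relations\<close>

text \<open>
  \<open>TmTuple X ts\<close> is the tuple \<open>\<langle>t\<^sub>1, \<dots>, t\<^sub>n\<rangle>\<close> with source \<open>X\<close>.
\<close>

datatype 'g ty = TyGen 'g | TyPrd "'g ty list"

datatype ('g, 't) tm =
    TmGen 't
  | TmId "'g ty"
  | TmComp "('g, 't) tm" "('g, 't) tm"
  | TmPrj "'g ty list" nat
  | TmTuple "'g ty" "('g, 't) tm list"

record ('g, 't) presentation =
  TyGens :: "'g set"
  TmGens :: "'t set"
  GDom :: "'t \<Rightarrow> 'g ty"
  GCod :: "'t \<Rightarrow> 'g ty"
  TyRel :: "('g ty \<times> 'g ty) set"
  TmRel :: "(('g, 't) tm \<times> ('g, 't) tm) set"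

definition wf_ty :: "('g, 't) presentation \<Rightarrow> 'g ty \<Rightarrow> bool" where
  "wf_ty P X \<longleftrightarrow> set_ty X \<subseteq> TyGens P"

text \<open>
  Type expressions are identified by the least congruence \<open>ty_eq\<close> containing \<open>TyRel\<close>. The
  well-formedness premises here and below make \<open>presented P\<close> a theory for every \<open>P\<close>; in the
  presentations used later all generators and relations are well-formed, so none is discarded.
\<close>

inductive ty_eq :: "('g, 't) presentation \<Rightarrow> 'g ty \<Rightarrow> 'g ty \<Rightarrow> bool" for P where
  refl: "wf_ty P X \<Longrightarrow> ty_eq P X X"
| sym: "ty_eq P X Y \<Longrightarrow> ty_eq P Y X"
| trans: "\<lbrakk>ty_eq P X Y; ty_eq P Y Z\<rbrakk> \<Longrightarrow> ty_eq P X Z"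
| rel: "\<lbrakk>(X, Y) \<in> TyRel P; wf_ty P X; wf_ty P Y\<rbrakk> \<Longrightarrow> ty_eq P X Y"
| prd: "list_all2 (ty_eq P) Xs Ys \<Longrightarrow> ty_eq P (TyPrd Xs) (TyPrd Ys)"

text \<open>\<open>tm_typed P t X Y\<close> means that \<open>t\<close> is a well-formed term expression \<open>X \<rightarrow> Y\<close>.\<close>

inductive tm_typed :: "('g, 't) presentation \<Rightarrow> ('g, 't) tm \<Rightarrow> 'g ty \<Rightarrow> 'g ty \<Rightarrow> bool" for P where
  gen: "\<lbrakk>t \<in> TmGens P; wf_ty P (GDom P t); wf_ty P (GCod P t)\<rbrakk>
    \<Longrightarrow> tm_typed P (TmGen t) (GDom P t) (GCod P t)"
| ident: "wf_ty P X \<Longrightarrow> tm_typed P (TmId X) X X"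
| comp: "\<lbrakk>tm_typed P t X Y; tm_typed P u Y Z\<rbrakk> \<Longrightarrow> tm_typed P (TmComp u t) X Z"
| prj: "\<lbrakk>wf_ty P (TyPrd Xs); i < length Xs\<rbrakk> \<Longrightarrow> tm_typed P (TmPrj Xs i) (TyPrd Xs) (Xs ! i)"
| tuple: "\<lbrakk>wf_ty P X; list_all2 (\<lambda>t Y. tm_typed P t X Y) ts Ys\<rbrakk>
    \<Longrightarrow> tm_typed P (TmTuple X ts) X (TyPrd Ys)"
| conv: "\<lbrakk>tm_typed P t X Y; ty_eq P X X'; ty_eq P Y Y'\<rbrakk> \<Longrightarrow> tm_typed P t X' Y'"

text \<open>
  Well-formed term expressions are identified by the least congruence \<open>tm_eq\<close> containing \<open>TmRel\<close>
  and the laws of categories and of finite products.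
\<close>

inductive tm_eq :: "('g, 't) presentation \<Rightarrow> ('g, 't) tm \<Rightarrow> ('g, 't) tm \<Rightarrow> bool" for P where
  refl: "tm_typed P t X Y \<Longrightarrow> tm_eq P t t"
| sym: "tm_eq P t u \<Longrightarrow> tm_eq P u t"
| trans: "\<lbrakk>tm_eq P t u; tm_eq P u v\<rbrakk> \<Longrightarrow> tm_eq P t v"
| rel: "\<lbrakk>(t, u) \<in> TmRel P; tm_typed P t X Y; tm_typed P u X Y\<rbrakk> \<Longrightarrow> tm_eq P t u"
| ident: "ty_eq P X X' \<Longrightarrow> tm_eq P (TmId X) (TmId X')"
| comp: "\<lbrakk>tm_typed P t X Y; tm_typed P u Y Z; tm_eq P t t'; tm_eq P u u'\<rbrakk>
    \<Longrightarrow> tm_eq P (TmComp u t) (TmComp u' t')"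
| prj: "\<lbrakk>list_all2 (ty_eq P) Xs Xs'; i < length Xs\<rbrakk> \<Longrightarrow> tm_eq P (TmPrj Xs i) (TmPrj Xs' i)"
| tuple: "\<lbrakk>ty_eq P X X'; list_all2 (\<lambda>t Y. tm_typed P t X Y) ts Ys; list_all2 (tm_eq P) ts ts'\<rbrakk>
    \<Longrightarrow> tm_eq P (TmTuple X ts) (TmTuple X' ts')"
| ident_left: "tm_typed P t X Y \<Longrightarrow> tm_eq P (TmComp (TmId Y) t) t"
| ident_right: "tm_typed P t X Y \<Longrightarrow> tm_eq P (TmComp t (TmId X)) t"
| assoc: "\<lbrakk>tm_typed P t W X; tm_typed P u X Y; tm_typed P v Y Z\<rbrakk>
    \<Longrightarrow> tm_eq P (TmComp v (TmComp u t)) (TmComp (TmComp v u) t)"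
| prj_tuple: "\<lbrakk>wf_ty P X; list_all2 (\<lambda>t Y. tm_typed P t X Y) ts Ys; i < length ts\<rbrakk>
    \<Longrightarrow> tm_eq P (TmComp (TmPrj Ys i) (TmTuple X ts)) (ts ! i)"
| tuple_prj: "tm_typed P t X (TyPrd Ys)
    \<Longrightarrow> tm_eq P (TmTuple X (map (\<lambda>i. TmComp (TmPrj Ys i) t) [0..<length Ys])) t"

definition ty_class :: "('g, 't) presentation \<Rightarrow> 'g ty \<Rightarrow> 'g ty set" where
  "ty_class P X = {Y. ty_eq P X Y}"

definition tm_class :: "('g, 't) presentation \<Rightarrow> ('g, 't) tm \<Rightarrow> ('g, 't) tm set" where
  "tm_class P t = {u. tm_eq P t u}"

definition rep :: "'a set \<Rightarrow> 'a" where
  "rep C = (SOME x. x \<in> C)"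

text \<open>
  The types and terms are congruence classes. All elements of a class of terms have the same sources
  and targets up to \<open>ty_eq\<close>, so that \<open>Dom\<close> and \<open>Cod\<close> are classes of types.
\<close>

definition presented :: "('g, 't) presentation \<Rightarrow> ('g ty set, ('g, 't) tm set) thy" where
  "presented P = \<lparr>
     Obj = {ty_class P X | X. wf_ty P X},
     Arr = {tm_class P t | t X Y. tm_typed P t X Y},
     Dom = (\<lambda>c. {X. \<exists>t \<in> c. \<exists>Y. tm_typed P t X Y}),
     Cod = (\<lambda>c. {Y. \<exists>t \<in> c. \<exists>X. tm_typed P t X Y}),
     Ident = (\<lambda>C. tm_class P (TmId (rep C))),
     Comp = (\<lambda>d c. tm_class P (TmComp (rep d) (rep c))),
     Prd = (\<lambda>Cs. ty_class P (TyPrd (map rep Cs))),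
     Prj = (\<lambda>Cs i. tm_class P (TmPrj (map rep Cs) i))\<rparr>"

primrec ty_eval :: "('p, 'n, 'z) thy_scheme \<Rightarrow> ('g \<Rightarrow> 'p) \<Rightarrow> 'g ty \<Rightarrow> 'p" where
  "ty_eval T a (TyGen g) = a g"
| "ty_eval T a (TyPrd Xs) = Prd T (map (ty_eval T a) Xs)"

primrec tm_eval :: "('p, 'n, 'z) thy_scheme \<Rightarrow> ('g \<Rightarrow> 'p) \<Rightarrow> ('t \<Rightarrow> 'n) \<Rightarrow> ('g, 't) tm \<Rightarrow> 'n" where
  "tm_eval T a b (TmGen t) = b t"
| "tm_eval T a b (TmId X) = Ident T (ty_eval T a X)"
| "tm_eval T a b (TmComp u t) = Comp T (tm_eval T a b u) (tm_eval T a b t)"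
| "tm_eval T a b (TmPrj Xs i) = Prj T (map (ty_eval T a) Xs) i"
| "tm_eval T a b (TmTuple X ts) = tuple T (ty_eval T a X) (map (tm_eval T a b) ts)"

text \<open>
  The morphism from \<open>presented P\<close> to \<open>T\<close> that is given on the generators by \<open>a\<close> and \<open>b\<close>.
\<close>

definition induced :: "('g, 't) presentation \<Rightarrow> ('p, 'n, 'z) thy_scheme \<Rightarrow> ('g \<Rightarrow> 'p) \<Rightarrow> ('t \<Rightarrow> 'n) \<Rightarrow>
    ('g ty set, ('g, 't) tm set, 'p, 'n) thy_mor" where
  "induced P T a b = \<lparr>
     on_obj = (\<lambda>C \<in> Obj (presented P). ty_eval T a (rep C)),
     on_arr = (\<lambda>c \<in> Arr (presented P). tm_eval T a b (rep c))\<rparr>"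

text \<open>
  The relations stating that the generators \<open>i X\<close> and \<open>j f\<close>, for the types \<open>X\<close> and the terms \<open>f\<close> of a
  theory \<open>S\<close>, form a morphism from \<open>S\<close>. Tuples need no relation: they are determined by the projections.
\<close>

definition mor_ty_rel :: "('o, 'm, 'z) thy_scheme \<Rightarrow> ('o \<Rightarrow> 'g) \<Rightarrow> ('g ty \<times> 'g ty) set" where
  "mor_ty_rel S i = {(TyGen (i (Prd S Xs)), TyPrd (map (\<lambda>X. TyGen (i X)) Xs)) | Xs. Xs \<in> lists (Obj S)}"

definition mor_tm_rel ::
  "('o, 'm, 'z) thy_scheme \<Rightarrow> ('o \<Rightarrow> 'g) \<Rightarrow> ('m \<Rightarrow> 't) \<Rightarrow> (('g, 't) tm \<times> ('g, 't) tm) set" where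
  "mor_tm_rel S i j =
     {(TmGen (j (Ident S X)), TmId (TyGen (i X))) | X. X \<in> Obj S} \<union>
     {(TmGen (j (Comp S g f)), TmComp (TmGen (j g)) (TmGen (j f))) | g f.
        f \<in> Arr S \<and> g \<in> Arr S \<and> Cod S f = Dom S g} \<union>
     {(TmGen (j (Prj S Xs k)), TmPrj (map (\<lambda>X. TyGen (i X)) Xs) k) | Xs k.
        Xs \<in> lists (Obj S) \<and> k < length Xs}"


section \<open>Pushouts and coslice categories of theories\<close>

text \<open>The pushout of \<open>F : S \<rightarrow> T\<^sub>1\<close> and \<open>G : S \<rightarrow> T\<^sub>2\<close>, with its two coprojections.\<close>

definition pushout_pres :: "('o, 'm) thy \<Rightarrow> ('o1, 'm1) thy \<Rightarrow> ('o2, 'm2) thy \<Rightarrow>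
    ('o, 'm, 'o1, 'm1) thy_mor \<Rightarrow> ('o, 'm, 'o2, 'm2) thy_mor \<Rightarrow>
    ('o1 + 'o2, 'm1 + 'm2) presentation" where
  "pushout_pres S T1 T2 F G = \<lparr>
     TyGens = Obj T1 <+> Obj T2,
     TmGens = Arr T1 <+> Arr T2,
     GDom = case_sum (\<lambda>f. TyGen (Inl (Dom T1 f))) (\<lambda>f. TyGen (Inr (Dom T2 f))),
     GCod = case_sum (\<lambda>f. TyGen (Inl (Cod T1 f))) (\<lambda>f. TyGen (Inr (Cod T2 f))),
     TyRel = mor_ty_rel T1 Inl \<union> mor_ty_rel T2 Inr \<union>
       {(TyGen (Inl (on_obj F X)), TyGen (Inr (on_obj G X))) | X. X \<in> Obj S},
     TmRel = mor_tm_rel T1 Inl Inl \<union> mor_tm_rel T2 Inr Inr \<union>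
       {(TmGen (Inl (on_arr F f)), TmGen (Inr (on_arr G f))) | f. f \<in> Arr S}\<rparr>"

definition pushout_in1 where
  "pushout_in1 S T1 T2 F G = (let P = pushout_pres S T1 T2 F G in
     \<lparr>on_obj = (\<lambda>X \<in> Obj T1. ty_class P (TyGen (Inl X))),
      on_arr = (\<lambda>f \<in> Arr T1. tm_class P (TmGen (Inl f)))\<rparr>)"

definition pushout_in2 where
  "pushout_in2 S T1 T2 F G = (let P = pushout_pres S T1 T2 F G in
     \<lparr>on_obj = (\<lambda>X \<in> Obj T2. ty_class P (TyGen (Inr X))),
      on_arr = (\<lambda>f \<in> Arr T2. tm_class P (TmGen (Inr f)))\<rparr>)"

text \<open>An object of the coslice category of theories under \<open>S\<close> is a pair of a theory and a morphism from \<open>S\<close>.\<close>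

definition coslice_object :: "('s, 'r) thy \<Rightarrow> ('o, 'm) thy \<times> ('s, 'r, 'o, 'm) thy_mor \<Rightarrow> bool" where
  "coslice_object S Q \<longleftrightarrow> theory_morphism S (fst Q) (snd Q)"

definition coslice_morphism :: "('s, 'r) thy \<Rightarrow> ('o, 'm) thy \<times> ('s, 'r, 'o, 'm) thy_mor \<Rightarrow>
    ('p, 'n) thy \<times> ('s, 'r, 'p, 'n) thy_mor \<Rightarrow> ('o, 'm, 'p, 'n) thy_mor \<Rightarrow> bool" where
  "coslice_morphism S Q Q' F \<longleftrightarrow> coslice_object S Q \<and> coslice_object S Q' \<and>
     theory_morphism (fst Q) (fst Q') F \<and> mor_comp S F (snd Q) = snd Q'"


section \<open>Parameterized theories and theories with a parameter\<close>

text \<open>\<open>\<Pi>\<^sub>A\<close> has one generating type \<open>()\<close>; \<open>\<Pi>\<^sub>a\<close> has moreover one generating term \<open>() : 1 \<rightarrow> ()\<close>.\<close>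

definition Pi_A_pres :: "(unit, unit) presentation" where
  "Pi_A_pres = \<lparr>TyGens = {()}, TmGens = {}, GDom = (\<lambda>_. TyPrd []), GCod = (\<lambda>_. TyGen ()),
     TyRel = {}, TmRel = {}\<rparr>"

definition Pi_a_pres :: "(unit, unit) presentation" where
  "Pi_a_pres = \<lparr>TyGens = {()}, TmGens = {()}, GDom = (\<lambda>_. TyPrd []), GCod = (\<lambda>_. TyGen ()),
     TyRel = {}, TmRel = {}\<rparr>"

type_synonym pi_ty = "unit ty set"
type_synonym pi_tm = "(unit, unit) tm set"

definition Pi_A :: "(pi_ty, pi_tm) thy" where
  "Pi_A = presented Pi_A_pres"

definition Pi_a :: "(pi_ty, pi_tm) thy" where
  "Pi_a = presented Pi_a_pres"

text \<open>
  A morphism from \<open>\<Pi>\<^sub>A\<close> is given by the image of the generating type only; the last argument of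
  \<open>induced\<close> is irrelevant, as there is no generating term.
\<close>

definition from_Pi_A :: "('o, 'm) thy \<Rightarrow> 'o \<Rightarrow> (pi_ty, pi_tm, 'o, 'm) thy_mor" where
  "from_Pi_A T X = induced Pi_A_pres T (\<lambda>_. X) (\<lambda>_. undefined)"

definition i_A :: "(pi_ty, pi_tm, pi_ty, pi_tm) thy_mor" where
  "i_A = from_Pi_A Pi_a (ty_class Pi_a_pres (TyGen ()))"

definition a_generator :: pi_tm where
  "a_generator = tm_class Pi_a_pres (TmGen ())"

type_synonym ('o, 'm) thy_with_type = "('o, 'm) thy \<times> (pi_ty, pi_tm, 'o, 'm) thy_mor"
type_synonym ('o, 'm) po_ty = "('o + pi_ty) ty set"
type_synonym ('o, 'm) po_tm = "('o + pi_ty, 'm + pi_tm) tm set"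

text \<open>
  The functor \<open>T\<^sub>A \<rightarrow> T\<^sub>a\<close>: it maps \<open>\<gamma>\<^sub>A : \<Pi>\<^sub>A \<rightarrow> \<Theta>\<^sub>A\<close> to its pushout along \<open>i\<^sub>A\<close>, and a morphism to the
  induced morphism of pushouts. \<open>add_const_in\<close> is the coprojection \<open>\<Theta>\<^sub>A \<rightarrow> \<Theta>\<^sub>a\<close>.
\<close>

definition add_const_pres :: "('o, 'm) thy_with_type \<Rightarrow> ('o + pi_ty, 'm + pi_tm) presentation" where
  "add_const_pres Q = pushout_pres Pi_A (fst Q) Pi_a (snd Q) i_A"

definition add_const_in :: "('o, 'm) thy_with_type \<Rightarrow>
    ('o, 'm, ('o, 'm) po_ty, ('o, 'm) po_tm) thy_mor" where
  "add_const_in Q = pushout_in1 Pi_A (fst Q) Pi_a (snd Q) i_A"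

definition add_const_obj ::
  "('o, 'm) thy_with_type \<Rightarrow> (('o, 'm) po_ty, ('o, 'm) po_tm) thy_with_type" where
  "add_const_obj Q = (presented (add_const_pres Q), pushout_in2 Pi_A (fst Q) Pi_a (snd Q) i_A)"

definition add_const_mor :: "('o, 'm) thy_with_type \<Rightarrow> ('p, 'n) thy_with_type \<Rightarrow>
    ('o, 'm, 'p, 'n) thy_mor \<Rightarrow>
    (('o, 'm) po_ty, ('o, 'm) po_tm, ('p, 'n) po_ty, ('p, 'n) po_tm) thy_mor" where
  "add_const_mor Q Q' F = induced (add_const_pres Q) (fst (add_const_obj Q'))
     (case_sum (\<lambda>X. on_obj (add_const_in Q') (on_obj F X)) (on_obj (snd (add_const_obj Q'))))
     (case_sum (\<lambda>f. on_arr (add_const_in Q') (on_arr F f)) (on_arr (snd (add_const_obj Q'))))"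

definition U'_obj :: "('o, 'm) thy_with_type \<Rightarrow> ('o, 'm) thy" where
  "U'_obj Q = fst Q"

definition U'_mor :: "('o, 'm, 'p, 'n) thy_mor \<Rightarrow> ('o, 'm, 'p, 'n) thy_mor" where
  "U'_mor F = F"


section \<open>The functors \<open>F\<^sub>e\<^sub>x\<^sub>p\<close> and \<open>F'\<^sub>e\<^sub>x\<^sub>p\<close>\<close>

text \<open>
  The generators of \<open>\<Theta>\<^sub>A\<close>: the types of \<open>\<Theta>\<close> and the new type \<open>A\<close>; the pure terms of \<open>\<Theta>\<close> and the
  terms \<open>f'\<close>.
\<close>

datatype 'o exp_tygen = OldTy 'o | ParTy
datatype 'm exp_tmgen = OldTm 'm | Prime 'm

definition par_times :: "'o \<Rightarrow> 'o exp_tygen ty list" where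
  "par_times X = [TyGen ParTy, TyGen (OldTy X)]"

definition pr :: "'o \<Rightarrow> ('o exp_tygen, 'm exp_tmgen) tm" where
  "pr X = TmPrj (par_times X) 0"

definition eps :: "'o \<Rightarrow> ('o exp_tygen, 'm exp_tmgen) tm" where
  "eps X = TmPrj (par_times X) 1"

definition exp_pres :: "('o, 'm) dec_thy \<Rightarrow> ('o exp_tygen, 'm exp_tmgen) presentation" where
  "exp_pres \<Theta> = \<lparr>
     TyGens = OldTy ` Obj \<Theta> \<union> {ParTy},
     TmGens = OldTm ` PureArr \<Theta> \<union> Prime ` Arr \<Theta>,
     GDom = case_exp_tmgen (\<lambda>f. TyGen (OldTy (Dom \<Theta> f))) (\<lambda>f. TyPrd (par_times (Dom \<Theta> f))),
     GCod = case_exp_tmgen (\<lambda>f. TyGen (OldTy (Cod \<Theta> f))) (\<lambda>f. TyGen (OldTy (Cod \<Theta> f))),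
     TyRel = mor_ty_rel (pure_part \<Theta>) OldTy,
     TmRel = mor_tm_rel (pure_part \<Theta>) OldTy OldTm \<union>
       {(TmGen (Prime f), TmComp (TmGen (OldTm f)) (eps (Dom \<Theta> f))) | f. f \<in> PureArr \<Theta>} \<union>
       {(TmGen (Prime (Comp \<Theta> g f)),
         TmComp (TmGen (Prime g))
           (TmTuple (TyPrd (par_times (Dom \<Theta> f))) [pr (Dom \<Theta> f), TmGen (Prime f)])) | g f.
         f \<in> Arr \<Theta> \<and> g \<in> Arr \<Theta> \<and> Cod \<Theta> f = Dom \<Theta> g} \<union>
       {(TmGen (Prime (tuple \<Theta> X fs)),
         TmTuple (TyPrd (par_times X)) (map (\<lambda>f. TmGen (Prime f)) fs)) | X fs.
         X \<in> Obj \<Theta> \<and> fs \<in> lists (Arr \<Theta>) \<and> (\<forall>f \<in> set fs. Dom \<Theta> f = X)}\<rparr>"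

type_synonym ('o, 'm) exp_ty = "'o exp_tygen ty set"
type_synonym ('o, 'm) exp_tm = "('o exp_tygen, 'm exp_tmgen) tm set"

definition exp_type :: "('o, 'm) dec_thy \<Rightarrow> 'o exp_tygen \<Rightarrow> ('o, 'm) exp_ty" where
  "exp_type \<Theta> g = ty_class (exp_pres \<Theta>) (TyGen g)"

definition exp_term :: "('o, 'm) dec_thy \<Rightarrow> 'm exp_tmgen \<Rightarrow> ('o, 'm) exp_tm" where
  "exp_term \<Theta> t = tm_class (exp_pres \<Theta>) (TmGen t)"

definition F_exp_obj :: "('o, 'm) dec_thy \<Rightarrow> (('o, 'm) exp_ty, ('o, 'm) exp_tm) thy_with_type" where
  "F_exp_obj \<Theta> = (presented (exp_pres \<Theta>), from_Pi_A (presented (exp_pres \<Theta>)) (exp_type \<Theta> ParTy))"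

definition F_exp_mor :: "('o, 'm) dec_thy \<Rightarrow> ('p, 'n) dec_thy \<Rightarrow> ('o, 'm, 'p, 'n) thy_mor \<Rightarrow>
    (('o, 'm) exp_ty, ('o, 'm) exp_tm, ('p, 'n) exp_ty, ('p, 'n) exp_tm) thy_mor" where
  "F_exp_mor \<Theta> \<Theta>' \<phi> = induced (exp_pres \<Theta>) (presented (exp_pres \<Theta>'))
     (\<lambda>g. exp_type \<Theta>' (map_exp_tygen (on_obj \<phi>) g))
     (\<lambda>t. exp_term \<Theta>' (map_exp_tmgen (on_arr \<phi>) t))"

type_synonym ('o, 'm) expa_ty = "(('o, 'm) exp_ty, ('o, 'm) exp_tm) po_ty"
type_synonym ('o, 'm) expa_tm = "(('o, 'm) exp_ty, ('o, 'm) exp_tm) po_tm"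

definition F'_exp_obj :: "('o, 'm) dec_thy \<Rightarrow> (('o, 'm) expa_ty, ('o, 'm) expa_tm) thy_with_type" where
  "F'_exp_obj \<Theta> = add_const_obj (F_exp_obj \<Theta>)"

definition F'_exp_mor :: "('o, 'm) dec_thy \<Rightarrow> ('p, 'n) dec_thy \<Rightarrow> ('o, 'm, 'p, 'n) thy_mor \<Rightarrow>
    (('o, 'm) expa_ty, ('o, 'm) expa_tm, ('p, 'n) expa_ty, ('p, 'n) expa_tm) thy_mor" where
  "F'_exp_mor \<Theta> \<Theta>' \<phi> = add_const_mor (F_exp_obj \<Theta>) (F_exp_obj \<Theta>') (F_exp_mor \<Theta> \<Theta>' \<phi>)"


section \<open>The morphism \<open>J\<close>\<close>

definition Theta_a :: "('o, 'm) dec_thy \<Rightarrow> (('o, 'm) expa_ty, ('o, 'm) expa_tm) thy" where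
  "Theta_a \<Theta> = U'_obj (F'_exp_obj \<Theta>)"

text \<open>The images in \<open>\<Theta>\<^sub>a\<close> of the generators of \<open>\<Theta>\<^sub>A\<close>, and the constant \<open>a : 1 \<rightarrow> A\<close> of \<open>\<Theta>\<^sub>a\<close>.\<close>

definition expa_type :: "('o, 'm) dec_thy \<Rightarrow> 'o exp_tygen \<Rightarrow> ('o, 'm) expa_ty" where
  "expa_type \<Theta> g = on_obj (add_const_in (F_exp_obj \<Theta>)) (exp_type \<Theta> g)"

definition expa_term :: "('o, 'm) dec_thy \<Rightarrow> 'm exp_tmgen \<Rightarrow> ('o, 'm) expa_tm" where
  "expa_term \<Theta> t = on_arr (add_const_in (F_exp_obj \<Theta>)) (exp_term \<Theta> t)"

definition expa_const :: "('o, 'm) dec_thy \<Rightarrow> ('o, 'm) expa_tm" where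
  "expa_const \<Theta> = on_arr (snd (F'_exp_obj \<Theta>)) a_generator"

text \<open>The morphism \<open>\<Theta>\<^sub>0 \<rightarrow> \<Theta>\<^sub>a\<close> making \<open>\<Theta>\<^sub>a\<close> a theory under \<open>\<Theta>\<^sub>0\<close>.\<close>

definition pure_to_Theta_a ::
  "('o, 'm) dec_thy \<Rightarrow> ('o, 'm, ('o, 'm) expa_ty, ('o, 'm) expa_tm) thy_mor" where
  "pure_to_Theta_a \<Theta> = \<lparr>on_obj = (\<lambda>X \<in> Obj \<Theta>. expa_type \<Theta> (OldTy X)),
                          on_arr = (\<lambda>f \<in> PureArr \<Theta>. expa_term \<Theta> (OldTm f))\<rparr>"

text \<open>
  In \<open>f' \<circ> (a \<times> id\<^sub>X)\<close> the source \<open>1 \<times> X\<close> of \<open>a \<times> id\<^sub>X\<close> is identified with \<open>X\<close> by \<open>unit_iso\<close>.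
\<close>

definition J :: "('o, 'm) dec_thy \<Rightarrow> ('o, 'm, ('o, 'm) expa_ty, ('o, 'm) expa_tm) thy_mor" where
  "J \<Theta> = \<lparr>
     on_obj = (\<lambda>X \<in> Obj \<Theta>. expa_type \<Theta> (OldTy X)),
     on_arr = (\<lambda>f \<in> Arr \<Theta>. let T = Theta_a \<Theta>; X = expa_type \<Theta> (OldTy (Dom \<Theta> f)) in
       Comp T (expa_term \<Theta> (Prime f))
         (Comp T (cross T (expa_const \<Theta>) (Ident T X)) (unit_iso T X)))\<rparr>"

end

theory Submission
  imports Defs
begin

text \<open>
  Morphisms out of a presented theory are determined by the generators, so functoriality of
  \<open>F'\<^sub>e\<^sub>x\<^sub>p\<close> and naturality of \<open>J\<close> only need to be checked on generators, once every morphism in sight is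
  known to respect the relations. That \<open>J\<close> is a morphism comes down to
  \<open>J f = f' \<circ> \<langle>a \<circ> !, id\<rangle>\<close>: the relation \<open>(g \<circ> f)' = g' \<circ> \<langle>pr, f'\<rangle>\<close> and
  \<open>\<langle>pr, f'\<rangle> \<circ> \<langle>a \<circ> !, id\<rangle> = \<langle>a \<circ> !, J f\<rangle> = \<langle>a \<circ> !, id\<rangle> \<circ> J f\<close> give composition, and on pure terms
  \<open>f' = f \<circ> \<epsilon>\<close> gives \<open>J f = f\<close>, hence identities and projections.
\<close>

section \<open>Tuples\<close>

text \<open>Morphisms preserve products strictly, so in a generated theory the formal product of old
  types has to equal the old product type. Hence type expressions are themselves taken modulo a
  congruence, term expressions are typed only up to it, and the operations on classes choose
  arbitrary representatives. The syntactic part shows that this is harmless: typing is unique up to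
  congruence and evaluation is sound. Normal forms never occur, since only equalities are derived
  and every morphism out of a generated theory is an evaluation.

  The correspondence that characterizes the parameterized theory is made into a locale of algebras
  in an arbitrary target theory. Algebras are pushed forward along morphisms of theories and pulled
  back along decorated morphisms. Pushing the generic algebra along a coprojection gives the one in
  the theory with a constant, pulling it back gives the action of the functor on morphisms, and
  \<open>J\<close> is an instance of a construction for any algebra equipped with a constant of its
  parameter type.\<close>

lemma hom_iff: "f \<in> hom T X Y \<longleftrightarrow> f \<in> Arr T \<and> Dom T f = X \<and> Cod T f = Y"
  by (simp add: hom_def)

context category
begin

lemma hom_obj: "f \<in> hom T X Y \<Longrightarrow> X \<in> Obj T \<and> Y \<in> Obj T"
  using dom_closed cod_closed by (auto simp: hom_iff)

lemma comp_arr: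
  assumes "f \<in> Arr T" "g \<in> Arr T" "Cod T f = Dom T g"
  shows "Comp T g f \<in> Arr T" "Dom T (Comp T g f) = Dom T f" "Cod T (Comp T g f) = Cod T g"
  using comp_hom[of f "Dom T f" "Cod T f" g "Cod T g"] assms by (auto simp: hom_iff)

end

context eq_theory
begin

text \<open>\<open>tuple\<close> reads the targets off the arrows, while the universal property
  takes them as given. Reconciling the two here lets all later statements carry the targets as an
  explicit list \<open>Ys\<close> in a \<open>list_all2\<close> hypothesis.\<close>

lemma tuple_ex1:
  assumes "X \<in> Obj T" "list_all2 (\<lambda>f Y. f \<in> hom T X Y) fs Ys"
  shows "map (Cod T) fs = Ys"
    and "\<exists>!h. h \<in> hom T X (Prd T Ys) \<and> (\<forall>i < length fs. Comp T (Prj T Ys i) h = fs ! i)"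
proof -
  show "map (Cod T) fs = Ys"
    using assms(2) by (auto simp: list_all2_conv_all_nth hom_iff list_eq_iff_nth_eq)
  have "Ys \<in> lists (Obj T)"
    using assms(2) hom_obj by (fastforce simp: list_all2_conv_all_nth in_set_conv_nth)
  moreover have "length fs = length Ys" "\<And>i. i < length Ys \<Longrightarrow> fs ! i \<in> hom T X (Ys ! i)"
    using assms(2) by (auto simp: list_all2_conv_all_nth)
  ultimately show "\<exists>!h. h \<in> hom T X (Prd T Ys) \<and> (\<forall>i < length fs. Comp T (Prj T Ys i) h = fs ! i)"
    using prd_universal[of X Ys fs] assms(1) by simp
qed

lemma
  assumes "X \<in> Obj T" "list_all2 (\<lambda>f Y. f \<in> hom T X Y) fs Ys"
  shows tuple_hom: "tuple T X fs \<in> hom T X (Prd T Ys)"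
    and prj_tuple: "i < length fs \<Longrightarrow> Comp T (Prj T Ys i) (tuple T X fs) = fs ! i"
  using theI'[OF tuple_ex1(2)[OF assms]] unfolding tuple_def tuple_ex1(1)[OF assms] by auto

lemma tuple_eqI:
  assumes "h \<in> hom T X (Prd T Ys)" "list_all2 (\<lambda>f Y. f \<in> hom T X Y) fs Ys"
    and "\<And>i. i < length fs \<Longrightarrow> Comp T (Prj T Ys i) h = fs ! i"
  shows "tuple T X fs = h"
proof -
  have X: "X \<in> Obj T"
    using assms(1) hom_obj by blast
  show ?thesis
    using tuple_ex1(2)[OF X assms(2)] tuple_hom[OF X assms(2)] prj_tuple[OF X assms(2)] assms(1,3)
    by blast
qed

text \<open>Both sides have the same projections, by associativity. For \<open>fs = []\<close> this
  says that the map to the terminal type absorbs precomposition.\<close>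

lemma tuple_comp:
  assumes "list_all2 (\<lambda>f Y. f \<in> hom T X Y) fs Ys" "h \<in> hom T W X"
  shows "Comp T (tuple T X fs) h = tuple T W (map (\<lambda>f. Comp T f h) fs)"
proof (rule tuple_eqI[symmetric])
  have X: "X \<in> Obj T"
    using assms(2) hom_obj by blast
  note tup = tuple_hom[OF X assms(1)]
  show "Comp T (tuple T X fs) h \<in> hom T W (Prd T Ys)"
    using comp_hom assms(2) tup by blast
  show "list_all2 (\<lambda>f Y. f \<in> hom T W Y) (map (\<lambda>f. Comp T f h) fs) Ys"
    using assms comp_hom by (auto simp: list_all2_conv_all_nth)
  have Ys: "Ys \<in> lists (Obj T)"
    using assms(1) hom_obj by (fastforce simp: list_all2_conv_all_nth in_set_conv_nth)
  fix i assume i: "i < length (map (\<lambda>f. Comp T f h) fs)"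
  then have "Prj T Ys i \<in> hom T (Prd T Ys) (Ys ! i)"
    using prj_hom[OF Ys] assms(1) by (auto simp: list_all2_lengthD)
  then have "Comp T (Prj T Ys i) (Comp T (tuple T X fs) h) =
      Comp T (Comp T (Prj T Ys i) (tuple T X fs)) h"
    using comp_assoc assms(2) tup by blast
  then show "Comp T (Prj T Ys i) (Comp T (tuple T X fs) h) = map (\<lambda>f. Comp T f h) fs ! i"
    using prj_tuple[OF X assms(1)] i by simp
qed

text \<open>Removes the detour through \<open>1 \<times> X\<close> from the definition of
  \<open>J\<close>: after the canonical isomorphism the two projections become the map to the
  terminal type and the identity. All later calculations use the resulting tuple.\<close>

lemma cross_unit_iso:
  assumes a: "a \<in> hom T (Prd T []) A" and X: "X \<in> Obj T"
  shows "Comp T (cross T a (Ident T X)) (unit_iso T X) =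
    tuple T X [Comp T a (tuple T X []), Ident T X]"
proof -
  have one: "Prd T [] \<in> Obj T"
    using prd_closed by simp
  let ?XY = "[Prd T [], X]"
  have XY: "?XY \<in> lists (Obj T)"
    using X one by simp
  note id = ident_hom[OF X]
  have bang: "tuple T X [] \<in> hom T X (Prd T [])"
    using tuple_hom[OF X, of "[]" "[]"] by simp
  have p: "Prj T ?XY 0 \<in> hom T (Prd T ?XY) (Prd T [])" "Prj T ?XY (Suc 0) \<in> hom T (Prd T ?XY) X"
    using prj_hom[OF XY, of 0] prj_hom[OF XY, of 1] by auto
  have fs: "list_all2 (\<lambda>f Y. f \<in> hom T X Y) [tuple T X [], Ident T X] ?XY"
    using bang id by simp
  have u: "unit_iso T X \<in> hom T X (Prd T ?XY)"
    and pu: "Comp T (Prj T ?XY 0) (unit_iso T X) = tuple T X []"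
      "Comp T (Prj T ?XY (Suc 0)) (unit_iso T X) = Ident T X"
    using tuple_hom[OF X fs] prj_tuple[OF X fs, of 0] prj_tuple[OF X fs, of 1]
    by (auto simp: unit_iso_def)
  have cr: "cross T a (Ident T X) =
      tuple T (Prd T ?XY) [Comp T a (Prj T ?XY 0), Comp T (Ident T X) (Prj T ?XY (Suc 0))]"
    using a id by (simp add: cross_def hom_iff Let_def)
  have gs: "list_all2 (\<lambda>f Y. f \<in> hom T (Prd T ?XY) Y)
      [Comp T a (Prj T ?XY 0), Comp T (Ident T X) (Prj T ?XY (Suc 0))] [A, X]"
    using comp_hom[OF p(1) a] comp_hom[OF p(2) id] by simp
  show ?thesis
    unfolding cr tuple_comp[OF gs u]
    using comp_assoc[OF u p(1) a] comp_assoc[OF u p(2) id] ident_left[OF id] by (simp add: pu)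
qed

end

section \<open>Morphisms of theories\<close>

lemma theory_morphismI:
  assumes "eq_theory S" "eq_theory T"
    and "on_obj F \<in> extensional (Obj S)" "on_arr F \<in> extensional (Arr S)"
    and "\<And>X. X \<in> Obj S \<Longrightarrow> on_obj F X \<in> Obj T"
    and "\<And>f. f \<in> Arr S \<Longrightarrow> on_arr F f \<in> hom T (on_obj F (Dom S f)) (on_obj F (Cod S f))"
    and "\<And>X. X \<in> Obj S \<Longrightarrow> on_arr F (Ident S X) = Ident T (on_obj F X)"
    and "\<And>f g. f \<in> Arr S \<Longrightarrow> g \<in> Arr S \<Longrightarrow> Cod S f = Dom S g \<Longrightarrow>
        on_arr F (Comp S g f) = Comp T (on_arr F g) (on_arr F f)"
    and "\<And>Xs. Xs \<in> lists (Obj S) \<Longrightarrow> on_obj F (Prd S Xs) = Prd T (map (on_obj F) Xs)"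
    and "\<And>Xs i. Xs \<in> lists (Obj S) \<Longrightarrow> i < length Xs \<Longrightarrow>
        on_arr F (Prj S Xs i) = Prj T (map (on_obj F) Xs) i"
  shows "theory_morphism S T F"
  using assms unfolding theory_morphism_def by (auto simp: PiE_def hom_iff)

lemma theory_morphismD:
  assumes "theory_morphism S T F"
  shows "eq_theory S" "eq_theory T"
    and "on_obj F \<in> extensional (Obj S)" "on_arr F \<in> extensional (Arr S)"
    and "\<And>X. X \<in> Obj S \<Longrightarrow> on_obj F X \<in> Obj T"
    and "\<And>f. f \<in> Arr S \<Longrightarrow> on_arr F f \<in> hom T (on_obj F (Dom S f)) (on_obj F (Cod S f))"
    and "\<And>X. X \<in> Obj S \<Longrightarrow> on_arr F (Ident S X) = Ident T (on_obj F X)"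
    and "\<And>f g. f \<in> Arr S \<Longrightarrow> g \<in> Arr S \<Longrightarrow> Cod S f = Dom S g \<Longrightarrow>
        on_arr F (Comp S g f) = Comp T (on_arr F g) (on_arr F f)"
    and "\<And>Xs. Xs \<in> lists (Obj S) \<Longrightarrow> on_obj F (Prd S Xs) = Prd T (map (on_obj F) Xs)"
    and "\<And>Xs i. Xs \<in> lists (Obj S) \<Longrightarrow> i < length Xs \<Longrightarrow>
        on_arr F (Prj S Xs i) = Prj T (map (on_obj F) Xs) i"
  using assms unfolding theory_morphism_def by (auto simp: PiE_def hom_iff)

lemma theory_morphism_hom:
  "theory_morphism S T F \<Longrightarrow> f \<in> hom S X Y \<Longrightarrow> on_arr F f \<in> hom T (on_obj F X) (on_obj F Y)"
  using theory_morphismD(6) by (fastforce simp: hom_iff)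

lemma theory_morphism_comp_hom:
  "theory_morphism S T F \<Longrightarrow> f \<in> hom S X Y \<Longrightarrow> g \<in> hom S Y Z \<Longrightarrow>
    on_arr F (Comp S g f) = Comp T (on_arr F g) (on_arr F f)"
  using theory_morphismD(8) by (fastforce simp: hom_iff)

text \<open>Morphisms are only required to preserve products and projections. The image of a tuple
  then has the projections that characterize the tuple of the images, and uniqueness does the
  rest.\<close>

lemma theory_morphism_tuple:
  assumes F: "theory_morphism S T F" and X: "X \<in> Obj S"
    and fs: "list_all2 (\<lambda>f Y. f \<in> hom S X Y) fs Ys"
  shows "on_arr F (tuple S X fs) = tuple T (on_obj F X) (map (on_arr F) fs)"
proof -
  interpret S: eq_theory S using theory_morphismD(1)[OF F] .
  interpret T: eq_theory T using theory_morphismD(2)[OF F] .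
  have Ys: "Ys \<in> lists (Obj S)"
    using fs S.hom_obj by (fastforce simp: list_all2_conv_all_nth in_set_conv_nth)
  note tup = S.tuple_hom[OF X fs]
  show ?thesis
  proof (rule T.tuple_eqI[symmetric])
    show "on_arr F (tuple S X fs) \<in> hom T (on_obj F X) (Prd T (map (on_obj F) Ys))"
      using theory_morphism_hom[OF F tup] theory_morphismD(9)[OF F Ys] by simp
    show "list_all2 (\<lambda>f Y. f \<in> hom T (on_obj F X) Y) (map (on_arr F) fs) (map (on_obj F) Ys)"
      using fs theory_morphism_hom[OF F] by (auto simp: list_all2_conv_all_nth)
    fix i assume "i < length (map (on_arr F) fs)"
    then have i: "i < length Ys" "i < length fs"
      using fs by (auto simp: list_all2_lengthD)
    show "Comp T (Prj T (map (on_obj F) Ys) i) (on_arr F (tuple S X fs)) = map (on_arr F) fs ! i"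
      using theory_morphism_comp_hom[OF F tup S.prj_hom[OF Ys i(1)]] S.prj_tuple[OF X fs i(2)]
        theory_morphismD(10)[OF F Ys i(1)] i by simp
  qed
qed

text \<open>Pointwise agreement on the source gives equality of records because both components are
  extensional.\<close>

lemma theory_morphism_eqI:
  assumes "theory_morphism S T F" "theory_morphism S T G"
    and "\<And>X. X \<in> Obj S \<Longrightarrow> on_obj F X = on_obj G X"
    and "\<And>f. f \<in> Arr S \<Longrightarrow> on_arr F f = on_arr G f"
  shows "F = G"
  using theory_morphismD(3,4)[OF assms(1)] theory_morphismD(3,4)[OF assms(2)] assms(3,4)
  by (intro thy_mor.equality) (auto intro: extensionalityI)

lemma mor_id_simps [simp]:
  "X \<in> Obj S \<Longrightarrow> on_obj (mor_id S) X = X" "f \<in> Arr S \<Longrightarrow> on_arr (mor_id S) f = f"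
  by (auto simp: mor_id_def)

lemma mor_comp_simps [simp]:
  "X \<in> Obj S \<Longrightarrow> on_obj (mor_comp S G F) X = on_obj G (on_obj F X)"
  "f \<in> Arr S \<Longrightarrow> on_arr (mor_comp S G F) f = on_arr G (on_arr F f)"
  by (auto simp: mor_comp_def compose_def)

lemma theory_morphism_id:
  assumes "eq_theory S"
  shows "theory_morphism S S (mor_id S)"
proof -
  interpret eq_theory S by fact
  have map: "map (on_obj (mor_id S)) Xs = Xs" if "Xs \<in> lists (Obj S)" for Xs
    using that by (auto intro!: map_idI)
  show ?thesis
    using prd_closed prj_hom comp_arr ident_hom dom_closed cod_closed map
    by (intro theory_morphismI assms) (auto simp: mor_id_def hom_iff)
qed

lemma theory_morphism_comp:
  assumes F: "theory_morphism S T F" and G: "theory_morphism T U G"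
  shows "theory_morphism S U (mor_comp S G F)"
proof -
  interpret S: eq_theory S using theory_morphismD(1)[OF F] .
  note f = theory_morphismD[OF F] and g = theory_morphismD[OF G]
  have map: "map (on_obj (mor_comp S G F)) Xs = map (on_obj G) (map (on_obj F) Xs)"
    "map (on_obj F) Xs \<in> lists (Obj T)" if "Xs \<in> lists (Obj S)" for Xs
    using that f(5) by auto
  show ?thesis
  proof (intro theory_morphismI f(1) g(2))
    show "on_obj (mor_comp S G F) \<in> extensional (Obj S)"
      "on_arr (mor_comp S G F) \<in> extensional (Arr S)"
      by (auto simp: mor_comp_def)
    fix f assume "f \<in> Arr S"
    then show "on_arr (mor_comp S G F) f \<in>
        hom U (on_obj (mor_comp S G F) (Dom S f)) (on_obj (mor_comp S G F) (Cod S f))"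
      using theory_morphism_hom[OF G f(6)] S.dom_closed S.cod_closed by simp
  next
    fix f h assume *: "f \<in> Arr S" "h \<in> Arr S" "Cod S f = Dom S h"
    then show "on_arr (mor_comp S G F) (Comp S h f) =
        Comp U (on_arr (mor_comp S G F) h) (on_arr (mor_comp S G F) f)"
      using S.comp_arr theory_morphism_comp_hom[OF G f(6)[OF *(1)], of "on_arr F h"] f(6)[OF *(2)] f(8)
      by simp
  next
    fix Xs assume *: "Xs \<in> lists (Obj S)"
    show "on_obj (mor_comp S G F) (Prd S Xs) = Prd U (map (on_obj (mor_comp S G F)) Xs)"
      unfolding map(1)[OF *] using * map(2)[OF *] f(9) g(9) S.prd_closed by simp
  next
    fix Xs i assume *: "Xs \<in> lists (Obj S)" "i < length Xs"
    then have "Prj S Xs i \<in> Arr S"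
      using S.prj_hom by (auto simp: hom_iff)
    then show "on_arr (mor_comp S G F) (Prj S Xs i) = Prj U (map (on_obj (mor_comp S G F)) Xs) i"
      unfolding map(1)[OF *(1)] using * map(2)[OF *(1)] f(10) g(10) by simp
  qed (use f g S.ident_hom in \<open>auto simp: hom_iff\<close>)
qed

section \<open>Presented theories\<close>

lemma wf_ty_TyPrd [simp]: "wf_ty P (TyPrd Xs) \<longleftrightarrow> (\<forall>X \<in> set Xs. wf_ty P X)"
  by (auto simp: wf_ty_def)

lemma wf_ty_TyGen [simp]: "wf_ty P (TyGen g) \<longleftrightarrow> g \<in> TyGens P"
  by (auto simp: wf_ty_def)

text \<open>Splits a \<open>list_all2\<close> premise, possibly conjoined with an induction
  hypothesis, into properties of the two lists. This unpacks the rules with list premises in the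
  inductions below.\<close>

lemma list_all2_ballD:
  assumes "list_all2 R xs ys" "\<And>x y. R x y \<Longrightarrow> P x \<and> Q y"
  shows "(\<forall>x \<in> set xs. P x) \<and> (\<forall>y \<in> set ys. Q y)"
  using assms by (induction rule: list_all2_induct) auto

lemma ty_eq_wf: "ty_eq P X Y \<Longrightarrow> wf_ty P X \<and> wf_ty P Y"
proof (induction rule: ty_eq.induct)
  case (prd Xs Ys)
  then show ?case
    using list_all2_ballD[OF prd, of "wf_ty P" "wf_ty P"] by auto
qed auto

lemma list_all2_ty_eq_wf:
  "list_all2 (ty_eq P) Xs Ys \<Longrightarrow> (\<forall>X \<in> set Xs. wf_ty P X) \<and> (\<forall>Y \<in> set Ys. wf_ty P Y)"
  using list_all2_ballD[of "ty_eq P" Xs Ys "wf_ty P" "wf_ty P"] ty_eq_wf by blast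

lemma tm_typed_wf: "tm_typed P t X Y \<Longrightarrow> wf_ty P X \<and> wf_ty P Y"
proof (induction rule: tm_typed.induct)
  case (tuple X ts Ys)
  then show ?case
    using list_all2_ballD[OF tuple(2), of "\<lambda>_. True" "wf_ty P"] by auto
qed (auto dest: ty_eq_wf)

lemma list_all2_tm_typed_wf:
  "list_all2 (\<lambda>t Y. tm_typed P t X Y) ts Ys \<Longrightarrow> \<forall>Y \<in> set Ys. wf_ty P Y"
  using list_all2_ballD[of "\<lambda>t Y. tm_typed P t X Y" ts Ys "\<lambda>_. True" "wf_ty P"] tm_typed_wf by blast

lemma list_all2_ty_eq_sym: "list_all2 (ty_eq P) Xs Ys \<Longrightarrow> list_all2 (ty_eq P) Ys Xs"
  by (auto simp: list_all2_conv_all_nth intro: ty_eq.sym)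

text \<open>Since \<open>conv\<close> may end any derivation, inversion fixes source and target only
  up to \<open>ty_eq\<close>; the same holds for the other constructors.\<close>

lemma tm_typed_TmGenD:
  fixes P :: "('g, 't) presentation"
  assumes "tm_typed P (TmGen t) X Y"
  shows "ty_eq P (GDom P t) X \<and> ty_eq P (GCod P t) Y"
  using assms by (induction "TmGen t :: ('g, 't) tm" X Y rule: tm_typed.induct) (auto intro: ty_eq.refl ty_eq.trans)

lemma tm_typed_TmIdD:
  fixes P :: "('g, 't) presentation"
  assumes "tm_typed P (TmId Z) X Y"
  shows "ty_eq P Z X \<and> ty_eq P Z Y"
  using assms by (induction "TmId Z :: ('g, 't) tm" X Y rule: tm_typed.induct)
    (auto intro: ty_eq.refl ty_eq.trans)

lemma tm_typed_TmCompD: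
  assumes "tm_typed P (TmComp u t) X Z"
  shows "\<exists>Y. tm_typed P t X Y \<and> tm_typed P u Y Z"
  using assms
proof (induction "TmComp u t" X Z rule: tm_typed.induct)
  case (conv X Z X' Z')
  then show ?case by (blast intro: tm_typed.conv ty_eq.refl dest: tm_typed_wf)
qed auto

lemma tm_typed_TmPrjD:
  fixes P :: "('g, 't) presentation"
  assumes "tm_typed P (TmPrj Xs i) X Y"
  shows "ty_eq P (TyPrd Xs) X \<and> i < length Xs \<and> ty_eq P (Xs ! i) Y"
  using assms by (induction "TmPrj Xs i :: ('g, 't) tm" X Y rule: tm_typed.induct)
    (auto intro: ty_eq.refl ty_eq.trans)

lemma tm_typed_TmTupleD:
  assumes "tm_typed P (TmTuple W ts) X Y"
  shows "\<exists>Ys. ty_eq P W X \<and> list_all2 (\<lambda>t Y. tm_typed P t W Y) ts Ys \<and> ty_eq P (TyPrd Ys) Y"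
  using assms
proof (induction "TmTuple W ts" X Y rule: tm_typed.induct)
  case (tuple Ys)
  then have "list_all2 (\<lambda>t Y. tm_typed P t W Y) ts Ys"
    by (auto simp: list_all2_conv_all_nth)
  then have "wf_ty P (TyPrd Ys)"
    using list_all2_tm_typed_wf by fastforce
  then show ?case
    using tuple by (auto simp: list_all2_conv_all_nth intro!: exI[of _ Ys] ty_eq.refl)
qed (auto intro: ty_eq.trans)

text \<open>Each constructor records enough to determine its types; in particular the annotation of
  \<open>TmTuple\<close> fixes the source of the empty tuple. This makes \<open>Dom\<close> and
  \<open>Cod\<close> of a class of terms into single classes of types.\<close>

lemma tm_typed_unique:
  assumes "tm_typed P t X Y" "tm_typed P t X' Y'"
  shows "ty_eq P X X' \<and> ty_eq P Y Y'"
  using assms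
proof (induction arbitrary: X' Y' rule: tm_typed.induct)
  case (gen t)
  show ?case using tm_typed_TmGenD[OF gen.prems] .
next
  case (ident X)
  then show ?case using tm_typed_TmIdD by blast
next
  case (comp t X Y u Z)
  then show ?case using tm_typed_TmCompD by blast
next
  case (prj Xs i)
  then show ?case using tm_typed_TmPrjD by blast
next
  case (tuple X ts Ys)
  obtain Ys' where Ys': "ty_eq P X X'" "list_all2 (\<lambda>t Y. tm_typed P t X Y) ts Ys'"
    "ty_eq P (TyPrd Ys') Y'"
    using tm_typed_TmTupleD[OF tuple.prems] by blast
  have "list_all2 (ty_eq P) Ys Ys'"
    using tuple.IH Ys'(2) by (fastforce simp: list_all2_conv_all_nth)
  then show ?case
    using Ys' ty_eq.prd ty_eq.trans by blast
next
  case (conv t X Y X'' Y'')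
  then show ?case by (blast intro: ty_eq.sym ty_eq.trans)
qed

lemma tm_typed_cong:
  "tm_typed P t X Y \<Longrightarrow> tm_typed P t X' Y' \<Longrightarrow> tm_typed P u X Y \<Longrightarrow> tm_typed P u X' Y'"
  using tm_typed_unique tm_typed.conv by blast

text \<open>The rules of \<open>tm_eq\<close> do not carry the types along: \<open>sym\<close> and
  \<open>trans\<close> mention none. A common typing is recovered by induction, and for
  \<open>trans\<close> the two typings of the middle expression are aligned by uniqueness.\<close>

lemma tm_eq_typed: "tm_eq P t u \<Longrightarrow> \<exists>X Y. tm_typed P t X Y \<and> tm_typed P u X Y"
proof (induction rule: tm_eq.induct)
  case (trans t u v)
  then show ?case by (blast intro: tm_typed_cong)
next
  case (ident X X')
  then have "tm_typed P (TmId X) X X" "tm_typed P (TmId X') X X"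
    by (auto dest: ty_eq_wf intro: tm_typed.intros ty_eq.sym)
  then show ?case by blast
next
  case (comp t X Y u Z t' u')
  then have "tm_typed P t' X Y" "tm_typed P u' Y Z"
    by (blast intro: tm_typed_cong)+
  then show ?case
    using comp by (blast intro: tm_typed.comp)
next
  case (prj Xs Xs' i)
  then have "tm_typed P (TmPrj Xs i) (TyPrd Xs) (Xs ! i)"
    "tm_typed P (TmPrj Xs' i) (TyPrd Xs') (Xs' ! i)"
    using list_all2_ty_eq_wf[OF prj(1)] by (auto simp: list_all2_lengthD intro!: tm_typed.prj)
  moreover have "ty_eq P (TyPrd Xs') (TyPrd Xs)" "ty_eq P (Xs' ! i) (Xs ! i)"
    using list_all2_ty_eq_sym[OF prj(1)] prj(2)
    by (auto simp: list_all2_nthD2 list_all2_lengthD intro: ty_eq.prd)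
  ultimately show ?case by (blast intro: tm_typed.conv)
next
  case (tuple X X' ts Ys ts')
  have "list_all2 (\<lambda>t Y. tm_typed P t X' Y) ts' Ys"
  proof (rule list_all2_all_nthI)
    show "length ts' = length Ys"
      using tuple by (simp add: list_all2_conv_all_nth)
    fix i assume i: "i < length ts'"
    have t: "tm_typed P (ts ! i) X (Ys ! i)"
      using tuple(2,3) i by (simp add: list_all2_conv_all_nth)
    \<comment> \<open>The induction hypothesis only provides some common typing of the two
      components; uniqueness transports it to the typing of \<open>ts ! i\<close> given by the
      premise of the rule.\<close>
    obtain X0 Y0 where "tm_typed P (ts ! i) X0 Y0" "tm_typed P (ts' ! i) X0 Y0"
      using list_all2_nthD2[OF tuple(3) i] by blast
    then have "tm_typed P (ts' ! i) X (Ys ! i)"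
      using t tm_typed_cong by blast
    then show "tm_typed P (ts' ! i) X' (Ys ! i)"
      using tuple(1) by (blast intro: tm_typed.conv ty_eq.refl dest: tm_typed_wf)
  qed
  then have "tm_typed P (TmTuple X' ts') X' (TyPrd Ys)"
    using tuple(1) by (auto intro: tm_typed.tuple dest: ty_eq_wf)
  then have "tm_typed P (TmTuple X' ts') X (TyPrd Ys)"
    using tuple(1) by (blast intro: tm_typed.conv ty_eq.refl ty_eq.sym dest: tm_typed_wf)
  moreover have "tm_typed P (TmTuple X ts) X (TyPrd Ys)"
    using tuple by (auto intro: tm_typed.tuple dest: ty_eq_wf)
  ultimately show ?case by blast
next
  case (ident_left t X Y)
  then show ?case by (blast intro: tm_typed.intros dest: tm_typed_wf)
next
  case (ident_right t X Y)
  then show ?case by (blast intro: tm_typed.intros dest: tm_typed_wf)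
next
  case (assoc t W X u Y v Z)
  then show ?case by (blast intro: tm_typed.comp)
next
  case (prj_tuple X ts Ys i)
  then have "wf_ty P (TyPrd Ys)" "i < length Ys" "tm_typed P (ts ! i) X (Ys ! i)"
    using list_all2_tm_typed_wf[OF prj_tuple(2)] by (auto simp: list_all2_conv_all_nth)
  then show ?case
    using prj_tuple(1,2) by (blast intro: tm_typed.intros)
next
  case (tuple_prj t X Ys)
  then have wf: "wf_ty P X" "wf_ty P (TyPrd Ys)"
    by (auto dest: tm_typed_wf)
  have "list_all2 (\<lambda>t Y. tm_typed P t X Y) (map (\<lambda>i. TmComp (TmPrj Ys i) t) [0..<length Ys]) Ys"
    using tuple_prj wf(2) by (auto simp: list_all2_conv_all_nth intro!: tm_typed.comp tm_typed.prj)
  then show ?case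
    using tuple_prj wf(1) by (blast intro: tm_typed.tuple)
qed auto

lemma tm_eq_typed_iff:
  assumes "tm_eq P t u"
  shows "tm_typed P t X Y \<longleftrightarrow> tm_typed P u X Y"
  using tm_eq_typed[OF assms] by (blast intro: tm_typed_cong)

section \<open>Congruence classes and representatives\<close>

lemma ty_class_eq_iff: "wf_ty P X \<Longrightarrow> ty_class P X = ty_class P Y \<longleftrightarrow> ty_eq P X Y"
  by (auto simp: ty_class_def intro: ty_eq.sym ty_eq.trans ty_eq.refl)

lemma ty_class_eqI: "ty_eq P X Y \<Longrightarrow> ty_class P X = ty_class P Y"
  using ty_class_eq_iff ty_eq_wf by blast

text \<open>Typedness gives reflexivity. All untyped expressions share the empty class, so equality
  of classes says nothing about them; the same holds for ill-formed types.\<close>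

lemma tm_class_eq_iff: "tm_typed P t X Y \<Longrightarrow> tm_class P t = tm_class P u \<longleftrightarrow> tm_eq P t u"
  by (auto simp: tm_class_def intro: tm_eq.sym tm_eq.trans tm_eq.refl)

lemma tm_class_eqI: "tm_eq P t u \<Longrightarrow> tm_class P t = tm_class P u"
  by (auto simp: tm_class_def intro: tm_eq.sym tm_eq.trans)

lemma rep_ty_class: "wf_ty P X \<Longrightarrow> ty_eq P X (rep (ty_class P X))"
  unfolding rep_def ty_class_def by (rule someI2[of _ X]) (auto intro: ty_eq.refl)

lemma rep_tm_class: "tm_typed P t X Y \<Longrightarrow> tm_eq P t (rep (tm_class P t))"
  unfolding rep_def tm_class_def by (rule someI2[of _ t]) (auto intro: tm_eq.refl)

lemma rep_ty_classes:
  "\<forall>X \<in> set Xs. wf_ty P X \<Longrightarrow> list_all2 (ty_eq P) Xs (map rep (map (ty_class P) Xs))"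
  by (auto simp: list_all2_conv_all_nth intro: rep_ty_class)

section \<open>Structure of a presented theory in terms of expressions\<close>

lemma presented_Obj: "C \<in> Obj (presented P) \<longleftrightarrow> (\<exists>X. wf_ty P X \<and> C = ty_class P X)"
  by (auto simp: presented_def)

lemma presented_Objs:
  "Cs \<in> lists (Obj (presented P)) \<longleftrightarrow> (\<exists>Xs. (\<forall>X \<in> set Xs. wf_ty P X) \<and> Cs = map (ty_class P) Xs)"
proof
  assume "Cs \<in> lists (Obj (presented P))"
  then have "\<forall>C \<in> set Cs. \<exists>X. wf_ty P X \<and> C = ty_class P X"
    by (auto simp: presented_Obj)
  then obtain r where "\<forall>C \<in> set Cs. wf_ty P (r C) \<and> C = ty_class P (r C)"
    by metis
  then show "\<exists>Xs. (\<forall>X \<in> set Xs. wf_ty P X) \<and> Cs = map (ty_class P) Xs"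
    by (intro exI[of _ "map r Cs"]) (auto intro!: map_idI[symmetric])
qed (auto simp: presented_Obj; blast)

lemma presented_Arr: "c \<in> Arr (presented P) \<longleftrightarrow> (\<exists>t X Y. tm_typed P t X Y \<and> c = tm_class P t)"
  by (auto simp: presented_def)

lemma
  assumes "tm_typed P t X Y"
  shows presented_Dom: "Dom (presented P) (tm_class P t) = ty_class P X"
    and presented_Cod: "Cod (presented P) (tm_class P t) = ty_class P Y"
proof -
  have refl: "ty_eq P X X" "ty_eq P Y Y" "tm_eq P t t"
    using assms by (auto intro: ty_eq.refl tm_eq.refl dest: tm_typed_wf)
  \<comment> \<open>\<open>Dom\<close> and \<open>Cod\<close> collect the types of all
    representatives. Typing is invariant under \<open>tm_eq\<close> and unique, so the single typing
    of \<open>t\<close> already determines both sets.\<close>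
  have *: "(\<exists>u \<in> tm_class P t. tm_typed P u X' Y') \<longleftrightarrow> ty_eq P X X' \<and> ty_eq P Y Y'" for X' Y'
  proof
    assume "\<exists>u \<in> tm_class P t. tm_typed P u X' Y'"
    then have "tm_typed P t X' Y'"
      by (auto simp: tm_class_def tm_eq_typed_iff)
    then show "ty_eq P X X' \<and> ty_eq P Y Y'"
      using assms tm_typed_unique by blast
  next
    assume "ty_eq P X X' \<and> ty_eq P Y Y'"
    then show "\<exists>u \<in> tm_class P t. tm_typed P u X' Y'"
      using assms refl(3) by (auto simp: tm_class_def intro: tm_typed.conv)
  qed
  have "Dom (presented P) (tm_class P t) = {X'. \<exists>Y'. \<exists>u \<in> tm_class P t. tm_typed P u X' Y'}"
    "Cod (presented P) (tm_class P t) = {Y'. \<exists>X'. \<exists>u \<in> tm_class P t. tm_typed P u X' Y'}"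
    by (auto simp: presented_def)
  then show "Dom (presented P) (tm_class P t) = ty_class P X"
    "Cod (presented P) (tm_class P t) = ty_class P Y"
    using refl unfolding * ty_class_def by auto
qed

lemma presented_homI: "tm_typed P t X Y \<Longrightarrow> tm_class P t \<in> hom (presented P) (ty_class P X) (ty_class P Y)"
  unfolding hom_iff presented_Arr by (auto simp: presented_Dom presented_Cod)

text \<open>The term comes out typed by the given representatives \<open>X\<close> and
  \<open>Y\<close> of the end points, not merely by congruent ones; \<open>conv\<close> absorbs the
  difference. This is what makes chosen terms composable as expressions.\<close>

lemma presented_homE:
  assumes "c \<in> hom (presented P) (ty_class P X) (ty_class P Y)"
  obtains t where "tm_typed P t X Y" "c = tm_class P t"
proof -
  obtain t X' Y' where t: "tm_typed P t X' Y'" "c = tm_class P t"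
    using assms unfolding hom_iff presented_Arr by blast
  then have "ty_class P X' = ty_class P X" "ty_class P Y' = ty_class P Y"
    using assms presented_Dom[OF t(1)] presented_Cod[OF t(1)] by (auto simp: hom_iff)
  moreover have "wf_ty P X'" "wf_ty P Y'"
    using t(1) tm_typed_wf by blast+
  ultimately have "tm_typed P t X Y"
    using t(1) by (auto simp: ty_class_eq_iff intro: tm_typed.conv)
  then show thesis using that t(2) by blast
qed

text \<open>Together with the next three lemmas this is the well-definedness of the operations:
  \<open>presented\<close> computes with \<open>rep\<close>, and by the congruence rules any other
  representative may be used instead.\<close>

lemma presented_Ident: "wf_ty P X \<Longrightarrow> Ident (presented P) (ty_class P X) = tm_class P (TmId X)"
  using rep_ty_class[of P X]
  by (auto simp: presented_def intro!: tm_class_eqI tm_eq.ident intro: ty_eq.sym)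

lemma presented_Comp:
  assumes "tm_typed P t X Y" "tm_typed P u Y Z"
  shows "Comp (presented P) (tm_class P u) (tm_class P t) = tm_class P (TmComp u t)"
  using tm_eq.comp[OF assms rep_tm_class[OF assms(1)] rep_tm_class[OF assms(2)]]
  by (simp add: presented_def tm_class_eqI)

lemma presented_Prd:
  assumes "\<forall>X \<in> set Xs. wf_ty P X"
  shows "Prd (presented P) (map (ty_class P) Xs) = ty_class P (TyPrd Xs)"
  using ty_class_eqI[OF ty_eq.prd[OF rep_ty_classes[OF assms]]] by (simp add: presented_def)

lemma presented_Prj:
  assumes "\<forall>X \<in> set Xs. wf_ty P X" "i < length Xs"
  shows "Prj (presented P) (map (ty_class P) Xs) i = tm_class P (TmPrj Xs i)"
  using tm_class_eqI[OF tm_eq.prj[OF rep_ty_classes[OF assms(1)] assms(2)]]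
  by (simp add: presented_def)

lemma category_presented: "category (presented P)"
proof
  show "Dom (presented P) f \<in> Obj (presented P)" "Cod (presented P) f \<in> Obj (presented P)"
    if "f \<in> Arr (presented P)" for f
    using that by (auto simp: presented_Arr presented_Obj presented_Dom presented_Cod dest: tm_typed_wf)
next
  fix X assume "X \<in> Obj (presented P)"
  then show "Ident (presented P) X \<in> hom (presented P) X X"
    by (auto simp: presented_Obj presented_Ident intro!: presented_homI tm_typed.ident)
next
  \<comment> \<open>Writes the end points of an arrow as classes of well-formed expressions, so that
    consecutive arrows can be represented by terms sharing the same intermediate type
    expression.\<close>
  have hom_cases: "\<exists>X' Y'. wf_ty P X' \<and> wf_ty P Y' \<and> X = ty_class P X' \<and> Y = ty_class P Y'"
    if f: "f \<in> hom (presented P) X Y" for f X Y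
  proof -
    obtain t X' Y' where "tm_typed P t X' Y'" "f = tm_class P t"
      using f unfolding hom_iff presented_Arr by blast
    then show ?thesis
      using f tm_typed_wf[of P t X' Y'] by (auto simp: hom_iff presented_Dom presented_Cod)
  qed
  fix f X Y assume f: "f \<in> hom (presented P) X Y"
  then obtain X' Y' where X: "X = ty_class P X'" and Y: "Y = ty_class P Y'" and
    wf: "wf_ty P X'" "wf_ty P Y'"
    using hom_cases by blast
  obtain t where t: "tm_typed P t X' Y'" "f = tm_class P t"
    using f unfolding X Y by (rule presented_homE)
  show "Comp (presented P) (Ident (presented P) Y) f = f"
    using tm_class_eqI[OF tm_eq.ident_left[OF t(1)]] wf
    by (simp add: Y t(2) presented_Ident presented_Comp[OF t(1) tm_typed.ident])
  show "Comp (presented P) f (Ident (presented P) X) = f"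
    using tm_class_eqI[OF tm_eq.ident_right[OF t(1)]] wf
    by (simp add: X t(2) presented_Ident presented_Comp[OF tm_typed.ident t(1)])
  fix g Z assume g: "g \<in> hom (presented P) Y Z"
  then obtain Z' where Z: "Z = ty_class P Z'"
    using hom_cases by blast
  obtain u where u: "tm_typed P u Y' Z'" "g = tm_class P u"
    using g unfolding Y Z by (rule presented_homE)
  show "Comp (presented P) g f \<in> hom (presented P) X Z"
    unfolding t(2) u(2) X Z presented_Comp[OF t(1) u(1)]
    using t(1) u(1) by (blast intro: presented_homI tm_typed.comp)
  fix h W assume h: "h \<in> hom (presented P) Z W"
  then obtain W' where W: "W = ty_class P W'"
    using hom_cases by blast
  obtain v where v: "tm_typed P v Z' W'" "h = tm_class P v"
    using h unfolding W Z by (rule presented_homE)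
  show "Comp (presented P) h (Comp (presented P) g f) = Comp (presented P) (Comp (presented P) h g) f"
    unfolding t(2) u(2) v(2) presented_Comp[OF t(1) u(1)] presented_Comp[OF u(1) v(1)]
      presented_Comp[OF tm_typed.comp[OF t(1) u(1)] v(1)]
      presented_Comp[OF t(1) tm_typed.comp[OF u(1) v(1)]]
    using tm_class_eqI[OF tm_eq.assoc[OF t(1) u(1) v(1)]] .
qed

text \<open>For the universal property of products, existence is the rule \<open>prj_tuple\<close>;
  uniqueness is congruence of tuples followed by surjective pairing, the rule
  \<open>tuple_prj\<close>.\<close>

lemma eq_theory_presented: "eq_theory (presented P)"
proof -
  interpret category "presented P" by (rule category_presented)
  let ?T = "presented P"
  show ?thesis
  proof
    fix Cs assume "Cs \<in> lists (Obj ?T)"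
    then obtain Xs where Xs: "\<forall>X \<in> set Xs. wf_ty P X" "Cs = map (ty_class P) Xs"
      by (auto simp: presented_Objs)
    then show "Prd ?T Cs \<in> Obj ?T"
      by (auto simp: presented_Prd presented_Obj intro!: exI[of _ "TyPrd Xs"])
    fix i assume i: "i < length Cs"
    then show "Prj ?T Cs i \<in> hom ?T (Prd ?T Cs) (Cs ! i)"
      using Xs by (auto simp: presented_Prd presented_Prj intro!: presented_homI tm_typed.prj)
  next
    fix C Cs fs
    assume "C \<in> Obj ?T" "Cs \<in> lists (Obj ?T)" and len: "length fs = length Cs"
      and fs: "\<And>i. i < length Cs \<Longrightarrow> fs ! i \<in> hom ?T C (Cs ! i)"
    then obtain X Xs where X: "wf_ty P X" "C = ty_class P X"
      and Xs: "\<forall>X \<in> set Xs. wf_ty P X" "Cs = map (ty_class P) Xs"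
      by (auto simp: presented_Objs presented_Obj)
    have "\<exists>t. tm_typed P t X (Xs ! i) \<and> fs ! i = tm_class P t" if "i < length Xs" for i
      using fs[of i] that X Xs by (auto elim!: presented_homE)
    then obtain r where r: "\<And>i. i < length Xs \<Longrightarrow> tm_typed P (r i) X (Xs ! i) \<and> fs ! i = tm_class P (r i)"
      by metis
    let ?ts = "map r [0..<length Xs]"
    have ts: "list_all2 (\<lambda>t Y. tm_typed P t X Y) ?ts Xs"
      using r by (auto simp: list_all2_conv_all_nth)
    have tup: "tm_typed P (TmTuple X ?ts) X (TyPrd Xs)"
      using X(1) ts by (rule tm_typed.tuple)
    have Prd: "Prd ?T Cs = ty_class P (TyPrd Xs)"
      using Xs by (simp add: presented_Prd)
    have prj: "tm_typed P (TmPrj Xs i) (TyPrd Xs) (Xs ! i)" if "i < length Xs" for i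
      using Xs that by (auto intro: tm_typed.prj)
    have Prj: "Comp ?T (Prj ?T Cs i) (tm_class P t) = tm_class P (TmComp (TmPrj Xs i) t)"
      if "tm_typed P t X (TyPrd Xs)" "i < length Xs" for i t
      using Xs that presented_Comp[OF that(1) prj[OF that(2)]] by (simp add: presented_Prj)
    show "\<exists>!h. h \<in> hom ?T C (Prd ?T Cs) \<and> (\<forall>i < length Cs. Comp ?T (Prj ?T Cs i) h = fs ! i)"
    proof (rule ex1I[of _ "tm_class P (TmTuple X ?ts)"], intro conjI allI impI)
      show "tm_class P (TmTuple X ?ts) \<in> hom ?T C (Prd ?T Cs)"
        unfolding X(2) Prd using tup by (rule presented_homI)
      fix i assume i: "i < length Cs"
      have "tm_eq P (TmComp (TmPrj Xs i) (TmTuple X ?ts)) (?ts ! i)"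
        using i Xs by (intro tm_eq.prj_tuple[OF X(1) ts]) simp
      then show "Comp ?T (Prj ?T Cs i) (tm_class P (TmTuple X ?ts)) = fs ! i"
        using Prj[OF tup, of i] i Xs r by (simp add: tm_class_eqI)
    next
      fix h assume h: "h \<in> hom ?T C (Prd ?T Cs) \<and> (\<forall>i < length Cs. Comp ?T (Prj ?T Cs i) h = fs ! i)"
      then obtain t where t: "tm_typed P t X (TyPrd Xs)" "h = tm_class P t"
        unfolding X(2) Prd by (auto elim!: presented_homE)
      have "tm_eq P (r i) (TmComp (TmPrj Xs i) t)" if "i < length Xs" for i
        using h t(2) Prj[OF t(1) that] that Xs r[OF that] tm_class_eq_iff by fastforce
      then have "tm_eq P (TmTuple X ?ts) (TmTuple X (map (\<lambda>i. TmComp (TmPrj Xs i) t) [0..<length Xs]))"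
        using X(1) ts by (auto intro!: tm_eq.tuple intro: ty_eq.refl simp: list_all2_conv_all_nth)
      also have "tm_eq P \<dots> t"
        using t(1) by (rule tm_eq.tuple_prj)
      finally (tm_eq.trans) show "h = tm_class P (TmTuple X ?ts)"
        using t(2) tm_class_eqI by metis
    qed
  qed
qed

text \<open>Unlike the other operations, \<open>tuple\<close> is a definite description and not a
  field of \<open>presented P\<close>, so it is identified by its projections.\<close>

lemma presented_tuple:
  assumes "wf_ty P X" "list_all2 (\<lambda>t Y. tm_typed P t X Y) ts Ys"
  shows "tuple (presented P) (ty_class P X) (map (tm_class P) ts) = tm_class P (TmTuple X ts)"
proof -
  interpret eq_theory "presented P" by (rule eq_theory_presented)
  have Ys: "\<forall>Y \<in> set Ys. wf_ty P Y"
    using assms(2) by (rule list_all2_tm_typed_wf)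
  note tup = tm_typed.tuple[OF assms]
  show ?thesis
  proof (rule tuple_eqI)
    show "tm_class P (TmTuple X ts) \<in> hom (presented P) (ty_class P X) (Prd (presented P) (map (ty_class P) Ys))"
      unfolding presented_Prd[OF Ys] using tup by (rule presented_homI)
    show "list_all2 (\<lambda>f Y. f \<in> hom (presented P) (ty_class P X) Y) (map (tm_class P) ts) (map (ty_class P) Ys)"
      using assms(2) by (auto simp: list_all2_conv_all_nth intro: presented_homI)
    fix i assume "i < length (map (tm_class P) ts)"
    then have i: "i < length ts" "i < length Ys"
      using assms(2) by (auto simp: list_all2_lengthD)
    have "tm_typed P (TmPrj Ys i) (TyPrd Ys) (Ys ! i)"
      using Ys i by (auto intro: tm_typed.prj)
    then show "Comp (presented P) (Prj (presented P) (map (ty_class P) Ys) i) (tm_class P (TmTuple X ts)) =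
        map (tm_class P) ts ! i"
      using tm_class_eqI[OF tm_eq.prj_tuple[OF assms i(1)]] i
      by (simp add: presented_Prj[OF Ys i(2)] presented_Comp[OF tup])
  qed
qed

section \<open>Morphisms from presented theories\<close>

text \<open>The data from which a morphism out of \<open>presented P\<close> is built: values of the
  generators of the right types, satisfying the relations. The locale yields the existence half of
  the universal property; the uniqueness half is
  \<open>theory_morphism_presented_eqI\<close>.\<close>

locale presentation_model = eq_theory T for T :: "('p, 'n, 'z) thy_scheme" +
  fixes P :: "('g, 't) presentation" and a :: "'g \<Rightarrow> 'p" and b :: "'t \<Rightarrow> 'n"
  assumes gen_obj: "g \<in> TyGens P \<Longrightarrow> a g \<in> Obj T"
    and gen_hom: "t \<in> TmGens P \<Longrightarrow> b t \<in> hom T (ty_eval T a (GDom P t)) (ty_eval T a (GCod P t))"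
    and ty_rel: "(X, Y) \<in> TyRel P \<Longrightarrow> ty_eval T a X = ty_eval T a Y"
    and tm_rel: "(s, u) \<in> TmRel P \<Longrightarrow> tm_eval T a b s = tm_eval T a b u"
begin

lemma ty_eval_Obj: "wf_ty P X \<Longrightarrow> ty_eval T a X \<in> Obj T"
  by (induction X) (auto intro!: gen_obj prd_closed)

lemma ty_eval_lists: "\<forall>X \<in> set Xs. wf_ty P X \<Longrightarrow> map (ty_eval T a) Xs \<in> lists (Obj T)"
  using ty_eval_Obj by auto

lemma ty_eval_cong: "ty_eq P X Y \<Longrightarrow> ty_eval T a X = ty_eval T a Y"
proof (induction rule: ty_eq.induct)
  case (prd Xs Ys)
  then have "map (ty_eval T a) Xs = map (ty_eval T a) Ys"
    by (auto simp: list_all2_conv_all_nth list_eq_iff_nth_eq)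
  then show ?case by simp
qed (auto intro: ty_rel)

lemma tm_eval_hom: "tm_typed P t X Y \<Longrightarrow> tm_eval T a b t \<in> hom T (ty_eval T a X) (ty_eval T a Y)"
proof (induction rule: tm_typed.induct)
  case (prj Xs i)
  then show ?case
    using prj_hom[of "map (ty_eval T a) Xs" i] ty_eval_lists[of Xs] by simp
next
  case (tuple X ts Ys)
  then show ?case
    by (auto intro!: tuple_hom ty_eval_Obj simp: list_all2_conv_all_nth)
next
  case (conv t X Y X' Y')
  then show ?case
    using ty_eval_cong by simp
qed (auto intro: gen_hom ident_hom ty_eval_Obj comp_hom)

lemma list_all2_tm_eval_hom:
  "list_all2 (\<lambda>t Y. tm_typed P t X Y) ts Ys \<Longrightarrow>
    list_all2 (\<lambda>f Y. f \<in> hom T (ty_eval T a X) Y) (map (tm_eval T a b) ts) (map (ty_eval T a) Ys)"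
  by (auto simp: list_all2_conv_all_nth intro: tm_eval_hom)

text \<open>Soundness of the equational calculus: every rule is either a law of categories with
  products or a relation of \<open>P\<close>. Surjective pairing is the uniqueness of tuples in
  \<open>T\<close>.\<close>

lemma tm_eval_cong: "tm_eq P t u \<Longrightarrow> tm_eval T a b t = tm_eval T a b u"
proof -
  note laws = ident_left ident_right prj_tuple
  show "tm_eq P t u \<Longrightarrow> tm_eval T a b t = tm_eval T a b u"
  proof (induction rule: tm_eq.induct)
    case (rel t u X Y)
    then show ?case by (simp add: tm_rel)
  next
    case (ident X X')
    then show ?case using ty_eval_cong by simp
  next
    case (prj Xs Xs' i)
    then have "map (ty_eval T a) Xs = map (ty_eval T a) Xs'"
      using ty_eval_cong by (auto simp: list_all2_conv_all_nth list_eq_iff_nth_eq)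
    then show ?case by simp
  next
    case (tuple X X' ts Ys ts')
    then have "map (tm_eval T a b) ts = map (tm_eval T a b) ts'"
      by (auto simp: list_all2_conv_all_nth list_eq_iff_nth_eq)
    then show ?case using tuple(1) ty_eval_cong by simp
  next
    case (ident_left t X Y)
    then show ?case by (simp add: laws(1)[OF tm_eval_hom])
  next
    case (ident_right t X Y)
    then show ?case by (simp add: laws(2)[OF tm_eval_hom])
  next
    case (assoc t W X u Y v Z)
    then show ?case by (simp add: comp_assoc[OF tm_eval_hom tm_eval_hom tm_eval_hom])
  next
    case (prj_tuple X ts Ys i)
    then show ?case
      using laws(3)[OF ty_eval_Obj list_all2_tm_eval_hom, of X ts Ys i] by simp
  next
    case (tuple_prj t X Ys)
    then have Ys: "\<forall>Y \<in> set Ys. wf_ty P Y"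
      using tm_typed_wf by fastforce
    have f: "tm_eval T a b t \<in> hom T (ty_eval T a X) (Prd T (map (ty_eval T a) Ys))"
      using tm_eval_hom[OF tuple_prj] by simp
    have p: "Prj T (map (ty_eval T a) Ys) i \<in> hom T (Prd T (map (ty_eval T a) Ys)) (ty_eval T a (Ys ! i))"
      if "i < length Ys" for i
      using prj_hom[OF ty_eval_lists[OF Ys], of i] that by simp
    have "tuple T (ty_eval T a X)
        (map (\<lambda>i. Comp T (Prj T (map (ty_eval T a) Ys) i) (tm_eval T a b t)) [0..<length Ys]) = tm_eval T a b t"
      by (rule tuple_eqI[OF f]) (auto simp: list_all2_conv_all_nth intro: comp_hom[OF f p])
    then show ?case by (simp add: comp_def)
  qed auto
qed

text \<open>\<open>induced\<close> evaluates an arbitrary representative of the class, and soundness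
  makes the choice immaterial.\<close>

lemma induced_obj: "wf_ty P X \<Longrightarrow> on_obj (induced P T a b) (ty_class P X) = ty_eval T a X"
  using ty_eval_cong[OF rep_ty_class] by (auto simp: induced_def presented_Obj)

lemma induced_arr: "tm_typed P t X Y \<Longrightarrow> on_arr (induced P T a b) (tm_class P t) = tm_eval T a b t"
  using tm_eval_cong[OF rep_tm_class, of t X Y] presented_homI[of P t X Y]
  by (simp add: induced_def hom_iff)

lemma theory_morphism_induced: "theory_morphism (presented P) T (induced P T a b)"
proof (intro theory_morphismI eq_theory_presented eq_theory_axioms)
  show "on_obj (induced P T a b) \<in> extensional (Obj (presented P))"
    "on_arr (induced P T a b) \<in> extensional (Arr (presented P))"
    by (auto simp: induced_def)
next
  fix C assume "C \<in> Obj (presented P)"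
  then show "on_obj (induced P T a b) C \<in> Obj T"
    "on_arr (induced P T a b) (Ident (presented P) C) = Ident T (on_obj (induced P T a b) C)"
    by (auto simp: presented_Obj presented_Ident induced_obj induced_arr[OF tm_typed.ident] ty_eval_Obj)
next
  fix c assume "c \<in> Arr (presented P)"
  then obtain t X Y where t: "tm_typed P t X Y" "c = tm_class P t"
    unfolding presented_Arr by blast
  then show "on_arr (induced P T a b) c \<in> hom T (on_obj (induced P T a b) (Dom (presented P) c))
      (on_obj (induced P T a b) (Cod (presented P) c))"
    using tm_typed_wf[OF t(1)] tm_eval_hom[OF t(1)]
    by (simp add: presented_Dom presented_Cod induced_obj induced_arr)
  fix d assume "d \<in> Arr (presented P)" and *: "Cod (presented P) c = Dom (presented P) d"
  then obtain u Y' Z where u: "tm_typed P u Y' Z" "d = tm_class P u"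
    unfolding presented_Arr by blast
  \<comment> \<open>Composability in \<open>presented P\<close> is an equality of classes. The term
    \<open>t\<close> has to be retyped with the source \<open>Y'\<close> of \<open>u\<close> before
    the composite is a typed expression.\<close>
  have "ty_eq P Y Y'"
    using * ty_class_eq_iff tm_typed_wf[OF t(1)]
    unfolding t(2) u(2) presented_Cod[OF t(1)] presented_Dom[OF u(1)] by blast
  then have t': "tm_typed P t X Y'"
    using t(1) tm_typed.conv ty_eq.refl tm_typed_wf by blast
  show "on_arr (induced P T a b) (Comp (presented P) d c) =
      Comp T (on_arr (induced P T a b) d) (on_arr (induced P T a b) c)"
    unfolding t(2) u(2) presented_Comp[OF t' u(1)] induced_arr[OF tm_typed.comp[OF t' u(1)]]
      induced_arr[OF t'] induced_arr[OF u(1)] by simp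
next
  fix Cs assume "Cs \<in> lists (Obj (presented P))"
  then obtain Xs where Xs: "\<forall>X \<in> set Xs. wf_ty P X" "Cs = map (ty_class P) Xs"
    by (auto simp: presented_Objs)
  then have map: "map (on_obj (induced P T a b)) Cs = map (ty_eval T a) Xs"
    by (simp add: induced_obj)
  show "on_obj (induced P T a b) (Prd (presented P) Cs) = Prd T (map (on_obj (induced P T a b)) Cs)"
    unfolding map using Xs by (simp add: presented_Prd induced_obj)
  fix i assume i: "i < length Cs"
  then have "tm_typed P (TmPrj Xs i) (TyPrd Xs) (Xs ! i)"
    using Xs by (auto intro: tm_typed.prj)
  then show "on_arr (induced P T a b) (Prj (presented P) Cs i) = Prj T (map (on_obj (induced P T a b)) Cs) i"
    unfolding map using Xs i by (simp add: presented_Prj induced_arr)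
qed

end

text \<open>Every morphism from a presented theory is evaluation at its own values on the
  generators, because strict preservation of products lets an induction over expressions go through.
  Hence the generators determine it.\<close>

lemma theory_morphism_presented_eval:
  assumes F: "theory_morphism (presented P) T F"
  defines "a \<equiv> \<lambda>g. on_obj F (ty_class P (TyGen g))" and "b \<equiv> \<lambda>t. on_arr F (tm_class P (TmGen t))"
  shows "wf_ty P X \<Longrightarrow> on_obj F (ty_class P X) = ty_eval T a X"
    and "tm_typed P t X Y \<Longrightarrow> on_arr F (tm_class P t) = tm_eval T a b t"
proof -
  note f = theory_morphismD[OF F]
  have Obj: "ty_class P X \<in> Obj (presented P)" if "wf_ty P X" for X
    using that by (auto simp: presented_Obj)
  have Objs: "map (ty_class P) Xs \<in> lists (Obj (presented P))" if "\<forall>X \<in> set Xs. wf_ty P X" for Xs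
    using that Obj by auto
  show ty: "on_obj F (ty_class P X) = ty_eval T a X" if "wf_ty P X" for X
    using that
  proof (induction X)
    case (TyPrd Xs)
    then have *: "\<forall>X \<in> set Xs. wf_ty P X" by simp
    have map: "map (on_obj F) (map (ty_class P) Xs) = map (ty_eval T a) Xs"
      using TyPrd by simp
    show ?case
      using f(9)[OF Objs[OF *]] unfolding presented_Prd[OF *] map by simp
  qed (simp add: a_def)
  have tys: "map (on_obj F) (map (ty_class P) Xs) = map (ty_eval T a) Xs" if "\<forall>X \<in> set Xs. wf_ty P X" for Xs
    using that ty by simp
  show "on_arr F (tm_class P t) = tm_eval T a b t" if "tm_typed P t X Y"
    using that
  proof (induction rule: tm_typed.induct)
    case (gen t)
    then show ?case by (simp add: b_def)
  next
    case (ident X)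
    then show ?case
      using f(7)[OF Obj[OF ident]] by (simp add: presented_Ident ty)
  next
    case (comp t X Y u Z)
    then show ?case
      using theory_morphism_comp_hom[OF F presented_homI[OF comp(1)] presented_homI[OF comp(2)]]
        presented_Comp[OF comp(1,2)] by simp
  next
    case (prj Xs i)
    then have *: "\<forall>X \<in> set Xs. wf_ty P X" by simp
    show ?case
      using f(10)[OF Objs[OF *], of i] prj(2) unfolding tys[OF *] by (simp add: presented_Prj[OF *])
  next
    case (tuple X ts Ys)
    have ts: "list_all2 (\<lambda>t Y. tm_typed P t X Y) ts Ys"
      using tuple(2) by (rule list_all2_mono) simp
    have "\<forall>t \<in> set ts. on_arr F (tm_class P t) = tm_eval T a b t"
      using list_all2_ballD[OF tuple(2), of "\<lambda>t. on_arr F (tm_class P t) = tm_eval T a b t" "\<lambda>_. True"] by simp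
    then have *: "map (on_arr F \<circ> tm_class P) ts = map (tm_eval T a b) ts" by simp
    have "list_all2 (\<lambda>f Y. f \<in> hom (presented P) (ty_class P X) Y) (map (tm_class P) ts) (map (ty_class P) Ys)"
      using ts by (auto simp: list_all2_conv_all_nth intro: presented_homI)
    from theory_morphism_tuple[OF F Obj[OF tuple(1)] this] show ?case
      using * ty[OF tuple(1)] by (simp add: presented_tuple[OF tuple(1) ts])
  qed simp
qed

lemma tm_eval_cong_gen:
  assumes "\<And>g. g \<in> TyGens P \<Longrightarrow> a g = a' g"
    and "\<And>t. t \<in> TmGens P \<Longrightarrow> wf_ty P (GDom P t) \<Longrightarrow> wf_ty P (GCod P t) \<Longrightarrow> b t = b' t"
  shows "wf_ty P X \<Longrightarrow> ty_eval T a X = ty_eval T a' X"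
    and "tm_typed P t X Y \<Longrightarrow> tm_eval T a b t = tm_eval T a' b' t"
proof -
  show ty: "ty_eval T a X = ty_eval T a' X" if "wf_ty P X" for X
    using that
  proof (induction X)
    case (TyPrd Xs)
    then have "map (ty_eval T a) Xs = map (ty_eval T a') Xs" by simp
    then show ?case by (simp only: ty_eval.simps)
  qed (simp add: assms(1))
  show "tm_eval T a b t = tm_eval T a' b' t" if "tm_typed P t X Y"
    using that
  proof (induction rule: tm_typed.induct)
    case (prj Xs i)
    then have "map (ty_eval T a) Xs = map (ty_eval T a') Xs" by (simp add: ty)
    then show ?case by (simp only: tm_eval.simps)
  next
    case (tuple X ts Ys)
    have "\<forall>t \<in> set ts. tm_eval T a b t = tm_eval T a' b' t"
      using list_all2_ballD[OF tuple(2), of "\<lambda>t. tm_eval T a b t = tm_eval T a' b' t" "\<lambda>_. True"] by simp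
    then have "map (tm_eval T a b) ts = map (tm_eval T a' b') ts" by simp
    then show ?case by (simp only: tm_eval.simps ty[OF tuple(1)])
  qed (simp_all add: assms(2) ty)
qed

text \<open>Both morphisms are evaluations, at interpretations that agree on the generators.\<close>

lemma theory_morphism_presented_eqI:
  assumes F: "theory_morphism (presented P) T F" and G: "theory_morphism (presented P) T G"
    and ty: "\<And>g. g \<in> TyGens P \<Longrightarrow> on_obj F (ty_class P (TyGen g)) = on_obj G (ty_class P (TyGen g))"
    and tm: "\<And>t. t \<in> TmGens P \<Longrightarrow> wf_ty P (GDom P t) \<Longrightarrow> wf_ty P (GCod P t) \<Longrightarrow>
      on_arr F (tm_class P (TmGen t)) = on_arr G (tm_class P (TmGen t))"
  shows "F = G"
proof (rule theory_morphism_eqI[OF F G])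
  note ev = theory_morphism_presented_eval[OF F] theory_morphism_presented_eval[OF G]
  fix C assume "C \<in> Obj (presented P)"
  then obtain X where X: "wf_ty P X" "C = ty_class P X"
    unfolding presented_Obj by blast
  show "on_obj F C = on_obj G C"
    unfolding X(2) ev(1)[OF X(1)] ev(3)[OF X(1)]
    by (rule tm_eval_cong_gen(1)[OF _ _ X(1)]) (simp_all add: ty)
next
  note ev = theory_morphism_presented_eval[OF F] theory_morphism_presented_eval[OF G]
  fix c assume "c \<in> Arr (presented P)"
  then obtain t X Y where t: "tm_typed P t X Y" "c = tm_class P t"
    unfolding presented_Arr by blast
  show "on_arr F c = on_arr G c"
    unfolding t(2) ev(2)[OF t(1)] ev(4)[OF t(1)]
    by (rule tm_eval_cong_gen(2)[OF _ _ t(1)]) (simp_all add: ty tm)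
qed

section \<open>Relations expressing a morphism\<close>

text \<open>Each relation is one clause of the definition of a morphism, so it holds in any
  interpretation that restricts to a morphism on the generators \<open>i X\<close> and
  \<open>j f\<close>. The next lemma is the counterpart: imposing the relations makes the generators
  into a morphism.\<close>

lemma mor_rel_eval:
  assumes F: "theory_morphism S T F"
    and i: "\<And>X. X \<in> Obj S \<Longrightarrow> a (i X) = on_obj F X"
    and j: "\<And>f. f \<in> Arr S \<Longrightarrow> b (j f) = on_arr F f"
  shows "(X, Y) \<in> mor_ty_rel S i \<Longrightarrow> ty_eval T a X = ty_eval T a Y"
    and "(t, u) \<in> mor_tm_rel S i j \<Longrightarrow> tm_eval T a b t = tm_eval T a b u"
proof -
  interpret S: eq_theory S using theory_morphismD(1)[OF F] .
  note f = theory_morphismD[OF F]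
  have map: "map (\<lambda>X. a (i X)) Xs = map (on_obj F) Xs" if "Xs \<in> lists (Obj S)" for Xs
    using that i by auto
  show "ty_eval T a X = ty_eval T a Y" if "(X, Y) \<in> mor_ty_rel S i"
  proof -
    obtain Xs where Xs: "X = TyGen (i (Prd S Xs))" "Y = TyPrd (map (\<lambda>X. TyGen (i X)) Xs)" "Xs \<in> lists (Obj S)"
      using \<open>(X, Y) \<in> mor_ty_rel S i\<close> unfolding mor_ty_rel_def by blast
    then show ?thesis
      using f(9)[OF Xs(3)] S.prd_closed[OF Xs(3)] by (simp add: comp_def i map[OF Xs(3)])
  qed
  show "tm_eval T a b t = tm_eval T a b u" if "(t, u) \<in> mor_tm_rel S i j"
    using that unfolding mor_tm_rel_def
  proof (elim UnE CollectE exE conjE)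
    fix X assume "(t, u) = (TmGen (j (Ident S X)), TmId (TyGen (i X)))" "X \<in> Obj S"
    then show ?thesis
      using S.ident_hom f(7) i j by (simp add: hom_iff)
  next
    fix g f assume "(t, u) = (TmGen (j (Comp S g f)), TmComp (TmGen (j g)) (TmGen (j f)))"
      "f \<in> Arr S" "g \<in> Arr S" "Cod S f = Dom S g"
    then show ?thesis
      using S.comp_arr f(8) j by simp
  next
    fix Xs k assume *: "(t, u) = (TmGen (j (Prj S Xs k)), TmPrj (map (\<lambda>X. TyGen (i X)) Xs) k)"
      "Xs \<in> lists (Obj S)" "k < length Xs"
    then show ?thesis
      using S.prj_hom[OF *(2,3)] f(10)[OF *(2,3)] by (simp add: hom_iff comp_def j map[OF *(2)])
  qed
qed

text \<open>Provides both coprojections of a pushout and the map from the pure terms into the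
  parameterized theory.\<close>

lemma mor_rel_morphism:
  assumes S: "eq_theory S"
    and gens: "\<And>X. X \<in> Obj S \<Longrightarrow> i X \<in> TyGens P" "\<And>f. f \<in> Arr S \<Longrightarrow> j f \<in> TmGens P"
      "\<And>f. f \<in> Arr S \<Longrightarrow> GDom P (j f) = TyGen (i (Dom S f))"
      "\<And>f. f \<in> Arr S \<Longrightarrow> GCod P (j f) = TyGen (i (Cod S f))"
    and rels: "mor_ty_rel S i \<subseteq> TyRel P" "mor_tm_rel S i j \<subseteq> TmRel P"
  shows "theory_morphism S (presented P)
    \<lparr>on_obj = (\<lambda>X \<in> Obj S. ty_class P (TyGen (i X))), on_arr = (\<lambda>f \<in> Arr S. tm_class P (TmGen (j f)))\<rparr>"
    (is "theory_morphism S _ ?F")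
proof -
  interpret S: eq_theory S by fact
  have typed: "tm_typed P (TmGen (j f)) (TyGen (i X)) (TyGen (i Y))" if "f \<in> hom S X Y" for f X Y
    using tm_typed.gen[of "j f" P] gens that S.hom_obj[OF that] by (simp add: hom_iff)
  have rel: "tm_class P (TmGen (j f)) = tm_class P t"
    if "(TmGen (j f), t) \<in> mor_tm_rel S i j" "f \<in> hom S X Y" "tm_typed P t (TyGen (i X)) (TyGen (i Y))" for f t X Y
    using that rels(2) typed by (auto intro!: tm_class_eqI tm_eq.rel)
  have map: "map (on_obj ?F) Xs = map (ty_class P) (map (\<lambda>X. TyGen (i X)) Xs)"
    and wf: "\<forall>X \<in> set (map (\<lambda>X. TyGen (i X)) Xs). wf_ty P X"
    if "Xs \<in> lists (Obj S)" for Xs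
    using that gens(1) by auto
  have prd: "ty_eq P (TyGen (i (Prd S Xs))) (TyPrd (map (\<lambda>X. TyGen (i X)) Xs))" if "Xs \<in> lists (Obj S)" for Xs
    using that rels(1) wf[OF that] gens(1) S.prd_closed[OF that]
    by (intro ty_eq.rel) (auto simp: mor_ty_rel_def)
  show ?thesis
  proof (intro theory_morphismI S eq_theory_presented)
    fix X assume X: "X \<in> Obj S"
    then show "on_obj ?F X \<in> Obj (presented P)"
      using gens(1) by (auto simp: presented_Obj intro!: exI[of _ "TyGen (i X)"])
    have "(TmGen (j (Ident S X)), TmId (TyGen (i X))) \<in> mor_tm_rel S i j"
      using X by (auto simp: mor_tm_rel_def)
    then show "on_arr ?F (Ident S X) = Ident (presented P) (on_obj ?F X)"
      using X S.ident_hom[OF X] gens(1)[OF X]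
      by (simp add: hom_iff presented_Ident rel[OF _ S.ident_hom tm_typed.ident])
  next
    fix f assume f: "f \<in> Arr S"
    then have f': "f \<in> hom S (Dom S f) (Cod S f)"
      by (simp add: hom_iff)
    then show "on_arr ?F f \<in> hom (presented P) (on_obj ?F (Dom S f)) (on_obj ?F (Cod S f))"
      using f S.hom_obj presented_homI[OF typed[OF f']] by simp
    fix g assume g: "g \<in> Arr S" and fg: "Cod S f = Dom S g"
    then have g': "g \<in> hom S (Cod S f) (Cod S g)"
      by (simp add: hom_iff)
    have "(TmGen (j (Comp S g f)), TmComp (TmGen (j g)) (TmGen (j f))) \<in> mor_tm_rel S i j"
      using f g fg by (auto simp: mor_tm_rel_def)
    from rel[OF this S.comp_hom[OF f' g'] tm_typed.comp[OF typed[OF f'] typed[OF g']]]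
    show "on_arr ?F (Comp S g f) = Comp (presented P) (on_arr ?F g) (on_arr ?F f)"
      using f g S.comp_arr(1)[OF f g fg] by (simp add: presented_Comp[OF typed[OF f'] typed[OF g']])
  next
    fix Xs assume Xs: "Xs \<in> lists (Obj S)"
    show "on_obj ?F (Prd S Xs) = Prd (presented P) (map (on_obj ?F) Xs)"
      unfolding map[OF Xs] presented_Prd[OF wf[OF Xs]]
      using S.prd_closed[OF Xs] ty_class_eqI[OF prd[OF Xs]] by simp
    fix k assume k: "k < length Xs"
    have "(TmGen (j (Prj S Xs k)), TmPrj (map (\<lambda>X. TyGen (i X)) Xs) k) \<in> mor_tm_rel S i j"
      using Xs k by (auto simp: mor_tm_rel_def)
    \<comment> \<open>The generator for a projection has source \<open>i (Prd S Xs)\<close>, the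
      syntactic projection has the formal product as source. A relation takes effect only between
      terms of the same type, so the type relation has to identify the sources first.\<close>
    moreover have "tm_typed P (TmPrj (map (\<lambda>X. TyGen (i X)) Xs) k) (TyGen (i (Prd S Xs))) (TyGen (i (Xs ! k)))"
    proof (rule tm_typed.conv)
      show "tm_typed P (TmPrj (map (\<lambda>X. TyGen (i X)) Xs) k) (TyPrd (map (\<lambda>X. TyGen (i X)) Xs))
          (map (\<lambda>X. TyGen (i X)) Xs ! k)"
        using wf[OF Xs] k by (intro tm_typed.prj) auto
      show "ty_eq P (TyPrd (map (\<lambda>X. TyGen (i X)) Xs)) (TyGen (i (Prd S Xs)))"
        using prd[OF Xs] by (rule ty_eq.sym)
      show "ty_eq P (map (\<lambda>X. TyGen (i X)) Xs ! k) (TyGen (i (Xs ! k)))"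
        using k Xs gens(1) by (auto intro!: ty_eq.refl)
    qed
    ultimately have "tm_class P (TmGen (j (Prj S Xs k))) = tm_class P (TmPrj (map (\<lambda>X. TyGen (i X)) Xs) k)"
      using rel S.prj_hom[OF Xs k] by blast
    then show "on_arr ?F (Prj S Xs k) = Prj (presented P) (map (on_obj ?F) Xs) k"
      unfolding map[OF Xs] using S.prj_hom[OF Xs k] presented_Prj[OF wf[OF Xs], of k] k
      by (simp add: hom_iff)
  qed auto
qed

section \<open>Pushouts\<close>

locale theory_span =
  fixes S :: "('o, 'm) thy" and T1 :: "('o1, 'm1) thy" and T2 :: "('o2, 'm2) thy"
    and F :: "('o, 'm, 'o1, 'm1) thy_mor" and G :: "('o, 'm, 'o2, 'm2) thy_mor"
  assumes F: "theory_morphism S T1 F" and G: "theory_morphism S T2 G"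
begin

abbreviation "P \<equiv> pushout_pres S T1 T2 F G"

sublocale S: eq_theory S using theory_morphismD(1)[OF F] .
sublocale T1: eq_theory T1 using theory_morphismD(2)[OF F] .
sublocale T2: eq_theory T2 using theory_morphismD(2)[OF G] .

lemma in1_morphism: "theory_morphism T1 (presented P) (pushout_in1 S T1 T2 F G)"
  unfolding pushout_in1_def Let_def
  by (rule mor_rel_morphism[OF T1.eq_theory_axioms]) (auto simp: pushout_pres_def)

lemma in2_morphism: "theory_morphism T2 (presented P) (pushout_in2 S T1 T2 F G)"
  unfolding pushout_in2_def Let_def
  by (rule mor_rel_morphism[OF T2.eq_theory_axioms]) (auto simp: pushout_pres_def)

lemma typed_gen:
  "f \<in> Arr T1 \<Longrightarrow> tm_typed P (TmGen (Inl f)) (TyGen (Inl (Dom T1 f))) (TyGen (Inl (Cod T1 f)))"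
  "g \<in> Arr T2 \<Longrightarrow> tm_typed P (TmGen (Inr g)) (TyGen (Inr (Dom T2 g))) (TyGen (Inr (Cod T2 g)))"
  using tm_typed.gen[of "Inl f" P] tm_typed.gen[of "Inr g" P]
    T1.dom_closed T1.cod_closed T2.dom_closed T2.cod_closed
  by (auto simp: pushout_pres_def)

lemma commutes_obj:
  assumes X: "X \<in> Obj S"
  shows "on_obj (pushout_in1 S T1 T2 F G) (on_obj F X) = on_obj (pushout_in2 S T1 T2 F G) (on_obj G X)"
  using theory_morphismD(5)[OF F X] theory_morphismD(5)[OF G X] X
  by (auto simp: pushout_in1_def pushout_in2_def Let_def pushout_pres_def intro!: ty_class_eqI ty_eq.rel)

lemma commutes_arr:
  assumes f: "f \<in> Arr S"
  shows "on_arr (pushout_in1 S T1 T2 F G) (on_arr F f) = on_arr (pushout_in2 S T1 T2 F G) (on_arr G f)"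
proof -
  note hom = theory_morphismD(6)[OF F f] theory_morphismD(6)[OF G f]
  \<comment> \<open>The two terms to be glued have types in different summands. The glueing of types
    gives them a common typing, without which the relation between them could not be
    applied.\<close>
  have eq: "ty_eq P (TyGen (Inr (on_obj G X))) (TyGen (Inl (on_obj F X)))" if "X \<in> Obj S" for X
    using that theory_morphismD(5)[OF F that] theory_morphismD(5)[OF G that]
    by (intro ty_eq.sym[OF ty_eq.rel]) (auto simp: pushout_pres_def)
  have t: "tm_typed P (TmGen (Inl (on_arr F f))) (TyGen (Inl (on_obj F (Dom S f)))) (TyGen (Inl (on_obj F (Cod S f))))"
    "tm_typed P (TmGen (Inr (on_arr G f))) (TyGen (Inr (on_obj G (Dom S f)))) (TyGen (Inr (on_obj G (Cod S f))))"
    using typed_gen(1)[of "on_arr F f"] typed_gen(2)[of "on_arr G f"] hom by (auto simp: hom_iff)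
  have "tm_class P (TmGen (Inl (on_arr F f))) = tm_class P (TmGen (Inr (on_arr G f)))"
    by (rule tm_class_eqI[OF tm_eq.rel[OF _ t(1) tm_typed.conv[OF t(2)]]])
      (use f eq S.dom_closed S.cod_closed in \<open>auto simp: pushout_pres_def\<close>)
  then show ?thesis
    using hom by (simp add: pushout_in1_def pushout_in2_def Let_def hom_iff)
qed

text \<open>Existence for the pushout. The relations fall into three groups: those of
  \<open>T1\<close> hold because \<open>u\<close> is a morphism, those of \<open>T2\<close> because
  \<open>v\<close> is one, and the glueing relations because the square commutes.\<close>

lemma pushout_model:
  assumes U: "theory_morphism T1 U u" and V: "theory_morphism T2 U v"
    and a: "\<And>X. X \<in> Obj T1 \<Longrightarrow> a (Inl X) = on_obj u X" "\<And>X. X \<in> Obj T2 \<Longrightarrow> a (Inr X) = on_obj v X"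
    and b: "\<And>f. f \<in> Arr T1 \<Longrightarrow> b (Inl f) = on_arr u f" "\<And>f. f \<in> Arr T2 \<Longrightarrow> b (Inr f) = on_arr v f"
    and comm: "\<And>X. X \<in> Obj S \<Longrightarrow> on_obj u (on_obj F X) = on_obj v (on_obj G X)"
      "\<And>f. f \<in> Arr S \<Longrightarrow> on_arr u (on_arr F f) = on_arr v (on_arr G f)"
  shows "presentation_model U P a b"
proof -
  interpret U: eq_theory U using theory_morphismD(2)[OF U] .
  show ?thesis
  proof
    fix g assume "g \<in> TyGens P"
    then show "a g \<in> Obj U"
      using a theory_morphismD(5)[OF U] theory_morphismD(5)[OF V] by (auto simp: pushout_pres_def)
  next
    fix t assume "t \<in> TmGens P"
    then show "b t \<in> hom U (ty_eval U a (GDom P t)) (ty_eval U a (GCod P t))"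
      using a b theory_morphismD(6)[OF U] theory_morphismD(6)[OF V]
        T1.dom_closed T1.cod_closed T2.dom_closed T2.cod_closed
      by (auto simp: pushout_pres_def)
  next
    fix X Y assume "(X, Y) \<in> TyRel P"
    then consider "(X, Y) \<in> mor_ty_rel T1 Inl" | "(X, Y) \<in> mor_ty_rel T2 Inr"
      | Z where "X = TyGen (Inl (on_obj F Z))" "Y = TyGen (Inr (on_obj G Z))" "Z \<in> Obj S"
      by (auto simp: pushout_pres_def)
    then show "ty_eval U a X = ty_eval U a Y"
    proof cases
      case 3
      then show ?thesis
        using comm a theory_morphismD(5)[OF F] theory_morphismD(5)[OF G] by simp
    qed (use mor_rel_eval(1)[of T1 U u a Inl b Inl, OF U a(1) b(1)]
        mor_rel_eval(1)[of T2 U v a Inr b Inr, OF V a(2) b(2)] in blast)+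
  next
    fix t s assume "(t, s) \<in> TmRel P"
    then consider "(t, s) \<in> mor_tm_rel T1 Inl Inl" | "(t, s) \<in> mor_tm_rel T2 Inr Inr"
      | f where "t = TmGen (Inl (on_arr F f))" "s = TmGen (Inr (on_arr G f))" "f \<in> Arr S"
      by (auto simp: pushout_pres_def)
    then show "tm_eval U a b t = tm_eval U a b s"
    proof cases
      case 3
      then show ?thesis
        using comm b theory_morphismD(6)[OF F] theory_morphismD(6)[OF G] by (simp add: hom_iff)
    qed (use mor_rel_eval(2)[of T1 U u a Inl b Inl, OF U a(1) b(1)]
        mor_rel_eval(2)[of T2 U v a Inr b Inr, OF V a(2) b(2)] in blast)+
  qed
qed

end

section \<open>Decorated theories\<close>

lemma pure_part_simps [simp]:
  "Obj (pure_part \<Theta>) = Obj \<Theta>" "Arr (pure_part \<Theta>) = PureArr \<Theta>"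
  "Dom (pure_part \<Theta>) = Dom \<Theta>" "Cod (pure_part \<Theta>) = Cod \<Theta>"
  "Ident (pure_part \<Theta>) = Ident \<Theta>" "Comp (pure_part \<Theta>) = Comp \<Theta>"
  "Prd (pure_part \<Theta>) = Prd \<Theta>" "Prj (pure_part \<Theta>) = Prj \<Theta>"
  by (simp_all add: pure_part_def thy.defs)

lemma H_obj_simps [simp]:
  "Obj (H_obj \<Theta>) = Obj \<Theta>" "Arr (H_obj \<Theta>) = Arr \<Theta>"
  "Dom (H_obj \<Theta>) = Dom \<Theta>" "Cod (H_obj \<Theta>) = Cod \<Theta>"
  "Ident (H_obj \<Theta>) = Ident \<Theta>" "Comp (H_obj \<Theta>) = Comp \<Theta>"
  "Prd (H_obj \<Theta>) = Prd \<Theta>" "Prj (H_obj \<Theta>) = Prj \<Theta>"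
  by (simp_all add: H_obj_def thy.defs)

lemma eq_theory_H_obj [simp]: "eq_theory (H_obj \<Theta>) \<longleftrightarrow> eq_theory \<Theta>"
  by (simp add: eq_theory_def eq_theory_axioms_def category_def hom_def)

lemma theory_morphism_H_obj [simp]:
  "theory_morphism (H_obj \<Theta>) T F \<longleftrightarrow> theory_morphism \<Theta> T F"
  "theory_morphism S (H_obj \<Theta>) G \<longleftrightarrow> theory_morphism S \<Theta> G"
  by (simp_all add: theory_morphism_def)

lemma pure_incl_simps [simp]:
  "X \<in> Obj \<Theta> \<Longrightarrow> on_obj (pure_incl \<Theta>) X = X" "f \<in> PureArr \<Theta> \<Longrightarrow> on_arr (pure_incl \<Theta>) f = f"
  by (simp_all add: pure_incl_def)

lemma hom_pure_part: "hom (pure_part \<Theta>) X Y = hom \<Theta> X Y \<inter> PureArr \<Theta>" if "PureArr \<Theta> \<subseteq> Arr \<Theta>"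
  using that by (auto simp: hom_def)

text \<open>The chosen products are those of the ambient theory: closure of pure terms under tuples
  gives existence of the mediating term, and its uniqueness is inherited.\<close>

lemma eq_theory_pure_part:
  assumes "decorated_theory \<Theta>"
  shows "eq_theory (pure_part \<Theta>)"
proof -
  interpret decorated_theory \<Theta> by fact
  note hom = hom_pure_part[OF pure_subset]
  show ?thesis
  proof
    fix f assume "f \<in> Arr (pure_part \<Theta>)"
    then show "Dom (pure_part \<Theta>) f \<in> Obj (pure_part \<Theta>)" "Cod (pure_part \<Theta>) f \<in> Obj (pure_part \<Theta>)"
      using pure_subset dom_closed cod_closed by auto
  next
    fix X assume "X \<in> Obj (pure_part \<Theta>)"
    then show "Ident (pure_part \<Theta>) X \<in> hom (pure_part \<Theta>) X X"
      using ident_hom pure_ident by (simp add: hom)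
  next
    fix f X Y assume f: "f \<in> hom (pure_part \<Theta>) X Y"
    then show "Comp (pure_part \<Theta>) (Ident (pure_part \<Theta>) Y) f = f"
      "Comp (pure_part \<Theta>) f (Ident (pure_part \<Theta>) X) = f"
      using ident_left ident_right by (auto simp: hom)
    fix g Z assume g: "g \<in> hom (pure_part \<Theta>) Y Z"
    then show "Comp (pure_part \<Theta>) g f \<in> hom (pure_part \<Theta>) X Z"
      using f comp_hom[of f X Y g Z] pure_comp[of f g] by (simp add: hom hom_iff)
    fix h W assume "h \<in> hom (pure_part \<Theta>) Z W"
    then show "Comp (pure_part \<Theta>) h (Comp (pure_part \<Theta>) g f) = Comp (pure_part \<Theta>) (Comp (pure_part \<Theta>) h g) f"
      using f g comp_assoc[of f X Y g Z h W] by (simp add: hom)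
  next
    fix Xs assume "Xs \<in> lists (Obj (pure_part \<Theta>))"
    then have Xs: "Xs \<in> lists (Obj \<Theta>)" by simp
    then show "Prd (pure_part \<Theta>) Xs \<in> Obj (pure_part \<Theta>)"
      using prd_closed by simp
    show "Prj (pure_part \<Theta>) Xs i \<in> hom (pure_part \<Theta>) (Prd (pure_part \<Theta>) Xs) (Xs ! i)"
      if "i < length Xs" for i
      using prj_hom[OF Xs that] pure_prj[OF Xs that] by (simp add: hom)
    fix X fs
    assume X: "X \<in> Obj (pure_part \<Theta>)" and len: "length fs = length Xs"
      and fs: "\<And>i. i < length Xs \<Longrightarrow> fs ! i \<in> hom (pure_part \<Theta>) X (Xs ! i)"
    have X': "X \<in> Obj \<Theta>"
      using X by simp
    have fs': "list_all2 (\<lambda>f Y. f \<in> hom \<Theta> X Y) fs Xs"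
      using fs len by (auto simp: list_all2_conv_all_nth hom)
    have pure: "\<forall>f \<in> set fs. f \<in> PureArr \<Theta> \<and> Dom \<Theta> f = X"
      using fs len by (auto simp: in_set_conv_nth hom hom_iff)
    have "tuple \<Theta> X fs \<in> hom (pure_part \<Theta>) X (Prd \<Theta> Xs)"
      using tuple_hom[OF X' fs'] pure_tuple[OF X', of fs] pure by (auto simp: hom)
    moreover have "\<forall>i < length Xs. Comp \<Theta> (Prj \<Theta> Xs i) (tuple \<Theta> X fs) = fs ! i"
      using prj_tuple[OF X' fs'] len by simp
    moreover have "h = tuple \<Theta> X fs"
      if "h \<in> hom \<Theta> X (Prd \<Theta> Xs)" "\<forall>i < length Xs. Comp \<Theta> (Prj \<Theta> Xs i) h = fs ! i" for h
      using tuple_eqI[OF that(1) fs'] that(2) len by simp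
    ultimately show "\<exists>!h. h \<in> hom (pure_part \<Theta>) X (Prd (pure_part \<Theta>) Xs) \<and>
        (\<forall>i < length Xs. Comp (pure_part \<Theta>) (Prj (pure_part \<Theta>) Xs i) h = fs ! i)"
      by (intro ex1I[of _ "tuple \<Theta> X fs"]) (auto simp: hom)
  qed
qed

text \<open>Composing with \<open>pure_incl\<close> restricts \<open>\<phi>\<close> to the pure
  terms. The restriction has to be explicit, since a morphism from the pure part is undefined on the
  other terms.\<close>

lemma theory_morphism_pure:
  assumes "dec_morphism \<Theta> \<Theta>' \<phi>"
  shows "theory_morphism (pure_part \<Theta>) (pure_part \<Theta>') (mor_comp (pure_part \<Theta>) \<phi> (pure_incl \<Theta>))"
    (is "theory_morphism _ _ ?F")
proof -
  have dec: "decorated_theory \<Theta>" "decorated_theory \<Theta>'" and \<phi>: "theory_morphism \<Theta> \<Theta>' \<phi>"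
    and im: "on_arr \<phi> ` PureArr \<Theta> \<subseteq> PureArr \<Theta>'"
    using assms by (auto simp: dec_morphism_def)
  interpret decorated_theory \<Theta> by fact
  interpret \<Theta>': decorated_theory \<Theta>' by fact
  note f = theory_morphismD[OF \<phi>]
  have F: "on_obj ?F X = on_obj \<phi> X" if "X \<in> Obj \<Theta>" for X
    using that by simp
  have F': "on_arr ?F g = on_arr \<phi> g" if "g \<in> PureArr \<Theta>" for g
    using that by simp
  have Arr: "g \<in> Arr \<Theta>" if "g \<in> PureArr \<Theta>" for g
    using that pure_subset by blast
  have map: "map (on_obj ?F) Xs = map (on_obj \<phi>) Xs" if "Xs \<in> lists (Obj \<Theta>)" for Xs
    using that F by auto
  show ?thesis
  proof (intro theory_morphismI eq_theory_pure_part dec)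
    show "on_obj ?F \<in> extensional (Obj (pure_part \<Theta>))" "on_arr ?F \<in> extensional (Arr (pure_part \<Theta>))"
      by (simp_all add: mor_comp_def)
    fix g assume g: "g \<in> Arr (pure_part \<Theta>)"
    then show "on_arr ?F g \<in> hom (pure_part \<Theta>')
        (on_obj ?F (Dom (pure_part \<Theta>) g)) (on_obj ?F (Cod (pure_part \<Theta>) g))"
      using f(6)[OF Arr] im dom_closed[OF Arr] cod_closed[OF Arr]
      by (auto simp: F F' hom_pure_part[OF \<Theta>'.pure_subset])
    fix h assume "h \<in> Arr (pure_part \<Theta>)" "Cod (pure_part \<Theta>) g = Dom (pure_part \<Theta>) h"
    then show "on_arr ?F (Comp (pure_part \<Theta>) h g) = Comp (pure_part \<Theta>') (on_arr ?F h) (on_arr ?F g)"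
      using g f(8)[OF Arr Arr] by (simp add: F' pure_comp)
  next
    fix Xs assume "Xs \<in> lists (Obj (pure_part \<Theta>))"
    then have Xs: "Xs \<in> lists (Obj \<Theta>)" by simp
    then show "on_obj ?F (Prd (pure_part \<Theta>) Xs) = Prd (pure_part \<Theta>') (map (on_obj ?F) Xs)"
      unfolding map[OF Xs] using f(9)[OF Xs] prd_closed[OF Xs] by (simp add: F)
    show "on_arr ?F (Prj (pure_part \<Theta>) Xs i) = Prj (pure_part \<Theta>') (map (on_obj ?F) Xs) i"
      if "i < length Xs" for i
      unfolding map[OF Xs] using f(10)[OF Xs that] pure_prj[OF Xs that] by (simp add: F')
  qed (use f(5,7) pure_ident in \<open>simp_all add: F F'\<close>)
qed

section \<open>The universal property of the parameterized theory\<close>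

text \<open>What a morphism from the parameterized theory to \<open>T\<close> amounts to: a morphism
  \<open>K\<close> on pure terms, a type \<open>A\<close>, and terms \<open>p f\<close> in the role
  of \<open>f'\<close>. Keeping \<open>T\<close> arbitrary allows one calculation to serve the
  generated theory, its extension by a constant, and the change of decorated theory.\<close>

locale exp_algebra = decorated_theory \<Theta> for \<Theta> :: "('o, 'm) dec_thy" +
  fixes T :: "('p, 'n) thy" and K :: "('o, 'm, 'p, 'n) thy_mor" and A :: 'p and p :: "'m \<Rightarrow> 'n"
  assumes K: "theory_morphism (pure_part \<Theta>) T K"
    and A: "A \<in> Obj T"
    and p_hom: "f \<in> hom \<Theta> X Y \<Longrightarrow> p f \<in> hom T (Prd T [A, on_obj K X]) (on_obj K Y)"
    and p_pure: "f \<in> PureArr \<Theta> \<Longrightarrow>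
      p f = Comp T (on_arr K f) (Prj T [A, on_obj K (Dom \<Theta> f)] (Suc 0))"
    and p_comp: "\<lbrakk>f \<in> hom \<Theta> X Y; g \<in> hom \<Theta> Y Z\<rbrakk> \<Longrightarrow> p (Comp \<Theta> g f) =
      Comp T (p g) (tuple T (Prd T [A, on_obj K X]) [Prj T [A, on_obj K X] 0, p f])"
    and p_tuple: "\<lbrakk>X \<in> Obj \<Theta>; list_all2 (\<lambda>f Y. f \<in> hom \<Theta> X Y) fs Ys\<rbrakk> \<Longrightarrow>
      p (tuple \<Theta> X fs) = tuple T (Prd T [A, on_obj K X]) (map p fs)"
begin

sublocale T: eq_theory T using theory_morphismD(2)[OF K] .

lemma K_obj: "X \<in> Obj \<Theta> \<Longrightarrow> on_obj K X \<in> Obj T"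
  using theory_morphismD(5)[OF K] by simp

lemma K_hom: "f \<in> PureArr \<Theta> \<Longrightarrow> on_arr K f \<in> hom T (on_obj K (Dom \<Theta> f)) (on_obj K (Cod \<Theta> f))"
  using theory_morphismD(6)[OF K] by simp

lemma par_lists: "X \<in> Obj \<Theta> \<Longrightarrow> [A, on_obj K X] \<in> lists (Obj T)"
  using A K_obj by simp

lemma par_prj:
  assumes "X \<in> Obj \<Theta>"
  shows "Prj T [A, on_obj K X] 0 \<in> hom T (Prd T [A, on_obj K X]) A"
    and "Prj T [A, on_obj K X] (Suc 0) \<in> hom T (Prd T [A, on_obj K X]) (on_obj K X)"
  using T.prj_hom[OF par_lists[OF assms], of 0] T.prj_hom[OF par_lists[OF assms], of "Suc 0"] by auto

text \<open>The relations of \<open>exp_pres\<close> evaluate to the axioms of the locale. The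
  interpretation is prescribed on generators only, so it may later be given by formulas such as
  \<open>map_exp_tygen\<close> that differ from \<open>K\<close> elsewhere.\<close>

lemma exp_model:
  assumes a: "\<And>X. X \<in> Obj \<Theta> \<Longrightarrow> a (OldTy X) = on_obj K X" "a ParTy = A"
    and b: "\<And>f. f \<in> PureArr \<Theta> \<Longrightarrow> b (OldTm f) = on_arr K f" "\<And>f. f \<in> Arr \<Theta> \<Longrightarrow> b (Prime f) = p f"
  shows "presentation_model T (exp_pres \<Theta>) a b"
proof
  note simps = par_times_def pr_def eps_def a b
  show "a g \<in> Obj T" if "g \<in> TyGens (exp_pres \<Theta>)" for g
    using that K_obj A a by (auto simp: exp_pres_def)
  show "b t \<in> hom T (ty_eval T a (GDom (exp_pres \<Theta>) t)) (ty_eval T a (GCod (exp_pres \<Theta>) t))"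
    if t: "t \<in> TmGens (exp_pres \<Theta>)" for t
  proof -
    consider f where "t = OldTm f" "f \<in> PureArr \<Theta>" | f where "t = Prime f" "f \<in> Arr \<Theta>"
      using t by (auto simp: exp_pres_def)
    then show ?thesis
    proof cases
      case 1
      then have "f \<in> Arr \<Theta>"
        using pure_subset by blast
      then show ?thesis
        using 1 K_hom dom_closed cod_closed by (simp add: exp_pres_def simps)
    next
      case 2
      then show ?thesis
        using p_hom[of f "Dom \<Theta> f" "Cod \<Theta> f"] dom_closed cod_closed
        by (simp add: exp_pres_def simps hom_iff)
    qed
  qed
  have mor: "\<And>X. X \<in> Obj (pure_part \<Theta>) \<Longrightarrow> a (OldTy X) = on_obj K X"
    "\<And>f. f \<in> Arr (pure_part \<Theta>) \<Longrightarrow> b (OldTm f) = on_arr K f"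
    using a b by auto
  show "ty_eval T a X = ty_eval T a Y" if "(X, Y) \<in> TyRel (exp_pres \<Theta>)" for X Y
    using that mor_rel_eval(1)[of "pure_part \<Theta>" T K a OldTy b OldTm, OF K mor]
    by (simp add: exp_pres_def)
  show "tm_eval T a b t = tm_eval T a b u" if "(t, u) \<in> TmRel (exp_pres \<Theta>)" for t u
    using that unfolding exp_pres_def presentation.simps
  proof (elim UnE CollectE exE conjE)
    assume "(t, u) \<in> mor_tm_rel (pure_part \<Theta>) OldTy OldTm"
    then show ?thesis
      using mor_rel_eval(2)[of "pure_part \<Theta>" T K a OldTy b OldTm, OF K mor] by blast
  next
    fix f assume "(t, u) = (TmGen (Prime f), TmComp (TmGen (OldTm f)) (eps (Dom \<Theta> f)))"
      and f: "f \<in> PureArr \<Theta>"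
    moreover have "f \<in> Arr \<Theta>"
      using f pure_subset by blast
    ultimately show ?thesis
      using p_pure dom_closed by (simp add: simps)
  next
    fix g f assume "(t, u) = (TmGen (Prime (Comp \<Theta> g f)), TmComp (TmGen (Prime g))
        (TmTuple (TyPrd (par_times (Dom \<Theta> f))) [pr (Dom \<Theta> f), TmGen (Prime f)]))"
      and *: "f \<in> Arr \<Theta>" "g \<in> Arr \<Theta>" "Cod \<Theta> f = Dom \<Theta> g"
    then show ?thesis
      using p_comp[of f "Dom \<Theta> f" "Dom \<Theta> g" g "Cod \<Theta> g"] dom_closed comp_arr(1)[OF *]
      by (simp add: simps hom_iff)
  next
    fix X fs assume "(t, u) = (TmGen (Prime (tuple \<Theta> X fs)),
        TmTuple (TyPrd (par_times X)) (map (\<lambda>f. TmGen (Prime f)) fs))"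
      and *: "X \<in> Obj \<Theta>" "fs \<in> lists (Arr \<Theta>)" "\<forall>f \<in> set fs. Dom \<Theta> f = X"
    have fs: "list_all2 (\<lambda>f Y. f \<in> hom \<Theta> X Y) fs (map (Cod \<Theta>) fs)"
      using * by (auto simp: list_all2_conv_all_nth hom_iff)
    have map: "map (\<lambda>f. b (Prime f)) fs = map p fs"
      using * b by auto
    then show ?thesis
      using \<open>(t, u) = _\<close> p_tuple[OF *(1) fs] tuple_hom[OF *(1) fs] *(1)
      by (simp add: simps hom_iff comp_def map)
  qed
qed

text \<open>The axioms are equations between composites, tuples and projections, all of which a
  morphism of theories preserves. Applied to a coprojection, this yields the algebra in the theory
  with a constant.\<close>

lemma exp_algebra_comp:
  assumes G: "theory_morphism T U G"
  shows "exp_algebra \<Theta> U (mor_comp (pure_part \<Theta>) G K) (on_obj G A) (\<lambda>f. on_arr G (p f))"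
proof -
  note g = theory_morphismD[OF G]
  have obj: "on_obj (mor_comp (pure_part \<Theta>) G K) X = on_obj G (on_obj K X)" if "X \<in> Obj \<Theta>" for X
    using that by simp
  have arr: "on_arr (mor_comp (pure_part \<Theta>) G K) f = on_arr G (on_arr K f)" if "f \<in> PureArr \<Theta>" for f
    using that by simp
  have Prd: "on_obj G (Prd T [A, on_obj K X]) = Prd U [on_obj G A, on_obj G (on_obj K X)]"
    if "X \<in> Obj \<Theta>" for X
    using g(9)[OF par_lists[OF that]] by simp
  have Prj: "on_arr G (Prj T [A, on_obj K X] i) = Prj U [on_obj G A, on_obj G (on_obj K X)] i"
    if "X \<in> Obj \<Theta>" "i < 2" for X i
    using g(10)[OF par_lists[OF that(1)], of i] that(2) by simp
  show ?thesis
  proof (intro exp_algebra.intro decorated_theory_axioms exp_algebra_axioms.intro)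
    show "theory_morphism (pure_part \<Theta>) U (mor_comp (pure_part \<Theta>) G K)"
      using K G by (rule theory_morphism_comp)
    show "on_obj G A \<in> Obj U"
      using g(5) A .
  next
    fix f X Y assume f: "f \<in> hom \<Theta> X Y"
    then have XY: "X \<in> Obj \<Theta>" "Y \<in> Obj \<Theta>"
      using hom_obj by auto
    note obj = obj[OF XY(1)] obj[OF XY(2)]
    show "on_arr G (p f) \<in> hom U (Prd U [on_obj G A, on_obj (mor_comp (pure_part \<Theta>) G K) X])
        (on_obj (mor_comp (pure_part \<Theta>) G K) Y)"
      using theory_morphism_hom[OF G p_hom[OF f]] unfolding Prd[OF XY(1)] obj .
    fix h Z assume h: "h \<in> hom \<Theta> Y Z"
    have fs: "list_all2 (\<lambda>f Y. f \<in> hom T (Prd T [A, on_obj K X]) Y) [Prj T [A, on_obj K X] 0, p f] [A, on_obj K Y]"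
      using par_prj(1)[OF XY(1)] p_hom[OF f] by simp
    have P: "Prd T [A, on_obj K X] \<in> Obj T"
      using T.prd_closed[OF par_lists[OF XY(1)]] .
    show "on_arr G (p (Comp \<Theta> h f)) = Comp U (on_arr G (p h))
        (tuple U (Prd U [on_obj G A, on_obj (mor_comp (pure_part \<Theta>) G K) X])
          [Prj U [on_obj G A, on_obj (mor_comp (pure_part \<Theta>) G K) X] 0, on_arr G (p f)])"
      unfolding p_comp[OF f h] obj theory_morphism_comp_hom[OF G T.tuple_hom[OF P fs] p_hom[OF h]]
        theory_morphism_tuple[OF G P fs] Prd[OF XY(1)] using Prj[OF XY(1), of 0] by simp
  next
    fix f assume f: "f \<in> PureArr \<Theta>"
    then have X: "Dom \<Theta> f \<in> Obj \<Theta>"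
      using pure_subset dom_closed by blast
    show "on_arr G (p f) = Comp U (on_arr (mor_comp (pure_part \<Theta>) G K) f)
        (Prj U [on_obj G A, on_obj (mor_comp (pure_part \<Theta>) G K) (Dom \<Theta> f)] (Suc 0))"
      unfolding p_pure[OF f] obj[OF X] arr[OF f] theory_morphism_comp_hom[OF G par_prj(2)[OF X] K_hom[OF f]]
      using Prj[OF X, of "Suc 0"] by simp
  next
    fix X fs Ys assume X: "X \<in> Obj \<Theta>" and fs: "list_all2 (\<lambda>f Y. f \<in> hom \<Theta> X Y) fs Ys"
    have fs': "list_all2 (\<lambda>f Y. f \<in> hom T (Prd T [A, on_obj K X]) Y) (map p fs) (map (on_obj K) Ys)"
      using fs p_hom by (auto simp: list_all2_conv_all_nth)
    show "on_arr G (p (tuple \<Theta> X fs)) = tuple U (Prd U [on_obj G A, on_obj (mor_comp (pure_part \<Theta>) G K) X])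
        (map (\<lambda>f. on_arr G (p f)) fs)"
      unfolding p_tuple[OF X fs] obj[OF X]
        theory_morphism_tuple[OF G T.prd_closed[OF par_lists[OF X]] fs'] Prd[OF X]
      by (simp add: comp_def)
  qed
qed

text \<open>Algebras are contravariant in the decorated theory, because \<open>\<phi>\<close>
  preserves purity as well as composites and tuples. Here \<open>\<Theta>0\<close> is a second
  decorated theory, the source of \<open>\<phi>\<close>, and not a theory of pure terms.\<close>

lemma exp_algebra_dec_comp:
  fixes \<Theta>0 :: "('s, 'r) dec_thy"
  assumes \<phi>: "dec_morphism \<Theta>0 \<Theta> \<phi>"
  shows "exp_algebra \<Theta>0 T (mor_comp (pure_part \<Theta>0) K (mor_comp (pure_part \<Theta>0) \<phi> (pure_incl \<Theta>0))) A
    (\<lambda>f. p (on_arr \<phi> f))" (is "exp_algebra _ _ ?K _ _")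
proof -
  interpret \<Theta>0: decorated_theory \<Theta>0
    using \<phi> by (simp add: dec_morphism_def)
  have m: "theory_morphism \<Theta>0 \<Theta> \<phi>" and pure: "\<And>f. f \<in> PureArr \<Theta>0 \<Longrightarrow> on_arr \<phi> f \<in> PureArr \<Theta>"
    using \<phi> by (auto simp: dec_morphism_def)
  have obj: "on_obj ?K X = on_obj K (on_obj \<phi> X)" if "X \<in> Obj \<Theta>0" for X
    using that by simp
  have arr: "on_arr ?K f = on_arr K (on_arr \<phi> f)" if "f \<in> PureArr \<Theta>0" for f
    using that by simp
  note hom = theory_morphism_hom[OF m]
  show ?thesis
  proof (intro exp_algebra.intro \<Theta>0.decorated_theory_axioms exp_algebra_axioms.intro A)
    show "theory_morphism (pure_part \<Theta>0) T ?K"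
      using theory_morphism_pure[OF \<phi>] K by (rule theory_morphism_comp)
  next
    fix f X Y assume f: "f \<in> hom \<Theta>0 X Y"
    then have XY: "X \<in> Obj \<Theta>0" "Y \<in> Obj \<Theta>0"
      using \<Theta>0.hom_obj by auto
    note obj = obj[OF XY(1)] obj[OF XY(2)]
    show "p (on_arr \<phi> f) \<in> hom T (Prd T [A, on_obj ?K X]) (on_obj ?K Y)"
      unfolding obj using p_hom[OF hom[OF f]] .
    fix h Z assume h: "h \<in> hom \<Theta>0 Y Z"
    show "p (on_arr \<phi> (Comp \<Theta>0 h f)) = Comp T (p (on_arr \<phi> h))
        (tuple T (Prd T [A, on_obj ?K X]) [Prj T [A, on_obj ?K X] 0, p (on_arr \<phi> f)])"
      unfolding obj theory_morphism_comp_hom[OF m f h] using p_comp[OF hom[OF f] hom[OF h]] .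
  next
    fix f assume f: "f \<in> PureArr \<Theta>0"
    then have f': "f \<in> Arr \<Theta>0"
      using \<Theta>0.pure_subset by blast
    show "p (on_arr \<phi> f) = Comp T (on_arr ?K f) (Prj T [A, on_obj ?K (Dom \<Theta>0 f)] (Suc 0))"
      unfolding arr[OF f] obj[OF \<Theta>0.dom_closed[OF f']]
      using p_pure[OF pure[OF f]] theory_morphismD(6)[OF m f'] by (simp add: hom_iff)
  next
    fix X fs Ys assume X: "X \<in> Obj \<Theta>0" and fs: "list_all2 (\<lambda>f Y. f \<in> hom \<Theta>0 X Y) fs Ys"
    have fs': "list_all2 (\<lambda>f Y. f \<in> hom \<Theta> (on_obj \<phi> X) Y) (map (on_arr \<phi>) fs) (map (on_obj \<phi>) Ys)"
      using fs hom by (auto simp: list_all2_conv_all_nth)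
    show "p (on_arr \<phi> (tuple \<Theta>0 X fs)) = tuple T (Prd T [A, on_obj ?K X]) (map (\<lambda>f. p (on_arr \<phi> f)) fs)"
      unfolding obj[OF X] theory_morphism_tuple[OF m X fs]
      using p_tuple[OF theory_morphismD(5)[OF m X] fs'] by (simp add: comp_def)
  qed
qed

text \<open>\<open>in_par X\<close> is \<open>a \<times> id\<^sub>X : X \<rightarrow> A \<times> X\<close>, up to the isomorphism \<open>X \<cong> 1 \<times> X\<close>.\<close>

lemma
  assumes a: "a \<in> hom T (Prd T []) A"
  defines "in_par \<equiv> \<lambda>X. tuple T X [Comp T a (tuple T X []), Ident T X]"
  defines "F \<equiv> \<lparr>on_obj = on_obj K,
    on_arr = (\<lambda>f \<in> Arr \<Theta>. Comp T (p f) (in_par (on_obj K (Dom \<Theta> f))))\<rparr>"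
  shows fill_pure: "f \<in> PureArr \<Theta> \<Longrightarrow> on_arr F f = on_arr K f"
    and fill_morphism: "theory_morphism \<Theta> T F"
proof -
  have bang: "tuple T X [] \<in> hom T X (Prd T [])" if "X \<in> Obj T" for X
    using T.tuple_hom[OF that, of "[]" "[]"] by simp
  have fs: "list_all2 (\<lambda>f Y. f \<in> hom T X Y) [Comp T a (tuple T X []), Ident T X] [A, X]"
    if "X \<in> Obj T" for X
    using T.comp_hom[OF bang[OF that] a] T.ident_hom[OF that] by simp
  have in_par: "in_par X \<in> hom T X (Prd T [A, X])" if "X \<in> Obj T" for X
    using T.tuple_hom[OF that fs[OF that]] by (simp add: in_par_def)
  have prj_in_par: "Comp T (Prj T [A, X] 0) (in_par X) = Comp T a (tuple T X [])"
    "Comp T (Prj T [A, X] (Suc 0)) (in_par X) = Ident T X" if "X \<in> Obj T" for X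
    using T.prj_tuple[OF that fs[OF that], of 0] T.prj_tuple[OF that fs[OF that], of "Suc 0"]
    by (simp_all add: in_par_def)
  \<comment> \<open>Here it matters that \<open>a\<close> is a constant: the first component absorbs
    \<open>h\<close> because there is only one map to the terminal type.\<close>
  have in_par_comp: "Comp T (in_par Y) h = tuple T X [Comp T a (tuple T X []), h]" if h: "h \<in> hom T X Y" for X Y h
  proof -
    have XY: "X \<in> Obj T" "Y \<in> Obj T"
      using h T.hom_obj by auto
    have "Comp T (tuple T Y []) h = tuple T X []"
      using T.tuple_comp[of Y "[]" "[]" h X] h by simp
    then show ?thesis
      using T.tuple_comp[OF fs[OF XY(2)] h] T.comp_assoc[OF h bang[OF XY(2)] a] T.ident_left[OF h]
      by (simp add: in_par_def)
  qed
  have F: "on_arr F f = Comp T (p f) (in_par (on_obj K X))" if "f \<in> hom \<Theta> X Y" for f X Y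
    using that by (simp add: F_def hom_iff)
  have F_hom: "on_arr F f \<in> hom T (on_obj K X) (on_obj K Y)" if f: "f \<in> hom \<Theta> X Y" for f X Y
    unfolding F[OF f] using T.comp_hom[OF in_par[OF K_obj] p_hom[OF f]] hom_obj[OF f] by blast
  have pure: "on_arr F f = on_arr K f" if f: "f \<in> PureArr \<Theta>" for f
  proof -
    have "f \<in> Arr \<Theta>"
      using f pure_subset by blast
    then have X: "Dom \<Theta> f \<in> Obj \<Theta>" and f': "f \<in> hom \<Theta> (Dom \<Theta> f) (Cod \<Theta> f)"
      using dom_closed by (auto simp: hom_iff)
    show ?thesis
      unfolding F[OF f'] p_pure[OF f]
        T.comp_assoc[OF in_par[OF K_obj[OF X]] par_prj(2)[OF X] K_hom[OF f], symmetric]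
        prj_in_par(2)[OF K_obj[OF X]]
      using K_hom[OF f] by (rule T.ident_right)
  qed
  then show "f \<in> PureArr \<Theta> \<Longrightarrow> on_arr F f = on_arr K f" .
  note k = theory_morphismD[OF K]
  have obj: "on_obj F = on_obj K"
    by (simp add: F_def)
  show "theory_morphism \<Theta> T F"
  proof (intro theory_morphismI eq_theory_axioms T.eq_theory_axioms)
    show "on_obj F \<in> extensional (Obj \<Theta>)"
      using k(3) by (simp add: F_def)
    show "on_arr F \<in> extensional (Arr \<Theta>)"
      by (simp add: F_def)
    show "on_arr F (Ident \<Theta> X) = Ident T (on_obj F X)" "on_obj F X \<in> Obj T" if "X \<in> Obj \<Theta>" for X
      using that k(5,7) pure[OF pure_ident] by (simp_all add: obj)
    show "on_arr F f \<in> hom T (on_obj F (Dom \<Theta> f)) (on_obj F (Cod \<Theta> f))" if "f \<in> Arr \<Theta>" for f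
      unfolding obj using that by (intro F_hom) (simp add: hom_iff)
    show "on_obj F (Prd \<Theta> Xs) = Prd T (map (on_obj F) Xs)" if "Xs \<in> lists (Obj \<Theta>)" for Xs
      using k(9) that by (simp add: obj)
    show "on_arr F (Prj \<Theta> Xs i) = Prj T (map (on_obj F) Xs) i" if "Xs \<in> lists (Obj \<Theta>)" "i < length Xs" for Xs i
      using k(10) pure[OF pure_prj] that by (simp add: obj)
  next
    fix f g assume "f \<in> Arr \<Theta>" "g \<in> Arr \<Theta>" "Cod \<Theta> f = Dom \<Theta> g"
    then have f: "f \<in> hom \<Theta> (Dom \<Theta> f) (Dom \<Theta> g)" and g: "g \<in> hom \<Theta> (Dom \<Theta> g) (Cod \<Theta> g)"
      by (auto simp: hom_iff)
    let ?X = "on_obj K (Dom \<Theta> f)" and ?Y = "on_obj K (Dom \<Theta> g)"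
    have X: "Dom \<Theta> f \<in> Obj \<Theta>" "?X \<in> Obj T" and Y: "?Y \<in> Obj T"
      using hom_obj[OF f] K_obj by auto
    have ts: "list_all2 (\<lambda>f Y. f \<in> hom T (Prd T [A, ?X]) Y) [Prj T [A, ?X] 0, p f] [A, ?Y]"
      using par_prj(1)[OF X(1)] p_hom[OF f] by simp
    note m = in_par[OF X(2)]
    note tup = T.tuple_hom[OF T.prd_closed[OF par_lists[OF X(1)]] ts]
    have "on_arr F (Comp \<Theta> g f) =
        Comp T (p g) (Comp T (tuple T (Prd T [A, ?X]) [Prj T [A, ?X] 0, p f]) (in_par ?X))"
      unfolding F[OF comp_hom[OF f g]] p_comp[OF f g]
      using T.comp_assoc[OF m tup p_hom[OF g]] by simp
    also have "Comp T (tuple T (Prd T [A, ?X]) [Prj T [A, ?X] 0, p f]) (in_par ?X) =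
        tuple T ?X [Comp T a (tuple T ?X []), on_arr F f]"
      using T.tuple_comp[OF ts m] prj_in_par(1)[OF X(2)] F[OF f] by simp
    also have "\<dots> = Comp T (in_par ?Y) (on_arr F f)"
      using in_par_comp[OF F_hom[OF f]] by simp
    also have "Comp T (p g) (Comp T (in_par ?Y) (on_arr F f)) = Comp T (on_arr F g) (on_arr F f)"
      unfolding F[OF g] using T.comp_assoc[OF F_hom[OF f] in_par[OF Y] p_hom[OF g]] .
    finally show "on_arr F (Comp \<Theta> g f) = Comp T (on_arr F g) (on_arr F f)" .
  qed
qed

end

section \<open>The generic algebra\<close>

definition pure_to_exp :: "('o, 'm) dec_thy \<Rightarrow> ('o, 'm, ('o, 'm) exp_ty, ('o, 'm) exp_tm) thy_mor" where
  "pure_to_exp \<Theta> = \<lparr>on_obj = (\<lambda>X \<in> Obj \<Theta>. exp_type \<Theta> (OldTy X)),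
                     on_arr = (\<lambda>f \<in> PureArr \<Theta>. exp_term \<Theta> (OldTm f))\<rparr>"

text \<open>The axioms hold because they were imposed as relations. What has to be checked is that
  both sides of each relation are well typed with the same source and target, since only then does
  \<open>tm_eq\<close> contain it.\<close>

lemma exp_algebra_presented:
  assumes "decorated_theory \<Theta>"
  shows "exp_algebra \<Theta> (presented (exp_pres \<Theta>)) (pure_to_exp \<Theta>) (exp_type \<Theta> ParTy)
    (\<lambda>f. exp_term \<Theta> (Prime f))"
proof -
  interpret decorated_theory \<Theta> by fact
  let ?P = "exp_pres \<Theta>"
  interpret P: eq_theory "presented ?P" by (rule eq_theory_presented)
  have wf: "wf_ty ?P (TyGen ParTy)" "\<And>X. X \<in> Obj \<Theta> \<Longrightarrow> wf_ty ?P (TyGen (OldTy X))"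
    by (auto simp: exp_pres_def)
  have wf_par: "\<forall>Y \<in> set (par_times X). wf_ty ?P Y" if "X \<in> Obj \<Theta>" for X
    using wf that by (simp add: par_times_def)
  have typed_old: "tm_typed ?P (TmGen (OldTm f)) (TyGen (OldTy (Dom \<Theta> f))) (TyGen (OldTy (Cod \<Theta> f)))"
    if "f \<in> PureArr \<Theta>" for f
  proof -
    have "f \<in> Arr \<Theta>" using that pure_subset by blast
    then show ?thesis
      using tm_typed.gen[of "OldTm f" ?P] that wf(2) dom_closed cod_closed by (simp add: exp_pres_def)
  qed
  have typed: "tm_typed ?P (TmGen (Prime f)) (TyPrd (par_times X)) (TyGen (OldTy Y))" if "f \<in> hom \<Theta> X Y" for f X Y
    using tm_typed.gen[of "Prime f" ?P] that wf(2) wf_par hom_obj[OF that]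
    by (auto simp: exp_pres_def hom_iff)
  have obj: "on_obj (pure_to_exp \<Theta>) X = ty_class ?P (TyGen (OldTy X))" if "X \<in> Obj \<Theta>" for X
    using that by (simp add: pure_to_exp_def exp_type_def)
  have Prd: "Prd (presented ?P) [exp_type \<Theta> ParTy, on_obj (pure_to_exp \<Theta>) X] = ty_class ?P (TyPrd (par_times X))"
    if "X \<in> Obj \<Theta>" for X
    using presented_Prd[OF wf_par[OF that]] by (simp add: obj[OF that] exp_type_def par_times_def)
  have typed_prj: "tm_typed ?P (pr X) (TyPrd (par_times X)) (TyGen ParTy)"
    "tm_typed ?P (eps X) (TyPrd (par_times X)) (TyGen (OldTy X))" if "X \<in> Obj \<Theta>" for X
    using tm_typed.prj[of ?P "par_times X" 0] tm_typed.prj[of ?P "par_times X" 1] wf_par[OF that]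
    by (simp_all add: pr_def eps_def par_times_def)
  have Prj: "Prj (presented ?P) [exp_type \<Theta> ParTy, on_obj (pure_to_exp \<Theta>) X] 0 = tm_class ?P (pr X)"
    "Prj (presented ?P) [exp_type \<Theta> ParTy, on_obj (pure_to_exp \<Theta>) X] (Suc 0) = tm_class ?P (eps X)"
    if "X \<in> Obj \<Theta>" for X
    using presented_Prj[OF wf_par[OF that], of 0] presented_Prj[OF wf_par[OF that], of 1]
    by (simp_all add: obj[OF that] exp_type_def par_times_def pr_def eps_def)
  have K: "theory_morphism (pure_part \<Theta>) (presented ?P) (pure_to_exp \<Theta>)"
    using mor_rel_morphism[OF eq_theory_pure_part[OF assms], of OldTy ?P OldTm]
    by (simp add: pure_to_exp_def exp_type_def exp_term_def) (auto simp: exp_pres_def)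
  show ?thesis
  proof (intro exp_algebra.intro decorated_theory_axioms exp_algebra_axioms.intro K)
    show "exp_type \<Theta> ParTy \<in> Obj (presented ?P)"
      using wf(1) unfolding exp_type_def presented_Obj by blast
  next
    fix f X Y assume f: "f \<in> hom \<Theta> X Y"
    then have XY: "X \<in> Obj \<Theta>" "Y \<in> Obj \<Theta>"
      using hom_obj by auto
    show "exp_term \<Theta> (Prime f) \<in> hom (presented ?P)
        (Prd (presented ?P) [exp_type \<Theta> ParTy, on_obj (pure_to_exp \<Theta>) X]) (on_obj (pure_to_exp \<Theta>) Y)"
      unfolding Prd[OF XY(1)] obj[OF XY(2)] exp_term_def using typed[OF f] by (rule presented_homI)
    fix g Z assume g: "g \<in> hom \<Theta> Y Z"
    have ts: "list_all2 (\<lambda>t Y. tm_typed ?P t (TyPrd (par_times X)) Y) [pr X, TmGen (Prime f)] (par_times Y)"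
      using typed_prj(1)[OF XY(1)] typed[OF f] by (simp add: par_times_def)
    have tup: "tm_typed ?P (TmTuple (TyPrd (par_times X)) [pr X, TmGen (Prime f)]) (TyPrd (par_times X)) (TyPrd (par_times Y))"
      using wf_par[OF XY(1)] ts by (intro tm_typed.tuple) simp_all
    have "(TmGen (Prime (Comp \<Theta> g f)), TmComp (TmGen (Prime g)) (TmTuple (TyPrd (par_times X)) [pr X, TmGen (Prime f)]))
        \<in> TmRel ?P"
      unfolding exp_pres_def using f g by (auto simp: hom_iff)
    from tm_class_eqI[OF tm_eq.rel[OF this typed[OF comp_hom[OF f g]] tm_typed.comp[OF tup typed[OF g]]]]
    show "exp_term \<Theta> (Prime (Comp \<Theta> g f)) = Comp (presented ?P) (exp_term \<Theta> (Prime g))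
        (tuple (presented ?P) (Prd (presented ?P) [exp_type \<Theta> ParTy, on_obj (pure_to_exp \<Theta>) X])
          [Prj (presented ?P) [exp_type \<Theta> ParTy, on_obj (pure_to_exp \<Theta>) X] 0, exp_term \<Theta> (Prime f)])"
      unfolding Prd[OF XY(1)] Prj(1)[OF XY(1)] exp_term_def
      using presented_tuple[OF _ ts] wf_par[OF XY(1)] presented_Comp[OF tup typed[OF g]] by simp
  next
    fix f assume f: "f \<in> PureArr \<Theta>"
    then have "f \<in> Arr \<Theta>"
      using pure_subset by blast
    then have X: "Dom \<Theta> f \<in> Obj \<Theta>" and f': "f \<in> hom \<Theta> (Dom \<Theta> f) (Cod \<Theta> f)"
      using dom_closed by (auto simp: hom_iff)
    have "(TmGen (Prime f), TmComp (TmGen (OldTm f)) (eps (Dom \<Theta> f))) \<in> TmRel ?P"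
      unfolding exp_pres_def using f by auto
    from tm_class_eqI[OF tm_eq.rel[OF this typed[OF f'] tm_typed.comp[OF typed_prj(2)[OF X] typed_old[OF f]]]]
    show "exp_term \<Theta> (Prime f) = Comp (presented ?P) (on_arr (pure_to_exp \<Theta>) f)
        (Prj (presented ?P) [exp_type \<Theta> ParTy, on_obj (pure_to_exp \<Theta>) (Dom \<Theta> f)] (Suc 0))"
      unfolding Prj(2)[OF X] using f presented_Comp[OF typed_prj(2)[OF X] typed_old[OF f]]
      by (simp add: exp_term_def pure_to_exp_def)
  next
    fix X fs Ys assume X: "X \<in> Obj \<Theta>" and fs: "list_all2 (\<lambda>f Y. f \<in> hom \<Theta> X Y) fs Ys"
    have Ys: "Ys \<in> lists (Obj \<Theta>)"
      using list_all2_ballD[OF fs, of "\<lambda>_. True" "\<lambda>Y. Y \<in> Obj \<Theta>"] hom_obj by auto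
    let ?ts = "map (\<lambda>f. TmGen (Prime f)) fs" and ?Ys = "map (\<lambda>Y. TyGen (OldTy Y)) Ys"
    have ts: "list_all2 (\<lambda>t Y. tm_typed ?P t (TyPrd (par_times X)) Y) ?ts ?Ys"
      using fs typed by (auto simp: list_all2_conv_all_nth)
    have tup: "tm_typed ?P (TmTuple (TyPrd (par_times X)) ?ts) (TyPrd (par_times X)) (TyPrd ?Ys)"
      using wf_par[OF X] ts by (intro tm_typed.tuple) simp_all
    \<comment> \<open>The primed tuple has the old product type as target, the tuple of primed terms
      has the formal product. The type relation inherited from the pure part makes them
      equal.\<close>
    have "ty_eq ?P (TyGen (OldTy (Prd \<Theta> Ys))) (TyPrd ?Ys)"
    proof (rule ty_eq.rel)
      show "(TyGen (OldTy (Prd \<Theta> Ys)), TyPrd ?Ys) \<in> TyRel ?P"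
        using Ys by (auto simp: exp_pres_def mor_ty_rel_def)
    qed (use Ys wf(2) prd_closed in auto)
    then have tup': "tm_typed ?P (TmTuple (TyPrd (par_times X)) ?ts) (TyPrd (par_times X)) (TyGen (OldTy (Prd \<Theta> Ys)))"
      using tm_typed.conv[OF tup ty_eq.refl ty_eq.sym] wf_par[OF X] by simp
    have "fs \<in> lists (Arr \<Theta>) \<and> (\<forall>f \<in> set fs. Dom \<Theta> f = X)"
      using list_all2_ballD[OF fs, of "\<lambda>f. f \<in> Arr \<Theta> \<and> Dom \<Theta> f = X" "\<lambda>_. True"] by (auto simp: hom_iff)
    then have "(TmGen (Prime (tuple \<Theta> X fs)), TmTuple (TyPrd (par_times X)) ?ts) \<in> TmRel ?P"
      unfolding exp_pres_def using X by auto
    from tm_class_eqI[OF tm_eq.rel[OF this typed[OF tuple_hom[OF X fs]] tup']]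
    show "exp_term \<Theta> (Prime (tuple \<Theta> X fs)) =
        tuple (presented ?P) (Prd (presented ?P) [exp_type \<Theta> ParTy, on_obj (pure_to_exp \<Theta>) X])
          (map (\<lambda>f. exp_term \<Theta> (Prime f)) fs)"
      unfolding Prd[OF X] exp_term_def
      using presented_tuple[OF _ ts] wf_par[OF X] by (simp add: comp_def)
  qed
qed

section \<open>Adding a constant\<close>

lemma eq_theory_Pi: "eq_theory Pi_A" "eq_theory Pi_a"
  by (simp_all add: Pi_A_def Pi_a_def eq_theory_presented)

lemma
  assumes T: "eq_theory T" and X: "X \<in> Obj T"
  shows from_Pi_A_morphism: "theory_morphism Pi_A T (from_Pi_A T X)"
    and from_Pi_A_gen: "on_obj (from_Pi_A T X) (ty_class Pi_A_pres (TyGen ())) = X"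
proof -
  interpret eq_theory T by fact
  interpret presentation_model T Pi_A_pres "\<lambda>_. X" "\<lambda>_. undefined"
    using X by unfold_locales (auto simp: Pi_A_pres_def)
  show "theory_morphism Pi_A T (from_Pi_A T X)"
    using theory_morphism_induced by (simp add: Pi_A_def from_Pi_A_def)
  show "on_obj (from_Pi_A T X) (ty_class Pi_A_pres (TyGen ())) = X"
    using induced_obj[of "TyGen ()"] by (simp add: from_Pi_A_def) (simp add: Pi_A_pres_def)
qed

lemma Pi_a_gen_Obj: "ty_class Pi_a_pres (TyGen ()) \<in> Obj Pi_a"
  by (auto simp: Pi_a_def presented_Obj Pi_a_pres_def intro!: exI[of _ "TyGen ()"])

lemma a_generator_hom: "a_generator \<in> hom Pi_a (Prd Pi_a []) (ty_class Pi_a_pres (TyGen ()))"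
proof -
  have "tm_typed Pi_a_pres (TmGen ()) (TyPrd []) (TyGen ())"
    using tm_typed.gen[of "()" Pi_a_pres] by (simp add: Pi_a_pres_def)
  then show ?thesis
    using presented_homI presented_Prd[of "[]" Pi_a_pres] by (fastforce simp: Pi_a_def a_generator_def)
qed

lemma i_A_morphism: "theory_morphism Pi_A Pi_a i_A"
  unfolding i_A_def using eq_theory_Pi(2) Pi_a_gen_Obj by (rule from_Pi_A_morphism)

lemma i_A_gen: "on_obj i_A (ty_class Pi_A_pres (TyGen ())) = ty_class Pi_a_pres (TyGen ())"
  unfolding i_A_def using eq_theory_Pi(2) Pi_a_gen_Obj by (rule from_Pi_A_gen)

lemma Pi_A_gen_Obj: "ty_class Pi_A_pres (TyGen ()) \<in> Obj Pi_A"
  by (auto simp: Pi_A_def presented_Obj Pi_A_pres_def intro!: exI[of _ "TyGen ()"])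

lemma Pi_A_morphism_eqI:
  assumes "theory_morphism Pi_A T F" "theory_morphism Pi_A T G"
    and "on_obj F (ty_class Pi_A_pres (TyGen ())) = on_obj G (ty_class Pi_A_pres (TyGen ()))"
  shows "F = G"
proof (rule theory_morphism_presented_eqI)
  show "theory_morphism (presented Pi_A_pres) T F" "theory_morphism (presented Pi_A_pres) T G"
    using assms(1,2) by (simp_all add: Pi_A_def)
qed (use assms(3) in simp, simp add: Pi_A_pres_def)

section \<open>The functor that adjoins a constant\<close>

lemma add_const_span: "coslice_object Pi_A Q \<Longrightarrow> theory_span Pi_A (fst Q) Pi_a (snd Q) i_A"
  by (simp add: theory_span_def coslice_object_def i_A_morphism)

lemma add_const_morphisms:
  assumes "coslice_object Pi_A Q"
  shows "theory_morphism (fst Q) (fst (add_const_obj Q)) (add_const_in Q)"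
    and "theory_morphism Pi_a (fst (add_const_obj Q)) (snd (add_const_obj Q))"
proof -
  interpret theory_span Pi_A "fst Q" Pi_a "snd Q" i_A
    using assms by (rule add_const_span)
  show "theory_morphism (fst Q) (fst (add_const_obj Q)) (add_const_in Q)"
    "theory_morphism Pi_a (fst (add_const_obj Q)) (snd (add_const_obj Q))"
    using in1_morphism in2_morphism by (simp_all add: add_const_obj_def add_const_in_def add_const_pres_def)
qed

lemma add_const_commutes:
  assumes "coslice_object Pi_A Q"
  shows "X \<in> Obj Pi_A \<Longrightarrow>
      on_obj (add_const_in Q) (on_obj (snd Q) X) = on_obj (snd (add_const_obj Q)) (on_obj i_A X)"
    and "f \<in> Arr Pi_A \<Longrightarrow>
      on_arr (add_const_in Q) (on_arr (snd Q) f) = on_arr (snd (add_const_obj Q)) (on_arr i_A f)"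
proof -
  interpret theory_span Pi_A "fst Q" Pi_a "snd Q" i_A
    using assms by (rule add_const_span)
  show "X \<in> Obj Pi_A \<Longrightarrow>
      on_obj (add_const_in Q) (on_obj (snd Q) X) = on_obj (snd (add_const_obj Q)) (on_obj i_A X)"
    "f \<in> Arr Pi_A \<Longrightarrow>
      on_arr (add_const_in Q) (on_arr (snd Q) f) = on_arr (snd (add_const_obj Q)) (on_arr i_A f)"
    using commutes_obj commutes_arr by (simp_all add: add_const_obj_def add_const_in_def)
qed

lemma coslice_object_add_const: "coslice_object Pi_A Q \<Longrightarrow> coslice_object Pi_a (add_const_obj Q)"
  using add_const_morphisms(2) by (simp add: coslice_object_def)

lemma add_const_gens:
  "X \<in> Obj (fst Q) \<Longrightarrow> on_obj (add_const_in Q) X = ty_class (add_const_pres Q) (TyGen (Inl X))"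
  "f \<in> Arr (fst Q) \<Longrightarrow> on_arr (add_const_in Q) f = tm_class (add_const_pres Q) (TmGen (Inl f))"
  "C \<in> Obj Pi_a \<Longrightarrow> on_obj (snd (add_const_obj Q)) C = ty_class (add_const_pres Q) (TyGen (Inr C))"
  "c \<in> Arr Pi_a \<Longrightarrow> on_arr (snd (add_const_obj Q)) c = tm_class (add_const_pres Q) (TmGen (Inr c))"
  by (simp_all add: add_const_in_def add_const_obj_def add_const_pres_def pushout_in1_def pushout_in2_def Let_def)

text \<open>Uniqueness for the pushout: its generators are exactly the images of types and terms
  under the two coprojections.\<close>

lemma add_const_eqI:
  assumes Q: "coslice_object Pi_A Q"
    and F: "theory_morphism (fst (add_const_obj Q)) T F" and G: "theory_morphism (fst (add_const_obj Q)) T G"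
    and in1: "\<And>X. X \<in> Obj (fst Q) \<Longrightarrow> on_obj F (on_obj (add_const_in Q) X) = on_obj G (on_obj (add_const_in Q) X)"
      "\<And>f. f \<in> Arr (fst Q) \<Longrightarrow> on_arr F (on_arr (add_const_in Q) f) = on_arr G (on_arr (add_const_in Q) f)"
    and in2: "\<And>X. X \<in> Obj Pi_a \<Longrightarrow> on_obj F (on_obj (snd (add_const_obj Q)) X) = on_obj G (on_obj (snd (add_const_obj Q)) X)"
      "\<And>f. f \<in> Arr Pi_a \<Longrightarrow> on_arr F (on_arr (snd (add_const_obj Q)) f) = on_arr G (on_arr (snd (add_const_obj Q)) f)"
  shows "F = G"
proof (rule theory_morphism_presented_eqI[of "add_const_pres Q" T])
  show "theory_morphism (presented (add_const_pres Q)) T F" "theory_morphism (presented (add_const_pres Q)) T G"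
    using F G by (simp_all add: add_const_obj_def)
  fix g assume "g \<in> TyGens (add_const_pres Q)"
  then consider X where "g = Inl X" "X \<in> Obj (fst Q)" | X where "g = Inr X" "X \<in> Obj Pi_a"
    by (auto simp: add_const_pres_def pushout_pres_def)
  then show "on_obj F (ty_class (add_const_pres Q) (TyGen g)) = on_obj G (ty_class (add_const_pres Q) (TyGen g))"
    by cases (use in1(1) in2(1) in \<open>simp_all add: add_const_gens\<close>)
next
  fix t assume "t \<in> TmGens (add_const_pres Q)"
  then consider f where "t = Inl f" "f \<in> Arr (fst Q)" | f where "t = Inr f" "f \<in> Arr Pi_a"
    by (auto simp: add_const_pres_def pushout_pres_def)
  then show "on_arr F (tm_class (add_const_pres Q) (TmGen t)) = on_arr G (tm_class (add_const_pres Q) (TmGen t))"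
    by cases (use in1(2) in2(2) in \<open>simp_all add: add_const_gens\<close>)
qed

text \<open>The triangle under \<open>Pi_A\<close> satisfied by \<open>F\<close> makes the evident
  cocone on the target pushout compatible with the glueing along \<open>i_A\<close>, so the
  interpretation defining \<open>add_const_mor\<close> respects the relations. The equations record
  compatibility with both coprojections and are all that is used of it afterwards.\<close>

lemma
  assumes F: "coslice_morphism Pi_A Q Q' F"
  shows add_const_mor_morphism:
      "theory_morphism (fst (add_const_obj Q)) (fst (add_const_obj Q')) (add_const_mor Q Q' F)"
    and add_const_mor_in:
      "X \<in> Obj (fst Q) \<Longrightarrow>
        on_obj (add_const_mor Q Q' F) (on_obj (add_const_in Q) X) = on_obj (add_const_in Q') (on_obj F X)"
      "f \<in> Arr (fst Q) \<Longrightarrow>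
        on_arr (add_const_mor Q Q' F) (on_arr (add_const_in Q) f) = on_arr (add_const_in Q') (on_arr F f)"
    and add_const_mor_const:
      "C \<in> Obj Pi_a \<Longrightarrow>
        on_obj (add_const_mor Q Q' F) (on_obj (snd (add_const_obj Q)) C) = on_obj (snd (add_const_obj Q')) C"
      "c \<in> Arr Pi_a \<Longrightarrow>
        on_arr (add_const_mor Q Q' F) (on_arr (snd (add_const_obj Q)) c) = on_arr (snd (add_const_obj Q')) c"
proof -
  have Q: "coslice_object Pi_A Q" "coslice_object Pi_A Q'" and m: "theory_morphism (fst Q) (fst Q') F"
    and tri: "mor_comp Pi_A F (snd Q) = snd Q'"
    using F by (auto simp: coslice_morphism_def)
  interpret theory_span Pi_A "fst Q" Pi_a "snd Q" i_A
    using Q(1) by (rule add_const_span)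
  have P: "P = add_const_pres Q"
    by (simp add: add_const_pres_def)
  let ?a = "case_sum (\<lambda>X. on_obj (add_const_in Q') (on_obj F X)) (on_obj (snd (add_const_obj Q')))"
  let ?b = "case_sum (\<lambda>f. on_arr (add_const_in Q') (on_arr F f)) (on_arr (snd (add_const_obj Q')))"
  let ?u = "mor_comp (fst Q) (add_const_in Q') F"
  have u: "theory_morphism (fst Q) (fst (add_const_obj Q')) ?u"
    using m add_const_morphisms(1)[OF Q(2)] by (rule theory_morphism_comp)
  have "on_obj F (on_obj (snd Q) X) = on_obj (snd Q') X" if "X \<in> Obj Pi_A" for X
    unfolding tri[symmetric] using that by simp
  then have comm1: "on_obj ?u (on_obj (snd Q) X) = on_obj (snd (add_const_obj Q')) (on_obj i_A X)"
    if "X \<in> Obj Pi_A" for X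
    using that add_const_commutes(1)[OF Q(2) that] theory_morphismD(5)[of Pi_A "fst Q" "snd Q"] Q(1)
    by (simp add: coslice_object_def)
  have "on_arr F (on_arr (snd Q) f) = on_arr (snd Q') f" if "f \<in> Arr Pi_A" for f
    unfolding tri[symmetric] using that by simp
  then have comm2: "on_arr ?u (on_arr (snd Q) f) = on_arr (snd (add_const_obj Q')) (on_arr i_A f)"
    if "f \<in> Arr Pi_A" for f
    using that add_const_commutes(2)[OF Q(2) that] theory_morphismD(6)[of Pi_A "fst Q" "snd Q"] Q(1)
    by (simp add: coslice_object_def hom_iff)
  interpret presentation_model "fst (add_const_obj Q')" "add_const_pres Q" ?a ?b
    using pushout_model[OF u add_const_morphisms(2)[OF Q(2)], of ?a ?b] comm1 comm2 by (simp add: P)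
  have ty: "on_obj (add_const_mor Q Q' F) (ty_class (add_const_pres Q) (TyGen g)) = ?a g"
    if "g \<in> TyGens (add_const_pres Q)" for g
    using induced_obj[of "TyGen g"] that by (simp add: add_const_mor_def)
  have gens: "X \<in> Obj (fst Q) \<Longrightarrow> Inl X \<in> TyGens (add_const_pres Q)"
    "C \<in> Obj Pi_a \<Longrightarrow> Inr C \<in> TyGens (add_const_pres Q)" for X C
    by (auto simp: add_const_pres_def pushout_pres_def)
  have tm: "on_arr (add_const_mor Q Q' F) (tm_class (add_const_pres Q) (TmGen t)) = ?b t"
    if "tm_typed (add_const_pres Q) (TmGen t) X Y" for t X Y
    using induced_arr[OF that] by (simp add: add_const_mor_def)
  show "theory_morphism (fst (add_const_obj Q)) (fst (add_const_obj Q')) (add_const_mor Q Q' F)"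
    using theory_morphism_induced by (simp add: add_const_mor_def add_const_obj_def)
  show "on_obj (add_const_mor Q Q' F) (on_obj (add_const_in Q) X) = on_obj (add_const_in Q') (on_obj F X)"
    if "X \<in> Obj (fst Q)"
    using that ty[OF gens(1)[OF that]] by (simp add: add_const_gens)
  show "on_arr (add_const_mor Q Q' F) (on_arr (add_const_in Q) f) = on_arr (add_const_in Q') (on_arr F f)"
    if "f \<in> Arr (fst Q)"
    using that tm[OF typed_gen(1)[OF that, unfolded P]] by (simp add: add_const_gens)
  show "on_obj (add_const_mor Q Q' F) (on_obj (snd (add_const_obj Q)) C) = on_obj (snd (add_const_obj Q')) C"
    if "C \<in> Obj Pi_a"
    using that ty[OF gens(2)[OF that]] by (simp add: add_const_gens)
  show "on_arr (add_const_mor Q Q' F) (on_arr (snd (add_const_obj Q)) c) = on_arr (snd (add_const_obj Q')) c"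
    if "c \<in> Arr Pi_a"
    using that tm[OF typed_gen(2)[OF that, unfolded P]] by (simp add: add_const_gens)
qed

lemma coslice_morphism_add_const:
  assumes F: "coslice_morphism Pi_A Q Q' F"
  shows "coslice_morphism Pi_a (add_const_obj Q) (add_const_obj Q') (add_const_mor Q Q' F)"
proof -
  have Q: "coslice_object Pi_A Q" "coslice_object Pi_A Q'"
    using F by (auto simp: coslice_morphism_def)
  have "mor_comp Pi_a (add_const_mor Q Q' F) (snd (add_const_obj Q)) = snd (add_const_obj Q')"
    by (rule theory_morphism_eqI[OF theory_morphism_comp[OF add_const_morphisms(2)[OF Q(1)]
          add_const_mor_morphism[OF F]] add_const_morphisms(2)[OF Q(2)]])
      (simp_all add: add_const_mor_const[OF F])
  then show ?thesis
    using coslice_object_add_const[OF Q(1)] coslice_object_add_const[OF Q(2)] add_const_mor_morphism[OF F]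
    by (simp add: coslice_morphism_def)
qed

lemma theory_morphism_mem:
  assumes "theory_morphism S T F"
  shows "X \<in> Obj S \<Longrightarrow> on_obj F X \<in> Obj T" "f \<in> Arr S \<Longrightarrow> on_arr F f \<in> Arr T"
  using theory_morphismD(5,6)[OF assms] by (auto simp: hom_iff)

text \<open>The two sides are compared after each coprojection: the first reduces to the identity of
  the base theory, the second to the structure map from \<open>Pi_a\<close>.\<close>

lemma add_const_mor_id:
  assumes Q: "coslice_object Pi_A Q" and F: "coslice_morphism Pi_A Q Q (mor_id (fst Q))"
  shows "add_const_mor Q Q (mor_id (fst Q)) = mor_id (fst (add_const_obj Q))"
proof (rule add_const_eqI[OF Q])
  show "theory_morphism (fst (add_const_obj Q)) (fst (add_const_obj Q)) (add_const_mor Q Q (mor_id (fst Q)))"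
    using F by (rule add_const_mor_morphism)
  show "theory_morphism (fst (add_const_obj Q)) (fst (add_const_obj Q)) (mor_id (fst (add_const_obj Q)))"
    using theory_morphismD(2)[OF add_const_morphisms(1)[OF Q]] by (rule theory_morphism_id)
qed (simp_all add: add_const_mor_in[OF F] add_const_mor_const[OF F] theory_morphism_mem[OF add_const_morphisms(1)[OF Q]]
    theory_morphism_mem[OF add_const_morphisms(2)[OF Q]])

text \<open>After the first coprojection the induced morphisms act as \<open>F\<close>,
  \<open>G\<close> and their composite; after the second they merely exchange the structure maps
  from \<open>Pi_a\<close>.\<close>

lemma add_const_mor_comp:
  assumes F: "coslice_morphism Pi_A Q Q' F" and G: "coslice_morphism Pi_A Q' Q'' G"
    and GF: "coslice_morphism Pi_A Q Q'' (mor_comp (fst Q) G F)"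
  shows "add_const_mor Q Q'' (mor_comp (fst Q) G F) =
    mor_comp (fst (add_const_obj Q)) (add_const_mor Q' Q'' G) (add_const_mor Q Q' F)"
proof -
  have Q: "coslice_object Pi_A Q" and m: "theory_morphism (fst Q) (fst Q') F"
    using F by (auto simp: coslice_morphism_def)
  show ?thesis
    by (rule add_const_eqI[OF Q add_const_mor_morphism[OF GF]
          theory_morphism_comp[OF add_const_mor_morphism[OF F] add_const_mor_morphism[OF G]]])
      (simp_all add: theory_morphism_mem[OF add_const_morphisms(1)[OF Q]] theory_morphism_mem[OF m]
        theory_morphism_mem[OF add_const_morphisms(2)[OF Q]] add_const_mor_in[OF F] add_const_mor_in[OF G]
        add_const_mor_in[OF GF] add_const_mor_const[OF F] add_const_mor_const[OF G] add_const_mor_const[OF GF])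
qed

section \<open>The functor to parameterized theories\<close>

lemma exp_gen_mem:
  assumes "decorated_theory \<Theta>"
  shows "X \<in> Obj \<Theta> \<Longrightarrow> exp_type \<Theta> (OldTy X) \<in> Obj (presented (exp_pres \<Theta>))"
    and "exp_type \<Theta> ParTy \<in> Obj (presented (exp_pres \<Theta>))"
    and "f \<in> PureArr \<Theta> \<Longrightarrow> exp_term \<Theta> (OldTm f) \<in> Arr (presented (exp_pres \<Theta>))"
    and "f \<in> Arr \<Theta> \<Longrightarrow> exp_term \<Theta> (Prime f) \<in> Arr (presented (exp_pres \<Theta>))"
proof -
  interpret exp_algebra \<Theta> "presented (exp_pres \<Theta>)" "pure_to_exp \<Theta>" "exp_type \<Theta> ParTy" "\<lambda>f. exp_term \<Theta> (Prime f)"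
    using assms by (rule exp_algebra_presented)
  show "X \<in> Obj \<Theta> \<Longrightarrow> exp_type \<Theta> (OldTy X) \<in> Obj (presented (exp_pres \<Theta>))"
    using K_obj by (simp add: pure_to_exp_def)
  show "exp_type \<Theta> ParTy \<in> Obj (presented (exp_pres \<Theta>))"
    by (rule A)
  show "f \<in> PureArr \<Theta> \<Longrightarrow> exp_term \<Theta> (OldTm f) \<in> Arr (presented (exp_pres \<Theta>))"
    using K_hom by (simp add: pure_to_exp_def hom_iff)
  show "f \<in> Arr \<Theta> \<Longrightarrow> exp_term \<Theta> (Prime f) \<in> Arr (presented (exp_pres \<Theta>))"
    using p_hom[of f "Dom \<Theta> f" "Cod \<Theta> f"] by (simp add: hom_iff)
qed

lemma F_exp_coslice_object:
  assumes "decorated_theory \<Theta>"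
  shows "coslice_object Pi_A (F_exp_obj \<Theta>)"
  using from_Pi_A_morphism[OF eq_theory_presented exp_gen_mem(2)[OF assms]]
  by (simp add: coslice_object_def F_exp_obj_def)

text \<open>The generic algebra of \<open>\<Theta>'\<close>, pulled back along
  \<open>\<phi>\<close>, is an algebra over \<open>\<Theta>\<close>, and \<open>F_exp_mor\<close> is
  the morphism that it induces.\<close>

lemma
  assumes \<phi>: "dec_morphism \<Theta> \<Theta>' \<phi>"
  shows F_exp_mor_morphism:
      "theory_morphism (presented (exp_pres \<Theta>)) (presented (exp_pres \<Theta>')) (F_exp_mor \<Theta> \<Theta>' \<phi>)"
    and F_exp_mor_type: "g \<in> TyGens (exp_pres \<Theta>) \<Longrightarrow>
      on_obj (F_exp_mor \<Theta> \<Theta>' \<phi>) (exp_type \<Theta> g) = exp_type \<Theta>' (map_exp_tygen (on_obj \<phi>) g)"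
    and F_exp_mor_term: "t \<in> TmGens (exp_pres \<Theta>) \<Longrightarrow>
      on_arr (F_exp_mor \<Theta> \<Theta>' \<phi>) (exp_term \<Theta> t) = exp_term \<Theta>' (map_exp_tmgen (on_arr \<phi>) t)"
proof -
  have dec: "decorated_theory \<Theta>" "decorated_theory \<Theta>'" and m: "theory_morphism \<Theta> \<Theta>' \<phi>"
    and pure: "on_arr \<phi> ` PureArr \<Theta> \<subseteq> PureArr \<Theta>'"
    using \<phi> by (auto simp: dec_morphism_def)
  interpret \<Theta>: decorated_theory \<Theta> by fact
  interpret \<Theta>': exp_algebra \<Theta>' "presented (exp_pres \<Theta>')" "pure_to_exp \<Theta>'" "exp_type \<Theta>' ParTy"
    "\<lambda>f. exp_term \<Theta>' (Prime f)"
    using dec(2) by (rule exp_algebra_presented)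
  have obj: "on_obj (pure_to_exp \<Theta>') (on_obj \<phi> X) = exp_type \<Theta>' (OldTy (on_obj \<phi> X))" if "X \<in> Obj \<Theta>" for X
    using theory_morphismD(5)[OF m that] by (simp add: pure_to_exp_def)
  have arr: "on_arr (pure_to_exp \<Theta>') (on_arr \<phi> f) = exp_term \<Theta>' (OldTm (on_arr \<phi> f))" if "f \<in> PureArr \<Theta>" for f
    using that pure by (auto simp: pure_to_exp_def)
  interpret presentation_model "presented (exp_pres \<Theta>')" "exp_pres \<Theta>"
    "\<lambda>g. exp_type \<Theta>' (map_exp_tygen (on_obj \<phi>) g)" "\<lambda>t. exp_term \<Theta>' (map_exp_tmgen (on_arr \<phi>) t)"
    by (rule exp_algebra.exp_model[OF \<Theta>'.exp_algebra_dec_comp[OF \<phi>]]) (simp_all add: obj arr)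
  show "theory_morphism (presented (exp_pres \<Theta>)) (presented (exp_pres \<Theta>')) (F_exp_mor \<Theta> \<Theta>' \<phi>)"
    unfolding F_exp_mor_def by (rule theory_morphism_induced)
  show "on_obj (F_exp_mor \<Theta> \<Theta>' \<phi>) (exp_type \<Theta> g) = exp_type \<Theta>' (map_exp_tygen (on_obj \<phi>) g)"
    if "g \<in> TyGens (exp_pres \<Theta>)"
    using induced_obj[of "TyGen g"] that by (simp add: F_exp_mor_def exp_type_def)
  show "on_arr (F_exp_mor \<Theta> \<Theta>' \<phi>) (exp_term \<Theta> t) = exp_term \<Theta>' (map_exp_tmgen (on_arr \<phi>) t)"
    if "t \<in> TmGens (exp_pres \<Theta>)"
  proof -
    \<comment> \<open>Membership in \<open>Arr\<close> only yields some typed \<open>u\<close> in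
      the class. Typing is invariant under \<open>tm_eq\<close>, so the generator
      \<open>TmGen t\<close> itself is typed, as evaluation on it requires.\<close>
    have "exp_term \<Theta> t \<in> Arr (presented (exp_pres \<Theta>))"
      using that exp_gen_mem(3,4)[OF dec(1)] by (auto simp: exp_pres_def)
    then obtain u X Y where u: "tm_typed (exp_pres \<Theta>) u X Y" "tm_class (exp_pres \<Theta>) (TmGen t) = tm_class (exp_pres \<Theta>) u"
      unfolding presented_Arr exp_term_def by blast
    show ?thesis
      using induced_arr[of "TmGen t" X Y] tm_eq_typed_iff[of "exp_pres \<Theta>" u "TmGen t" X Y] u
        tm_class_eq_iff[OF u(1), of "TmGen t"]
      by (simp add: F_exp_mor_def exp_term_def)
  qed
qed

text \<open>\<open>map_exp_tygen\<close> fixes \<open>ParTy\<close>, and a morphism from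
  \<open>Pi_A\<close> is determined by its value on the generating type.\<close>

lemma F_exp_coslice_morphism:
  assumes \<phi>: "dec_morphism \<Theta> \<Theta>' \<phi>"
  shows "coslice_morphism Pi_A (F_exp_obj \<Theta>) (F_exp_obj \<Theta>') (F_exp_mor \<Theta> \<Theta>' \<phi>)"
proof -
  have dec: "decorated_theory \<Theta>" "decorated_theory \<Theta>'"
    using \<phi> by (auto simp: dec_morphism_def)
  note obj = F_exp_coslice_object[OF dec(1)] F_exp_coslice_object[OF dec(2)]
  have mor: "theory_morphism (fst (F_exp_obj \<Theta>)) (fst (F_exp_obj \<Theta>')) (F_exp_mor \<Theta> \<Theta>' \<phi>)"
    using F_exp_mor_morphism[OF \<phi>] by (simp add: F_exp_obj_def)
  have "ParTy \<in> TyGens (exp_pres \<Theta>)"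
    by (simp add: exp_pres_def)
  then have "mor_comp Pi_A (F_exp_mor \<Theta> \<Theta>' \<phi>) (snd (F_exp_obj \<Theta>)) = snd (F_exp_obj \<Theta>')"
    using from_Pi_A_gen[OF eq_theory_presented exp_gen_mem(2)[OF dec(1)]]
      from_Pi_A_gen[OF eq_theory_presented exp_gen_mem(2)[OF dec(2)]] F_exp_mor_type[OF \<phi>, of ParTy]
    by (intro Pi_A_morphism_eqI[of "fst (F_exp_obj \<Theta>')"] theory_morphism_comp[OF _ mor]
        obj[unfolded coslice_object_def])
      (simp add: Pi_A_gen_Obj F_exp_obj_def)
  then show ?thesis
    using obj mor by (simp add: coslice_morphism_def)
qed

lemma F_exp_eqI:
  assumes "theory_morphism (presented (exp_pres \<Theta>)) T F" "theory_morphism (presented (exp_pres \<Theta>)) T G"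
    and "\<And>g. g \<in> TyGens (exp_pres \<Theta>) \<Longrightarrow> on_obj F (exp_type \<Theta> g) = on_obj G (exp_type \<Theta> g)"
    and "\<And>t. t \<in> TmGens (exp_pres \<Theta>) \<Longrightarrow> on_arr F (exp_term \<Theta> t) = on_arr G (exp_term \<Theta> t)"
  shows "F = G"
  using assms(1,2) by (rule theory_morphism_presented_eqI) (simp_all add: assms(3,4) flip: exp_type_def exp_term_def)

lemma exp_gens_mem:
  assumes "decorated_theory \<Theta>"
  shows "g \<in> TyGens (exp_pres \<Theta>) \<Longrightarrow> exp_type \<Theta> g \<in> Obj (presented (exp_pres \<Theta>))"
    and "t \<in> TmGens (exp_pres \<Theta>) \<Longrightarrow> exp_term \<Theta> t \<in> Arr (presented (exp_pres \<Theta>))"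
  using exp_gen_mem[OF assms] by (auto simp: exp_pres_def)

section \<open>Functoriality of the parameterized theory\<close>

lemma dec_morphism_id: "decorated_theory \<Theta> \<Longrightarrow> dec_morphism \<Theta> \<Theta> (mor_id \<Theta>)"
  using theory_morphism_id[of \<Theta>] decorated_theory.pure_subset[of \<Theta>]
  by (auto simp: dec_morphism_def decorated_theory_def mor_id_def)

lemma dec_morphism_comp:
  "dec_morphism \<Theta> \<Theta>' \<phi> \<Longrightarrow> dec_morphism \<Theta>' \<Theta>'' \<psi> \<Longrightarrow> dec_morphism \<Theta> \<Theta>'' (mor_comp \<Theta> \<psi> \<phi>)"
  using theory_morphism_comp[of \<Theta> \<Theta>' \<phi> \<Theta>'' \<psi>] decorated_theory.pure_subset[of \<Theta>]
  by (auto simp: dec_morphism_def subset_iff image_subset_iff)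

lemma F_exp_mor_id:
  fixes \<Theta> :: "('o, 'm) dec_thy"
  assumes "decorated_theory \<Theta>"
  shows "F_exp_mor \<Theta> \<Theta> (mor_id \<Theta>) = mor_id (presented (exp_pres \<Theta>))"
proof -
  interpret decorated_theory \<Theta> by fact
  note id = dec_morphism_id[OF assms]
  have ty: "map_exp_tygen (on_obj (mor_id \<Theta>)) g = g" if "g \<in> TyGens (exp_pres \<Theta>)" for g
    using that by (auto simp: exp_pres_def)
  have tm: "map_exp_tmgen (on_arr (mor_id \<Theta>)) t = t" if "t \<in> TmGens (exp_pres \<Theta>)" for t
    using that pure_subset by (auto simp: exp_pres_def)
  show ?thesis
    by (rule F_exp_eqI[OF F_exp_mor_morphism[OF id] theory_morphism_id[OF eq_theory_presented]])
      (simp_all add: F_exp_mor_type[OF id] F_exp_mor_term[OF id] exp_gens_mem[OF assms] ty tm)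
qed

lemma map_exp_gens_mem:
  assumes "dec_morphism \<Theta> \<Theta>' \<phi>"
  shows "g \<in> TyGens (exp_pres \<Theta>) \<Longrightarrow> map_exp_tygen (on_obj \<phi>) g \<in> TyGens (exp_pres \<Theta>')"
    and "t \<in> TmGens (exp_pres \<Theta>) \<Longrightarrow> map_exp_tmgen (on_arr \<phi>) t \<in> TmGens (exp_pres \<Theta>')"
  using assms theory_morphism_mem[of \<Theta> \<Theta>' \<phi>] by (auto simp: exp_pres_def dec_morphism_def)

lemma F_exp_mor_comp:
  assumes \<phi>: "dec_morphism \<Theta> \<Theta>' \<phi>" and \<psi>: "dec_morphism \<Theta>' \<Theta>'' \<psi>"
  shows "F_exp_mor \<Theta> \<Theta>'' (mor_comp \<Theta> \<psi> \<phi>) =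
    mor_comp (presented (exp_pres \<Theta>)) (F_exp_mor \<Theta>' \<Theta>'' \<psi>) (F_exp_mor \<Theta> \<Theta>' \<phi>)"
proof -
  have dec: "decorated_theory \<Theta>"
    using \<phi> by (simp add: dec_morphism_def)
  interpret decorated_theory \<Theta> by fact
  note comp = dec_morphism_comp[OF \<phi> \<psi>]
  have ty: "map_exp_tygen (on_obj (mor_comp \<Theta> \<psi> \<phi>)) g = map_exp_tygen (on_obj \<psi>) (map_exp_tygen (on_obj \<phi>) g)"
    if "g \<in> TyGens (exp_pres \<Theta>)" for g
    using that by (auto simp: exp_pres_def)
  have tm: "map_exp_tmgen (on_arr (mor_comp \<Theta> \<psi> \<phi>)) t = map_exp_tmgen (on_arr \<psi>) (map_exp_tmgen (on_arr \<phi>) t)"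
    if "t \<in> TmGens (exp_pres \<Theta>)" for t
    using that pure_subset by (auto simp: exp_pres_def)
  show ?thesis
    by (rule F_exp_eqI[OF F_exp_mor_morphism[OF comp]
          theory_morphism_comp[OF F_exp_mor_morphism[OF \<phi>] F_exp_mor_morphism[OF \<psi>]]])
      (simp_all add: F_exp_mor_type[OF \<phi>] F_exp_mor_term[OF \<phi>] F_exp_mor_type[OF \<psi>] F_exp_mor_term[OF \<psi>]
        F_exp_mor_type[OF comp] F_exp_mor_term[OF comp] exp_gens_mem[OF dec] map_exp_gens_mem[OF \<phi>] ty tm)
qed

section \<open>The morphism from a decorated theory to its expansion with a constant\<close>

text \<open>These values are the only facts specific to the functor on which naturality rests: old
  types, primed terms and the constant are sent to their counterparts.\<close>

lemma F'_exp_mor_gens: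
  assumes \<phi>: "dec_morphism \<Theta> \<Theta>' \<phi>"
  shows "g \<in> TyGens (exp_pres \<Theta>) \<Longrightarrow>
      on_obj (F'_exp_mor \<Theta> \<Theta>' \<phi>) (expa_type \<Theta> g) = expa_type \<Theta>' (map_exp_tygen (on_obj \<phi>) g)"
    and "t \<in> TmGens (exp_pres \<Theta>) \<Longrightarrow>
      on_arr (F'_exp_mor \<Theta> \<Theta>' \<phi>) (expa_term \<Theta> t) = expa_term \<Theta>' (map_exp_tmgen (on_arr \<phi>) t)"
    and "on_arr (F'_exp_mor \<Theta> \<Theta>' \<phi>) (expa_const \<Theta>) = expa_const \<Theta>'"
proof -
  have dec: "decorated_theory \<Theta>"
    using \<phi> by (simp add: dec_morphism_def)
  have fst: "fst (F_exp_obj \<Theta>) = presented (exp_pres \<Theta>)"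
    by (simp add: F_exp_obj_def)
  note F = F_exp_coslice_morphism[OF \<phi>]
  note inn = add_const_mor_in[OF F, unfolded fst]
  show "on_obj (F'_exp_mor \<Theta> \<Theta>' \<phi>) (expa_type \<Theta> g) = expa_type \<Theta>' (map_exp_tygen (on_obj \<phi>) g)"
    if "g \<in> TyGens (exp_pres \<Theta>)"
    using inn(1)[OF exp_gens_mem(1)[OF dec that]] F_exp_mor_type[OF \<phi> that]
    by (simp add: F'_exp_mor_def expa_type_def)
  show "on_arr (F'_exp_mor \<Theta> \<Theta>' \<phi>) (expa_term \<Theta> t) = expa_term \<Theta>' (map_exp_tmgen (on_arr \<phi>) t)"
    if "t \<in> TmGens (exp_pres \<Theta>)"
    using inn(2)[OF exp_gens_mem(2)[OF dec that]] F_exp_mor_term[OF \<phi> that]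
    by (simp add: F'_exp_mor_def expa_term_def)
  show "on_arr (F'_exp_mor \<Theta> \<Theta>' \<phi>) (expa_const \<Theta>) = expa_const \<Theta>'"
    using add_const_mor_const(2)[OF F, of a_generator] a_generator_hom
    by (simp add: F'_exp_mor_def expa_const_def F'_exp_obj_def hom_iff)
qed

text \<open>The generic algebra pushed forward along the coprojection into the theory with a
  constant.\<close>

lemma exp_algebra_Theta_a:
  assumes "decorated_theory \<Theta>"
  shows "exp_algebra \<Theta> (Theta_a \<Theta>) (pure_to_Theta_a \<Theta>) (expa_type \<Theta> ParTy) (\<lambda>f. expa_term \<Theta> (Prime f))"
proof -
  interpret exp_algebra \<Theta> "presented (exp_pres \<Theta>)" "pure_to_exp \<Theta>" "exp_type \<Theta> ParTy" "\<lambda>f. exp_term \<Theta> (Prime f)"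
    using assms by (rule exp_algebra_presented)
  have "theory_morphism (presented (exp_pres \<Theta>)) (Theta_a \<Theta>) (add_const_in (F_exp_obj \<Theta>))"
    using add_const_morphisms(1)[OF F_exp_coslice_object[OF assms]]
    by (simp add: Theta_a_def U'_obj_def F'_exp_obj_def F_exp_obj_def)
  moreover have "mor_comp (pure_part \<Theta>) (add_const_in (F_exp_obj \<Theta>)) (pure_to_exp \<Theta>) = pure_to_Theta_a \<Theta>"
    by (simp add: mor_comp_def compose_def pure_to_exp_def pure_to_Theta_a_def expa_type_def expa_term_def
        cong: restrict_cong)
  ultimately show ?thesis
    using exp_algebra_comp by (fastforce simp: expa_type_def expa_term_def)
qed

lemma expa_const_hom:
  assumes "decorated_theory \<Theta>"
  shows "expa_const \<Theta> \<in> hom (Theta_a \<Theta>) (Prd (Theta_a \<Theta>) []) (expa_type \<Theta> ParTy)"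
proof -
  note obj = F_exp_coslice_object[OF assms]
  note mor = add_const_morphisms(2)[OF obj]
  have "on_obj (snd (add_const_obj (F_exp_obj \<Theta>))) (Prd Pi_a []) = Prd (fst (add_const_obj (F_exp_obj \<Theta>))) []"
    using theory_morphismD(9)[OF mor, of "[]"] by simp
  \<comment> \<open>The constant arrives through the second coprojection, whereas
    \<open>expa_type\<close> is defined through the first. The commuting pushout square identifies
    the two images of the generating type, so the target of the constant is the parameter
    type.\<close>
  moreover have "on_obj (snd (add_const_obj (F_exp_obj \<Theta>))) (ty_class Pi_a_pres (TyGen ())) = expa_type \<Theta> ParTy"
    using add_const_commutes(1)[OF obj Pi_A_gen_Obj] from_Pi_A_gen[OF eq_theory_presented exp_gen_mem(2)[OF assms]]
    by (simp add: i_A_gen expa_type_def F_exp_obj_def)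
  ultimately show ?thesis
    using theory_morphism_hom[OF mor a_generator_hom]
    by (simp add: expa_const_def F'_exp_obj_def Theta_a_def U'_obj_def)
qed

text \<open>Brings \<open>J\<close> into the form for which \<open>fill_morphism\<close> and
  \<open>fill_pure\<close> are stated.\<close>

lemma J_arr:
  assumes "decorated_theory \<Theta>" "f \<in> Arr \<Theta>"
  defines "X \<equiv> expa_type \<Theta> (OldTy (Dom \<Theta> f))"
  shows "on_arr (J \<Theta>) f = Comp (Theta_a \<Theta>) (expa_term \<Theta> (Prime f)) (tuple (Theta_a \<Theta>) X
    [Comp (Theta_a \<Theta>) (expa_const \<Theta>) (tuple (Theta_a \<Theta>) X []), Ident (Theta_a \<Theta>) X])"
proof -
  interpret exp_algebra \<Theta> "Theta_a \<Theta>" "pure_to_Theta_a \<Theta>" "expa_type \<Theta> ParTy" "\<lambda>f. expa_term \<Theta> (Prime f)"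
    using assms(1) by (rule exp_algebra_Theta_a)
  have "X \<in> Obj (Theta_a \<Theta>)"
    using K_obj[OF dom_closed[OF assms(2)]] dom_closed[OF assms(2)] by (simp add: X_def pure_to_Theta_a_def)
  from T.cross_unit_iso[OF expa_const_hom[OF assms(1)] this] show ?thesis
    using assms(2) by (simp add: J_def Let_def X_def)
qed

lemma
  assumes "decorated_theory \<Theta>"
  shows J_morphism: "theory_morphism \<Theta> (Theta_a \<Theta>) (J \<Theta>)"
    and J_pure: "f \<in> PureArr \<Theta> \<Longrightarrow> on_arr (J \<Theta>) f = expa_term \<Theta> (OldTm f)"
proof -
  interpret exp_algebra \<Theta> "Theta_a \<Theta>" "pure_to_Theta_a \<Theta>" "expa_type \<Theta> ParTy" "\<lambda>f. expa_term \<Theta> (Prime f)"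
    using assms by (rule exp_algebra_Theta_a)
  \<comment> \<open>The left-hand side is literally the morphism built from an algebra and a
    constant, here for the algebra in \<open>Theta_a\<close> and the adjoined constant. Both
    components are extensional, so the formula need only be compared on actual terms.\<close>
  have J: "\<lparr>on_obj = on_obj (pure_to_Theta_a \<Theta>), on_arr = (\<lambda>f \<in> Arr \<Theta>. Comp (Theta_a \<Theta>) (expa_term \<Theta> (Prime f))
      (tuple (Theta_a \<Theta>) (on_obj (pure_to_Theta_a \<Theta>) (Dom \<Theta> f))
        [Comp (Theta_a \<Theta>) (expa_const \<Theta>) (tuple (Theta_a \<Theta>) (on_obj (pure_to_Theta_a \<Theta>) (Dom \<Theta> f)) []),
         Ident (Theta_a \<Theta>) (on_obj (pure_to_Theta_a \<Theta>) (Dom \<Theta> f))]))\<rparr> = J \<Theta>" (is "?F = _")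
  proof (rule thy_mor.equality)
    show "on_obj ?F = on_obj (J \<Theta>)"
      by (simp add: pure_to_Theta_a_def J_def)
    show "on_arr ?F = on_arr (J \<Theta>)"
    proof (rule extensionalityI[of _ "Arr \<Theta>"])
      fix f assume "f \<in> Arr \<Theta>"
      then show "on_arr ?F f = on_arr (J \<Theta>) f"
        using J_arr[OF assms] dom_closed by (simp add: pure_to_Theta_a_def)
    qed (simp_all add: J_def)
  qed simp
  show "theory_morphism \<Theta> (Theta_a \<Theta>) (J \<Theta>)"
    using fill_morphism[OF expa_const_hom[OF assms]] unfolding J .
  show "on_arr (J \<Theta>) f = expa_term \<Theta> (OldTm f)" if "f \<in> PureArr \<Theta>"
    using fill_pure[OF expa_const_hom[OF assms] that] that unfolding J by (simp add: pure_to_Theta_a_def)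
qed

text \<open>\<open>J f\<close> is built from \<open>f'\<close> and the constant by composition,
  tuples and identities. The functor image of \<open>\<phi>\<close> preserves these operations,
  fixes the constant and replaces \<open>f'\<close> by the primed image of \<open>f\<close>, so it
  carries \<open>J f\<close> to \<open>J\<close> of the image.\<close>

lemma J_natural:
  fixes \<Theta> :: "('o, 'm) dec_thy" and \<Theta>' :: "('p, 'n) dec_thy"
  assumes \<phi>: "dec_morphism \<Theta> \<Theta>' \<phi>"
    and F': "theory_morphism (Theta_a \<Theta>) (Theta_a \<Theta>') (F'_exp_mor \<Theta> \<Theta>' \<phi>)"
  shows "mor_comp \<Theta> (F'_exp_mor \<Theta> \<Theta>' \<phi>) (J \<Theta>) = mor_comp \<Theta> (J \<Theta>') \<phi>"
proof (rule theory_morphism_eqI)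
  have dec: "decorated_theory \<Theta>" "decorated_theory \<Theta>'" and m: "theory_morphism \<Theta> \<Theta>' \<phi>"
    using \<phi> by (auto simp: dec_morphism_def)
  interpret exp_algebra \<Theta> "Theta_a \<Theta>" "pure_to_Theta_a \<Theta>" "expa_type \<Theta> ParTy" "\<lambda>f. expa_term \<Theta> (Prime f)"
    using dec(1) by (rule exp_algebra_Theta_a)
  note gens = F'_exp_mor_gens[OF \<phi>]
  show "theory_morphism \<Theta> (Theta_a \<Theta>') (mor_comp \<Theta> (F'_exp_mor \<Theta> \<Theta>' \<phi>) (J \<Theta>))"
    using J_morphism[OF dec(1)] F' by (rule theory_morphism_comp)
  show "theory_morphism \<Theta> (Theta_a \<Theta>') (mor_comp \<Theta> (J \<Theta>') \<phi>)"
    using m J_morphism[OF dec(2)] by (rule theory_morphism_comp)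
  have ty: "on_obj (F'_exp_mor \<Theta> \<Theta>' \<phi>) (expa_type \<Theta> (OldTy X)) = expa_type \<Theta>' (OldTy (on_obj \<phi> X))"
    if "X \<in> Obj \<Theta>" for X
    using gens(1)[of "OldTy X"] that by (simp add: exp_pres_def)
  show "on_obj (mor_comp \<Theta> (F'_exp_mor \<Theta> \<Theta>' \<phi>) (J \<Theta>)) X = on_obj (mor_comp \<Theta> (J \<Theta>') \<phi>) X" if "X \<in> Obj \<Theta>" for X
    using that ty theory_morphismD(5)[OF m that] by (simp add: J_def)
  fix f assume f: "f \<in> Arr \<Theta>"
  define X where "X = expa_type \<Theta> (OldTy (Dom \<Theta> f))"
  let ?T = "Theta_a \<Theta>" and ?F = "F'_exp_mor \<Theta> \<Theta>' \<phi>"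
  note D = dom_closed[OF f]
  have X: "X = on_obj (pure_to_Theta_a \<Theta>) (Dom \<Theta> f)" "X \<in> Obj ?T"
    using K_obj[OF D] D by (simp_all add: X_def pure_to_Theta_a_def)
  have bang: "tuple ?T X [] \<in> hom ?T X (Prd ?T [])"
    using T.tuple_hom[OF X(2), of "[]" "[]"] by simp
  note a = expa_const_hom[OF dec(1)]
  have ts: "list_all2 (\<lambda>f Y. f \<in> hom ?T X Y) [Comp ?T (expa_const \<Theta>) (tuple ?T X []), Ident ?T X]
      [expa_type \<Theta> ParTy, X]"
    using T.comp_hom[OF bang a] T.ident_hom[OF X(2)] by simp
  have p: "expa_term \<Theta> (Prime f) \<in> hom ?T (Prd ?T [expa_type \<Theta> ParTy, X])
      (on_obj (pure_to_Theta_a \<Theta>) (Cod \<Theta> f))"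
    unfolding X(1) by (rule p_hom) (simp add: f hom_iff)
  \<comment> \<open>The morphism is pushed inward through the outer composite and the pair, then
    through the two components of the pair; the map to the terminal type is the empty case of
    preservation of tuples.\<close>
  have "on_arr ?F (on_arr (J \<Theta>) f) = on_arr (J \<Theta>') (on_arr \<phi> f)"
    unfolding J_arr[OF dec(1) f, folded X_def] theory_morphism_comp_hom[OF F' T.tuple_hom[OF X(2) ts] p]
      theory_morphism_tuple[OF F' X(2) ts]
    using theory_morphism_comp_hom[OF F' bang a] theory_morphism_tuple[OF F' X(2), of "[]" "[]"]
      theory_morphismD(7)[OF F' X(2)] gens(2)[of "Prime f"] gens(3) ty[OF D] f
      J_arr[OF dec(2), of "on_arr \<phi> f"] theory_morphismD(6)[OF m f]
    by (simp add: exp_pres_def X_def hom_iff)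
  then show "on_arr (mor_comp \<Theta> ?F (J \<Theta>)) f = on_arr (mor_comp \<Theta> (J \<Theta>') \<phi>) f"
    using f by simp
qed

lemma mor_comp_H_obj [simp]: "mor_comp (H_obj \<Theta>) = mor_comp \<Theta>"
  by (simp add: mor_comp_def fun_eq_iff)

lemma mor_id_H_obj [simp]: "mor_id (H_obj \<Theta>) = mor_id \<Theta>"
  by (simp add: mor_id_def)

theorem theorem3p9:
  shows
    \<comment> \<open>\<open>H\<close> and \<open>U' \<circ> F'\<^sub>e\<^sub>x\<^sub>p\<close> are functors from decorated theories to theories\<close>
    "(\<forall>\<Theta> :: ('o, 'm) dec_thy. decorated_theory \<Theta> \<longrightarrow>
        eq_theory (H_obj \<Theta>) \<and>
        coslice_object Pi_a (F'_exp_obj \<Theta>) \<and> eq_theory (U'_obj (F'_exp_obj \<Theta>)) \<and>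
        H_mor (mor_id \<Theta>) = mor_id (H_obj \<Theta>) \<and>
        U'_mor (F'_exp_mor \<Theta> \<Theta> (mor_id \<Theta>)) = mor_id (U'_obj (F'_exp_obj \<Theta>))) \<and>
     (\<forall>(\<Theta> :: ('o, 'm) dec_thy) (\<Theta>' :: ('p, 'n) dec_thy) \<phi>. dec_morphism \<Theta> \<Theta>' \<phi> \<longrightarrow>
        theory_morphism (H_obj \<Theta>) (H_obj \<Theta>') (H_mor \<phi>) \<and>
        coslice_morphism Pi_a (F'_exp_obj \<Theta>) (F'_exp_obj \<Theta>') (F'_exp_mor \<Theta> \<Theta>' \<phi>) \<and>
        theory_morphism (U'_obj (F'_exp_obj \<Theta>)) (U'_obj (F'_exp_obj \<Theta>'))
          (U'_mor (F'_exp_mor \<Theta> \<Theta>' \<phi>))) \<and>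
     (\<forall>(\<Theta> :: ('o, 'm) dec_thy) (\<Theta>' :: ('p, 'n) dec_thy) (\<Theta>'' :: ('q, 'k) dec_thy) \<phi> \<psi>.
        dec_morphism \<Theta> \<Theta>' \<phi> \<and> dec_morphism \<Theta>' \<Theta>'' \<psi> \<longrightarrow>
        H_mor (mor_comp \<Theta> \<psi> \<phi>) = mor_comp (H_obj \<Theta>) (H_mor \<psi>) (H_mor \<phi>) \<and>
        U'_mor (F'_exp_mor \<Theta> \<Theta>'' (mor_comp \<Theta> \<psi> \<phi>)) =
          mor_comp (U'_obj (F'_exp_obj \<Theta>))
            (U'_mor (F'_exp_mor \<Theta>' \<Theta>'' \<psi>)) (U'_mor (F'_exp_mor \<Theta> \<Theta>' \<phi>))) \<and>
    \<comment> \<open>the components of \<open>J\<close> are morphisms of theories, under \<open>\<Theta>\<^sub>0\<close>\<close>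
     (\<forall>\<Theta> :: ('o, 'm) dec_thy. decorated_theory \<Theta> \<longrightarrow>
        theory_morphism (H_obj \<Theta>) (U'_obj (F'_exp_obj \<Theta>)) (J \<Theta>) \<and>
        mor_comp (pure_part \<Theta>) (J \<Theta>) (pure_incl \<Theta>) = pure_to_Theta_a \<Theta>) \<and>
    \<comment> \<open>naturality\<close>
     (\<forall>(\<Theta> :: ('o, 'm) dec_thy) (\<Theta>' :: ('p, 'n) dec_thy) \<phi>. dec_morphism \<Theta> \<Theta>' \<phi> \<longrightarrow>
        mor_comp (H_obj \<Theta>) (U'_mor (F'_exp_mor \<Theta> \<Theta>' \<phi>)) (J \<Theta>) =
        mor_comp (H_obj \<Theta>) (J \<Theta>') (H_mor \<phi>))"
proof (intro conjI allI impI)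
  fix \<Theta> :: "('o, 'm) dec_thy"
  assume dec: "decorated_theory \<Theta>"
  interpret decorated_theory \<Theta> by fact
  note obj = F_exp_coslice_object[OF dec]
  have fst: "fst (F_exp_obj \<Theta>) = presented (exp_pres \<Theta>)"
    by (simp add: F_exp_obj_def)
  show "eq_theory (H_obj \<Theta>)"
    using eq_theory_axioms by simp
  show "coslice_object Pi_a (F'_exp_obj \<Theta>)"
    unfolding F'_exp_obj_def using obj by (rule coslice_object_add_const)
  then show "eq_theory (U'_obj (F'_exp_obj \<Theta>))"
    unfolding coslice_object_def U'_obj_def by (rule theory_morphismD(2))
  show "H_mor (mor_id \<Theta>) = mor_id (H_obj \<Theta>)"
    by (simp add: H_mor_def)
  \<comment> \<open>The identity on the parameterized theory is the image of the identity decorated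
    morphism, so its triangle under \<open>Pi_A\<close> is already known.\<close>
  have "coslice_morphism Pi_A (F_exp_obj \<Theta>) (F_exp_obj \<Theta>) (mor_id (fst (F_exp_obj \<Theta>)))"
    using F_exp_coslice_morphism[OF dec_morphism_id[OF dec]] by (simp add: F_exp_mor_id[OF dec] fst)
  from add_const_mor_id[OF obj this]
  show "U'_mor (F'_exp_mor \<Theta> \<Theta> (mor_id \<Theta>)) = mor_id (U'_obj (F'_exp_obj \<Theta>))"
    by (simp add: U'_mor_def U'_obj_def F'_exp_mor_def F'_exp_obj_def F_exp_mor_id[OF dec] fst)
  show "theory_morphism (H_obj \<Theta>) (U'_obj (F'_exp_obj \<Theta>)) (J \<Theta>)"
    using J_morphism[OF dec] by (simp add: Theta_a_def)
  show "mor_comp (pure_part \<Theta>) (J \<Theta>) (pure_incl \<Theta>) = pure_to_Theta_a \<Theta>"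
    by (simp add: mor_comp_def compose_def pure_to_Theta_a_def J_pure[OF dec] cong: restrict_cong)
      (simp add: J_def cong: restrict_cong)
next
  fix \<Theta> :: "('o, 'm) dec_thy" and \<Theta>' :: "('p, 'n) dec_thy" and \<phi>
  assume \<phi>: "dec_morphism \<Theta> \<Theta>' \<phi>"
  then show "theory_morphism (H_obj \<Theta>) (H_obj \<Theta>') (H_mor \<phi>)"
    by (simp add: H_mor_def dec_morphism_def)
  show "coslice_morphism Pi_a (F'_exp_obj \<Theta>) (F'_exp_obj \<Theta>') (F'_exp_mor \<Theta> \<Theta>' \<phi>)"
    unfolding F'_exp_obj_def F'_exp_mor_def
    using F_exp_coslice_morphism[OF \<phi>] by (rule coslice_morphism_add_const)
  then show mor: "theory_morphism (U'_obj (F'_exp_obj \<Theta>)) (U'_obj (F'_exp_obj \<Theta>'))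
      (U'_mor (F'_exp_mor \<Theta> \<Theta>' \<phi>))"
    by (simp add: coslice_morphism_def U'_obj_def U'_mor_def)
  show "mor_comp (H_obj \<Theta>) (U'_mor (F'_exp_mor \<Theta> \<Theta>' \<phi>)) (J \<Theta>) = mor_comp (H_obj \<Theta>) (J \<Theta>') (H_mor \<phi>)"
    using J_natural[OF \<phi>] mor by (simp add: Theta_a_def U'_mor_def H_mor_def)
next
  fix \<Theta> :: "('o, 'm) dec_thy" and \<Theta>' :: "('p, 'n) dec_thy" and \<Theta>'' :: "('q, 'k) dec_thy" and \<phi> \<psi>
  assume "dec_morphism \<Theta> \<Theta>' \<phi> \<and> dec_morphism \<Theta>' \<Theta>'' \<psi>"
  then have \<phi>: "dec_morphism \<Theta> \<Theta>' \<phi>" and \<psi>: "dec_morphism \<Theta>' \<Theta>'' \<psi>"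
    by auto
  show "H_mor (mor_comp \<Theta> \<psi> \<phi>) = mor_comp (H_obj \<Theta>) (H_mor \<psi>) (H_mor \<phi>)"
    by (simp add: H_mor_def)
  have fst: "fst (F_exp_obj \<Theta>) = presented (exp_pres \<Theta>)"
    by (simp add: F_exp_obj_def)
  have "coslice_morphism Pi_A (F_exp_obj \<Theta>) (F_exp_obj \<Theta>'')
      (mor_comp (fst (F_exp_obj \<Theta>)) (F_exp_mor \<Theta>' \<Theta>'' \<psi>) (F_exp_mor \<Theta> \<Theta>' \<phi>))"
    using F_exp_coslice_morphism[OF dec_morphism_comp[OF \<phi> \<psi>]] by (simp add: F_exp_mor_comp[OF \<phi> \<psi>] fst)
  from add_const_mor_comp[OF F_exp_coslice_morphism[OF \<phi>] F_exp_coslice_morphism[OF \<psi>] this]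
  show "U'_mor (F'_exp_mor \<Theta> \<Theta>'' (mor_comp \<Theta> \<psi> \<phi>)) = mor_comp (U'_obj (F'_exp_obj \<Theta>))
      (U'_mor (F'_exp_mor \<Theta>' \<Theta>'' \<psi>)) (U'_mor (F'_exp_mor \<Theta> \<Theta>' \<phi>))"
    by (simp add: U'_mor_def U'_obj_def F'_exp_mor_def F'_exp_obj_def F_exp_mor_comp[OF \<phi> \<psi>] fst)
qed

end
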